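(* Let $(M^8,g,\rho)$ be a non-integrable $\mathrm{PSU}(3)$-structure of type $\mathcal{W}_1\oplus\mathcal{W}_2\oplus\mathcal{W}_3\oplus\mathcal{W}_4\oplus\mathcal{W}_5$ with parallel characteristic torsion $\mathcal{T}^c$. Then its characteristic connection $\nabla^c$ is an Ambrose–Singer connection, i.e. $$\nabla^c\mathcal{T}^c=0,\qquad\nabla^c\mathcal{R}^c=0 .$$
   Context: Algebraic setting. $\mathbb{R}^8$ is oriented Euclidean space, identified with its dual; $(e_1,\dots,e_8)$ is an oriented orthonormal basis, $e_{i_1\dots i_j}=e_{i_1}\wedge\dots\wedge e_{i_j}$, $\Lambda^k$ the space of $k$-forms. For $\alpha\in\Lambda^k,\beta\in\Lambda^l$ put $\sigma_0(\alpha,\beta)=\alpha\wedge\beta$ and $\sigma_j(\alpha,\beta)=\sum_{i_1<\dots<i_j}(e_{i_1}\lrcorner\cdots\lrcorner e_{i_j}\lrcorner\alpha)\wedge(e_{i_1}\lrcorner\cdots\lrcorner e_{i_j}\lrcorner\beta)$. For $k\le l$ the contraction is $\alpha\lrcorner\beta=\sigma_k(\alpha,\beta)$; $\ast$ is the Hodge operator. Let $$(\star)\quad\rho=e_{246}-e_{235}-e_{145}-e_{136}+(e_{12}+e_{34}-2e_{56})\wedge e_7+\sqrt3\,(e_{12}-e_{34})\wedge e_8 ,$$ $\mathrm{PSU}(3)\subset\mathrm{SO}(8)$ its isotropy group, $\sigma_+(\alpha)=\sigma_1(\rho,\alpha)$. Modules: $\Lambda^2_8=\sigma_+(\Lambda^1)$,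 $\Lambda^2_{20}=\{\omega\in\Lambda^2\mid\omega\wedge\ast\rho=0\}$, $\Lambda^3_8=\{\ast(\omega\wedge\rho)\mid\omega\in\Lambda^2_8\}$, $\Lambda^3_{20}=\sigma_+(\Lambda^2_{20})$, $\Lambda^3_{27}=\{T\in\Lambda^3\mid T\wedge\rho=0,\ T\wedge\ast\rho=0\}$, $\Lambda^4_8=\sigma_+(\Lambda^3_8)$, $\Lambda^4_{27}=\sigma_+(\Lambda^3_{27})$. With $\mathfrak{so}(8)=\Lambda^2$ one has $\mathfrak{psu}(3)=\Lambda^2_8$; let $\mathfrak m=\Lambda^2_{20}$ be its orthogonal complement and $\mathrm{pr}_{\mathfrak m}$ the projection. Maps: $\Phi_1(X\otimes\omega)=X\wedge\omega$ and $\Phi_2(X\otimes\omega)=(X\lrcorner\rho)\wedge\omega$ on $\mathbb{R}^8\otimes\mathfrak m$; $\Theta_1(T)=-\frac12\sum_i e_i\otimes\mathrm{pr}_{\mathfrak m}(e_i\lrcorner T)$ for $T\in\Lambda^3$; $\Theta_2(F)=-\sum_i e_i\otimes\mathrm{pr}_{\mathfrak m}((e_i\lrcorner\rho)\lrcorner F)$ for $F\in\Lambda^4$. Put $\mathcal{W}_1=\Theta_1(\Lambda^3_8)$, $\mathcal{W}_2=\Theta_1(\Lambda^3_{20})$, $\mathcal{W}_3=\Theta_1(\Lambda^3_{27})$, $\mathcal{W}_4=\Theta_2(\ast\Lambda^4_8)$, $\mathcal{W}_5=\Theta_2(\ast\Lambda^4_{27})$, $\mathcal{W}_6=\mathrm{Ker}(\Phi_1)\cap\mathrm{Ker}(\Phi_2)$;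 then $\mathbb{R}^8\otimes\mathfrak m=\mathcal{W}_1\oplus\dots\oplus\mathcal{W}_6$. Geometric setting. A $\mathrm{PSU}(3)$-structure $(M^8,g,\rho)$ is an (oriented) Riemannian 8-manifold with a 3-form $\rho$ such that at every point there is an oriented orthonormal frame (an adapted frame) realizing $(\star)$; the operators $\sigma_j,\sigma_+,\ast$, the modules $\Lambda^k_i$ and $\mathfrak m$, the maps $\Phi_1,\Phi_2,\Theta_1,\Theta_2$ and the spaces $\mathcal{W}_1,\dots,\mathcal{W}_6$ are applied pointwise in adapted frames. Let $\Omega^g=(\omega^g_{ij})$, $\omega^g_{ij}=g(\nabla^g e_i,e_j)$, in an adapted frame. The intrinsic torsion is $\Gamma=\mathrm{pr}_{\mathfrak m}(\Omega^g)=\Gamma_1+\dots+\Gamma_6$, $\Gamma_i\in\mathcal{W}_i$. The structure is integrable if $\Gamma=0$, and of type $\mathcal{W}_{i_1}\oplus\dots\oplus\mathcal{W}_{i_j}$ if $\Gamma\in\mathcal{W}_{i_1}\oplus\dots\oplus\mathcal{W}_{i_j}$. The characteristic forms are $T^c\in\Lambda^3_8\oplus\Lambda^3_{20}\oplus\Lambda^3_{27}$ with $\Theta_1(T^c)=\Gamma_1+\Gamma_2+\Gamma_3$ and $F^c\in\ast\Lambda^4_8\oplus\ast\Lambda^4_{27}$ with $\Theta_2(F^c)=\Gamma_4+\Gamma_5$. For a structure of type $\mathcal{W}_1\oplus\dots\oplus\mathcal{W}_5$ the characteristic connection $\nabla^c$ is the metric connection $g(\nabla^c_XY,Z)=g(\nabla^g_XY,Z)+\frac12T^c(X,Y,Z)+((X\lrcorner\rho)\lrcorner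 F^c)(Y,Z)$ (it satisfies $\nabla^c\rho=0$), with characteristic torsion $\mathcal{T}^c(X,Y,Z)=g(\nabla^c_XY-\nabla^c_YX-[X,Y],Z)$ and curvature tensor $\mathcal{R}^c(X,Y,Z,V)=g(\nabla^c_X\nabla^c_YZ-\nabla^c_Y\nabla^c_XZ-\nabla^c_{[X,Y]}Z,V)$. Parallel characteristic torsion means $\nabla^c\mathcal{T}^c=0$. *)

theory Defs
  imports "HOL-Analysis.Analysis"
begin

section \<open>The exterior algebra of \<open>\<real>\<^sup>8\<close>\<close>

text \<open>
  A form is the vector of its coefficients with respect to \<open>e_I = e_{i_1} \<and> \<dots> \<and> e_{i_k}\<close>,
  where \<open>I = {i_1 < \<dots> < i_k}\<close>. The type \<open>8\<close> has the elements \<open>0 < 1 < \<dots> < 7\<close>; the vector called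
  \<open>e_n\<close> in the mathematics (\<open>1 \<le> n \<le> 8\<close>) has index \<open>n - 1\<close>. The standard inner product of this
  vector type is the one for which the \<open>e_I\<close> are orthonormal.
\<close>

type_synonym R8 = "real ^ 8"
type_synonym form = "(real, 8 set) vec"

definition Lam :: "nat \<Rightarrow> form set" where
  "Lam k = {\<alpha>. \<forall>I. card I \<noteq> k \<longrightarrow> \<alpha> $ I = 0}"

text \<open>\<open>e_I \<and> e_J = shuffle_sign I J e_{I \<union> J}\<close> for disjoint \<open>I\<close>, \<open>J\<close>.\<close>

definition shuffle_sign :: "8 set \<Rightarrow> 8 set \<Rightarrow> real" where
  "shuffle_sign I J = (- 1) ^ card {(i, j). i \<in> I \<and> j \<in> J \<and> j < i}"

definition wedge :: "form \<Rightarrow> form \<Rightarrow> form"  (infixr \<open>\<and>\<^sub>f\<close> 72) where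
  "\<alpha> \<and>\<^sub>f \<beta> = (\<chi> K. \<Sum>I\<in>Pow K. shuffle_sign I (K - I) * \<alpha> $ I * \<beta> $ (K - I))"

definition one_form :: "R8 \<Rightarrow> form" where
  "one_form X = (\<Sum>i\<in>UNIV. X $ i *\<^sub>R axis {i} 1)"

definition hook :: "R8 \<Rightarrow> form \<Rightarrow> form" where
  "hook X \<alpha> = (\<chi> K. \<Sum>i\<in>- K. X $ i * (- 1) ^ card {j \<in> K. j < i} * \<alpha> $ insert i K)"

text \<open>\<open>form_eval \<alpha> [X, Y, \<dots>] = \<alpha>(X, Y, \<dots>)\<close> for a form whose degree is the length of the list.\<close>

definition form_eval :: "form \<Rightarrow> R8 list \<Rightarrow> real" where
  "form_eval \<alpha> Xs = fold hook Xs \<alpha> $ {}"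

text \<open>Characterised by \<open>\<alpha> \<and> \<star>\<beta> = \<langle>\<alpha>, \<beta>\<rangle> e_{12345678}\<close> for \<open>\<alpha>\<close>, \<open>\<beta>\<close> of the same degree.\<close>

definition hodge :: "form \<Rightarrow> form" where
  "hodge \<beta> = (\<chi> K. shuffle_sign (- K) K * \<beta> $ (- K))"

text \<open>\<open>e_{i_1} \<lrcorner> \<dots> \<lrcorner> e_{i_j} \<lrcorner> \<alpha>\<close> for \<open>I = {i_1 < \<dots> < i_j}\<close>.\<close>

definition hook_set :: "8 set \<Rightarrow> form \<Rightarrow> form" where
  "hook_set I \<alpha> = foldr (\<lambda>i. hook (axis i 1)) (sorted_list_of_set I) \<alpha>"

definition sigma :: "nat \<Rightarrow> form \<Rightarrow> form \<Rightarrow> form" where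
  "sigma j \<alpha> \<beta> = (\<Sum>I | card I = j. hook_set I \<alpha> \<and>\<^sub>f hook_set I \<beta>)"

definition e_wedge :: "nat list \<Rightarrow> form" where
  "e_wedge ns = foldr (\<lambda>n \<alpha>. one_form (axis (of_nat (n - 1)) 1) \<and>\<^sub>f \<alpha>) ns (axis {} 1)"

definition rho0 :: form where
  "rho0 = e_wedge [2,4,6] - e_wedge [2,3,5] - e_wedge [1,4,5] - e_wedge [1,3,6]
    + (e_wedge [1,2] + e_wedge [3,4] - 2 *\<^sub>R e_wedge [5,6]) \<and>\<^sub>f e_wedge [7]
    + sqrt 3 *\<^sub>R ((e_wedge [1,2] - e_wedge [3,4]) \<and>\<^sub>f e_wedge [8])"

definition sigma_plus :: "form \<Rightarrow> form" where
  "sigma_plus \<alpha> = sigma 1 rho0 \<alpha>"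


section \<open>Modules of forms and of intrinsic torsion\<close>

definition Lam2_8 :: "form set" where "Lam2_8 = sigma_plus ` Lam 1"

definition Lam2_20 :: "form set" where
  "Lam2_20 = {\<omega> \<in> Lam 2. \<omega> \<and>\<^sub>f hodge rho0 = 0}"

definition Lam3_8 :: "form set" where "Lam3_8 = {hodge (\<omega> \<and>\<^sub>f rho0) | \<omega>. \<omega> \<in> Lam2_8}"

definition Lam3_20 :: "form set" where "Lam3_20 = sigma_plus ` Lam2_20"

definition Lam3_27 :: "form set" where
  "Lam3_27 = {T \<in> Lam 3. T \<and>\<^sub>f rho0 = 0 \<and> T \<and>\<^sub>f hodge rho0 = 0}"

definition Lam4_8 :: "form set" where "Lam4_8 = sigma_plus ` Lam3_8"

definition Lam4_27 :: "form set" where "Lam4_27 = sigma_plus ` Lam3_27"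

definition pr_m :: "form \<Rightarrow> form" where
  "pr_m \<omega> = (THE \<eta>. \<eta> \<in> Lam2_20 \<and> (\<forall>\<zeta>\<in>Lam2_20. (\<omega> - \<eta>) \<bullet> \<zeta> = 0))"

text \<open>An element \<open>\<Sum>_i e_i \<otimes> \<omega>_i\<close> of \<open>\<real>\<^sup>8 \<otimes> \<Lambda>\<close> is the vector of the forms \<open>\<omega>_i\<close>.\<close>

type_synonym tform = "form ^ 8"

definition R8_tensor_m :: "tform set" where
  "R8_tensor_m = {G. \<forall>i. G $ i \<in> Lam2_20}"

definition Phi1 :: "tform \<Rightarrow> form" where
  "Phi1 G = (\<Sum>i\<in>UNIV. one_form (axis i 1) \<and>\<^sub>f G $ i)"

definition Phi2 :: "tform \<Rightarrow> form" where
  "Phi2 G = (\<Sum>i\<in>UNIV. hook (axis i 1) rho0 \<and>\<^sub>f G $ i)"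

definition Theta1 :: "form \<Rightarrow> tform" where
  "Theta1 T = (\<chi> i. - (1/2) *\<^sub>R pr_m (hook (axis i 1) T))"

definition Theta2 :: "form \<Rightarrow> tform" where
  "Theta2 F = (\<chi> i. - pr_m (sigma 2 (hook (axis i 1) rho0) F))"

definition W :: "nat \<Rightarrow> tform set" where
  "W n =
    (if n = 1 then Theta1 ` Lam3_8
     else if n = 2 then Theta1 ` Lam3_20
     else if n = 3 then Theta1 ` Lam3_27
     else if n = 4 then Theta2 ` hodge ` Lam4_8
     else if n = 5 then Theta2 ` hodge ` Lam4_27
     else if n = 6 then {G \<in> R8_tensor_m. Phi1 G = 0 \<and> Phi2 G = 0}
     else {0})"

definition W_components :: "tform \<Rightarrow> (nat \<Rightarrow> tform) \<Rightarrow> bool" where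
  "W_components \<Gamma> G \<longleftrightarrow> (\<forall>i\<in>{1..6}. G i \<in> W i) \<and> \<Gamma> = (\<Sum>i=1..6. G i)"

definition characteristic_forms :: "(nat \<Rightarrow> tform) \<Rightarrow> form \<Rightarrow> form \<Rightarrow> bool" where
  "characteristic_forms G T F \<longleftrightarrow>
     T \<in> {a + b + c | a b c. a \<in> Lam3_8 \<and> b \<in> Lam3_20 \<and> c \<in> Lam3_27} \<and>
     Theta1 T = G 1 + G 2 + G 3 \<and>
     F \<in> {a + b | a b. a \<in> hodge ` Lam4_8 \<and> b \<in> hodge ` Lam4_27} \<and>
     Theta2 F = G 4 + G 5"


section \<open>Smooth 8-manifolds and tensor fields\<close>

text \<open>\<open>ck_on\<close> and \<open>smooth_on\<close> are meant for open sets only.\<close>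

primrec ck_on :: "nat \<Rightarrow> 'a::euclidean_space set \<Rightarrow> ('a \<Rightarrow> 'b::real_normed_vector) \<Rightarrow> bool" where
  "ck_on 0 U f \<longleftrightarrow> continuous_on U f"
| "ck_on (Suc k) U f \<longleftrightarrow>
     (\<forall>x\<in>U. f differentiable (at x)) \<and>
     (\<forall>v. ck_on k U (\<lambda>x. frechet_derivative f (at x) v))"

definition smooth_on :: "'a::euclidean_space set \<Rightarrow> ('a \<Rightarrow> 'b::real_normed_vector) \<Rightarrow> bool" where
  "smooth_on U f \<longleftrightarrow> (\<forall>k. ck_on k U f)"

type_synonym 'm chart = "'m set \<times> ('m \<Rightarrow> R8)"

definition img :: "'m chart \<Rightarrow> R8 set" where
  "img c = snd c ` fst c"

definition transition :: "'m chart \<Rightarrow> 'm chart \<Rightarrow> R8 \<Rightarrow> R8" where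
  "transition c d = snd d \<circ> inv_into (fst c) (snd c)"

definition overlap :: "'m chart \<Rightarrow> 'm chart \<Rightarrow> R8 set" where
  "overlap c d = snd c ` (fst c \<inter> fst d)"

definition jac :: "'m chart \<Rightarrow> 'm chart \<Rightarrow> R8 \<Rightarrow> R8 \<Rightarrow> R8" where
  "jac c d x = frechet_derivative (transition c d) (at x)"

text \<open>The orientation is the one in which all charts of the atlas are positively oriented.\<close>

definition oriented_manifold :: "'m topology \<Rightarrow> 'm chart set \<Rightarrow> bool" where
  "oriented_manifold M A \<longleftrightarrow>
     Hausdorff_space M \<and> second_countable M \<and>
     (\<Union>c\<in>A. fst c) = topspace M \<and>
     (\<forall>c\<in>A. openin M (fst c) \<and> open (img c) \<and>
        homeomorphic_map (subtopology M (fst c)) (top_of_set (img c)) (snd c)) \<and>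
     (\<forall>c\<in>A. \<forall>d\<in>A. smooth_on (overlap c d) (transition c d) \<and>
        (\<forall>x\<in>overlap c d. det (matrix (jac c d x)) > 0))"

text \<open>
  A covariant tensor field is given by its values \<open>S c x [u, v, \<dots>]\<close> at the point with coordinates
  \<open>x\<close> in the chart \<open>c\<close>, on the tangent vectors with components \<open>u, v, \<dots>\<close>.
\<close>

type_synonym 'm tensor = "'m chart \<Rightarrow> R8 \<Rightarrow> R8 list \<Rightarrow> real"

definition tensor_field :: "'m chart set \<Rightarrow> nat \<Rightarrow> 'm tensor \<Rightarrow> bool" where
  "tensor_field A k S \<longleftrightarrow>
     (\<forall>c\<in>A. \<forall>us. length us = k \<longrightarrow>
        smooth_on (img c) (\<lambda>x. S c x us) \<and>
        (\<forall>x\<in>img c. \<forall>i<k. linear (\<lambda>v. S c x (us[i := v])))) \<and>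
     (\<forall>c\<in>A. \<forall>d\<in>A. \<forall>x\<in>overlap c d. \<forall>us. length us = k \<longrightarrow>
        S c x us = S d (transition c d x) (map (jac c d x) us))"

definition riemannian_metric :: "'m chart set \<Rightarrow> 'm tensor \<Rightarrow> bool" where
  "riemannian_metric A g \<longleftrightarrow>
     tensor_field A 2 g \<and>
     (\<forall>c\<in>A. \<forall>x\<in>img c. (\<forall>u v. g c x [u, v] = g c x [v, u]) \<and>
                         (\<forall>u. u \<noteq> 0 \<longrightarrow> g c x [u, u] > 0))"

definition three_form :: "'m chart set \<Rightarrow> 'm tensor \<Rightarrow> bool" where
  "three_form A \<rho> \<longleftrightarrow>
     tensor_field A 3 \<rho> \<and>
     (\<forall>c\<in>A. \<forall>x\<in>img c. \<forall>u v.
        \<rho> c x [u, u, v] = 0 \<and> \<rho> c x [u, v, u] = 0 \<and> \<rho> c x [v, u, u] = 0)"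


section \<open>Affine connections\<close>

text \<open>
  An affine connection is given by its Christoffel maps \<open>D c x u v\<close>: in the chart \<open>c\<close>,
  \<open>\<nabla>_X Y = \<partial>_X Y + D c x X Y\<close>. The last condition is the transformation law under a change of
  charts that makes \<open>\<nabla>_X Y\<close> independent of the chart. In the functions below, vector fields on the
  domain of a chart are given by their components as functions of the coordinates.
\<close>

type_synonym 'm connection = "'m chart \<Rightarrow> R8 \<Rightarrow> R8 \<Rightarrow> R8 \<Rightarrow> R8"

definition affine_connection :: "'m chart set \<Rightarrow> 'm connection \<Rightarrow> bool" where
  "affine_connection A D \<longleftrightarrow>
     (\<forall>c\<in>A. (\<forall>x\<in>img c. bilinear (D c x)) \<and> (\<forall>u v. smooth_on (img c) (\<lambda>x. D c x u v))) \<and>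
     (\<forall>c\<in>A. \<forall>d\<in>A. \<forall>x\<in>overlap c d. \<forall>u v.
        jac c d x (D c x u v) =
          frechet_derivative (\<lambda>y. jac c d y v) (at x) u
          + D d (transition c d x) (jac c d x u) (jac c d x v))"

definition cov :: "'m connection \<Rightarrow> 'm chart \<Rightarrow> (R8 \<Rightarrow> R8) \<Rightarrow> (R8 \<Rightarrow> R8) \<Rightarrow> R8 \<Rightarrow> R8" where
  "cov D c X Y x = frechet_derivative Y (at x) (X x) + D c x (X x) (Y x)"

definition lie_bracket :: "(R8 \<Rightarrow> R8) \<Rightarrow> (R8 \<Rightarrow> R8) \<Rightarrow> R8 \<Rightarrow> R8" where
  "lie_bracket X Y x = frechet_derivative Y (at x) (X x) - frechet_derivative X (at x) (Y x)"

definition torsion ::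
  "'m connection \<Rightarrow> 'm chart \<Rightarrow> (R8 \<Rightarrow> R8) \<Rightarrow> (R8 \<Rightarrow> R8) \<Rightarrow> R8 \<Rightarrow> R8" where
  "torsion D c X Y x = cov D c X Y x - cov D c Y X x - lie_bracket X Y x"

definition curvature ::
  "'m connection \<Rightarrow> 'm chart \<Rightarrow> (R8 \<Rightarrow> R8) \<Rightarrow> (R8 \<Rightarrow> R8) \<Rightarrow> (R8 \<Rightarrow> R8) \<Rightarrow> R8 \<Rightarrow> R8" where
  "curvature D c X Y Z x =
     cov D c X (cov D c Y Z) x - cov D c Y (cov D c X Z) x - cov D c (lie_bracket X Y) Z x"

text \<open>
  Torsion and curvature are tensorial, so their components are obtained by evaluating them on
  the vector fields with constant components in the chart.
\<close>

definition torsion_tensor :: "'m tensor \<Rightarrow> 'm connection \<Rightarrow> 'm tensor" where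
  "torsion_tensor g D c x us =
     g c x [torsion D c (\<lambda>_. us ! 0) (\<lambda>_. us ! 1) x, us ! 2]"

definition curvature_tensor :: "'m tensor \<Rightarrow> 'm connection \<Rightarrow> 'm tensor" where
  "curvature_tensor g D c x us =
     g c x [curvature D c (\<lambda>_. us ! 0) (\<lambda>_. us ! 1) (\<lambda>_. us ! 2) x, us ! 3]"

text \<open>\<open>(\<nabla>_u S)(v_1, \<dots>, v_k) = \<partial>_u (S(v_1, \<dots>, v_k)) - \<Sum>_i S(v_1, \<dots>, \<nabla>_u v_i, \<dots>, v_k)\<close>
  for constant \<open>v_i\<close>.\<close>

definition cov_tensor :: "'m connection \<Rightarrow> 'm tensor \<Rightarrow> 'm chart \<Rightarrow> R8 \<Rightarrow> R8 \<Rightarrow> R8 list \<Rightarrow> real" where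
  "cov_tensor D S c x u vs =
     frechet_derivative (\<lambda>y. S c y vs) (at x) u
     - (\<Sum>i<length vs. S c x (vs[i := D c x u (vs ! i)]))"

definition parallel :: "'m chart set \<Rightarrow> 'm connection \<Rightarrow> nat \<Rightarrow> 'm tensor \<Rightarrow> bool" where
  "parallel A D k S \<longleftrightarrow>
     (\<forall>c\<in>A. \<forall>x\<in>img c. \<forall>u vs. length vs = k \<longrightarrow> cov_tensor D S c x u vs = 0)"

definition levi_civita :: "'m chart set \<Rightarrow> 'm tensor \<Rightarrow> 'm connection \<Rightarrow> bool" where
  "levi_civita A g D \<longleftrightarrow>
     affine_connection A D \<and>
     (\<forall>c\<in>A. \<forall>x\<in>img c. \<forall>u v. torsion D c (\<lambda>_. u) (\<lambda>_. v) x = 0) \<and>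
     parallel A D 2 g"


section \<open>\<open>PSU(3)\<close>-structures\<close>

definition adapted_frame :: "'m tensor \<Rightarrow> 'm tensor \<Rightarrow> 'm chart \<Rightarrow> R8 \<Rightarrow> (8 \<Rightarrow> R8) \<Rightarrow> bool" where
  "adapted_frame g \<rho> c x E \<longleftrightarrow>
     (\<forall>i j. g c x [E i, E j] = (if i = j then 1 else 0)) \<and>
     det (\<chi> i. E i) > 0 \<and>
     (\<forall>i j k. \<rho> c x [E i, E j, E k] = form_eval rho0 [axis i 1, axis j 1, axis k 1])"

definition psu3_structure ::
  "'m topology \<Rightarrow> 'm chart set \<Rightarrow> 'm tensor \<Rightarrow> 'm tensor \<Rightarrow> bool" where
  "psu3_structure M A g \<rho> \<longleftrightarrow>
     oriented_manifold M A \<and> riemannian_metric A g \<and> three_form A \<rho> \<and>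
     (\<forall>c\<in>A. \<forall>x\<in>img c. \<exists>E. adapted_frame g \<rho> c x E)"

definition local_adapted_frame ::
  "'m tensor \<Rightarrow> 'm tensor \<Rightarrow> 'm chart \<Rightarrow> R8 \<Rightarrow> (8 \<Rightarrow> R8 \<Rightarrow> R8) \<Rightarrow> bool" where
  "local_adapted_frame g \<rho> c x e \<longleftrightarrow>
     (\<exists>V. open V \<and> x \<in> V \<and> V \<subseteq> img c \<and> (\<forall>i. smooth_on V (e i)) \<and>
          (\<forall>y\<in>V. adapted_frame g \<rho> c y (\<lambda>i. e i y)))"

text \<open>
  \<open>connection_form g D c x e k\<close> is the value on \<open>e_k\<close> of the form \<open>(\<omega>_{ij})\<close>,
  \<open>\<omega>_{ij} = g(\<nabla>e_i, e_j)\<close>, where a skew matrix \<open>(a_{ij})\<close> is identified with the 2-form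
  \<open>\<Sum>_{i<j} a_{ij} e_{ij} = (1/2) \<Sum>_{i,j} a_{ij} e_{ij}\<close>.
\<close>

definition connection_form ::
  "'m tensor \<Rightarrow> 'm connection \<Rightarrow> 'm chart \<Rightarrow> R8 \<Rightarrow> (8 \<Rightarrow> R8 \<Rightarrow> R8) \<Rightarrow> 8 \<Rightarrow> form" where
  "connection_form g D c x e k =
     (1/2) *\<^sub>R (\<Sum>i\<in>UNIV. \<Sum>j\<in>UNIV.
        g c x [cov D c (e k) (e i) x, e j x] *\<^sub>R (one_form (axis i 1) \<and>\<^sub>f one_form (axis j 1)))"

definition intrinsic_torsion ::
  "'m tensor \<Rightarrow> 'm connection \<Rightarrow> 'm chart \<Rightarrow> R8 \<Rightarrow> (8 \<Rightarrow> R8 \<Rightarrow> R8) \<Rightarrow> tform" where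
  "intrinsic_torsion g Dg c x e = (\<chi> k. pr_m (connection_form g Dg c x e k))"

text \<open>
  The modules and maps above are invariant under the isotropy group of \<open>rho0\<close>, so the following
  pointwise conditions do not depend on the choice of the adapted frame. In these definitions
  \<open>Dg\<close> is the Levi-Civita connection.
\<close>

definition of_type ::
  "'m chart set \<Rightarrow> 'm tensor \<Rightarrow> 'm tensor \<Rightarrow> 'm connection \<Rightarrow> nat set \<Rightarrow> bool" where
  "of_type A g \<rho> Dg I \<longleftrightarrow>
     (\<forall>c\<in>A. \<forall>x\<in>img c. \<exists>e G.
        local_adapted_frame g \<rho> c x e \<and>
        W_components (intrinsic_torsion g Dg c x e) G \<and> (\<forall>i\<in>{1..6} - I. G i = 0))"

definition psu3_integrable ::
  "'m chart set \<Rightarrow> 'm tensor \<Rightarrow> 'm tensor \<Rightarrow> 'm connection \<Rightarrow> bool" where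
  "psu3_integrable A g \<rho> Dg \<longleftrightarrow>
     (\<forall>c\<in>A. \<forall>x\<in>img c. \<exists>e.
        local_adapted_frame g \<rho> c x e \<and> intrinsic_torsion g Dg c x e = 0)"

definition frame_components :: "'m tensor \<Rightarrow> 'm chart \<Rightarrow> R8 \<Rightarrow> (8 \<Rightarrow> R8 \<Rightarrow> R8) \<Rightarrow> R8 \<Rightarrow> R8" where
  "frame_components g c x e u = (\<chi> i. g c x [u, e i x])"

text \<open>
  The characteristic connection of a structure of type \<open>\<W>_1 \<oplus> \<dots> \<oplus> \<W>_5\<close> (whence \<open>G 6 = 0\<close>).
  The defining equation is imposed on the difference tensor, the derivatives of \<open>Y\<close> cancel.
  Since \<open>T\<close> and \<open>F\<close> are determined by the intrinsic torsion, \<open>Dc\<close> is unique on the chart images.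
\<close>

definition characteristic_connection ::
  "'m chart set \<Rightarrow> 'm tensor \<Rightarrow> 'm tensor \<Rightarrow> 'm connection \<Rightarrow> 'm connection \<Rightarrow> bool" where
  "characteristic_connection A g \<rho> Dg Dc \<longleftrightarrow>
     affine_connection A Dc \<and>
     (\<forall>c\<in>A. \<forall>x\<in>img c. \<exists>e G T F.
        local_adapted_frame g \<rho> c x e \<and>
        W_components (intrinsic_torsion g Dg c x e) G \<and> G 6 = 0 \<and>
        characteristic_forms G T F \<and>
        (\<forall>u v w. let X = frame_components g c x e u;
                     Y = frame_components g c x e v;
                     Z = frame_components g c x e w
                 in g c x [Dc c x u v, w] =
                      g c x [Dg c x u v, w] + 1/2 * form_eval T [X, Y, Z]
                      + form_eval (sigma 2 (hook X rho0) F) [Y, Z]))"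

definition ambrose_singer :: "'m chart set \<Rightarrow> 'm tensor \<Rightarrow> 'm connection \<Rightarrow> bool" where
  "ambrose_singer A g D \<longleftrightarrow>
     parallel A D 3 (torsion_tensor g D) \<and> parallel A D 4 (curvature_tensor g D)"

end

theory Submission
  imports Defs
begin

text \<open>
  Everything is pointwise algebra. The connection \<open>\<nabla>\<close> preserves \<open>g\<close> and \<open>\<rho>\<close>, so its curvature \<open>R\<close> and
  \<open>\<nabla>\<^bsub>X\<^esub> R\<close> take values in the skew derivations of the bracket defined by \<open>\<rho>\<close>, which are the inner ones
  since every closed 2-cochain is exact. As the torsion \<open>t\<close> is parallel, \<open>\<nabla>\<^bsub>X\<^esub> R\<close> satisfies the first
  Bianchi identity without torsion, and the only curvature operators with values in \<open>psu(3)\<close> that do so are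
  the multiples of the one of the symmetric space: \<open>(\<nabla>\<^bsub>X\<^esub> R)(Y, Z) = l(X) ad [Y, Z]\<close>. If \<open>l \<noteq> 0\<close>, then
  all of \<open>psu(3)\<close> annihilates \<open>t\<close>. For \<open>a\<close> in \<open>psu(3)\<close> the operator \<open>a \<cdot> R\<close> then also satisfies the first Bianchi
  identity without torsion and is a multiple of the same invariant tensor. Hence commutators annihilate
  \<open>R\<close>, and by perfectness all of \<open>psu(3)\<close> does. The second Bianchi identity now shows that the cyclic
  sum of \<open>l(X) [Y, Z]\<close> is invariant, which forces \<open>l = 0\<close>.
\<close>

section \<open>Curvature operators of the adjoint representation\<close>

text \<open>That the connection preserves \<rho> is where the choice of \<open>T\<close> and
  \<open>F\<close> enters. In an adapted frame the Levi-Civita form and the contorsion have opposite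
  components in \<open>Lam2_20\<close>; the factors in \<open>Theta1\<close> and
  \<open>Theta2\<close> are made for this. What remains is orthogonal to \<open>Lam2_20\<close>,
  hence a combination of the forms \<open>hook (axis k 1) rho0\<close>, and as operators these are
  the brackets with the frame vectors. The first Bianchi identity alone cannot kill the derivative
  of the curvature, since by Jacobi the symmetric-space tensor ad [Y, Z] satisfies it as well. This
  one-dimensional family is the whole obstacle. Once \<open>t\<close> and \<open>R\<close> are
  invariant, applying a to the second Bianchi identity leaves the cyclic sum of l([a, X]) [Y, Z]
  equal to zero. So l vanishes on commutators, and these span psu(3). The facts about psu(3) that
  are used (second cohomology, uniqueness of the curvature tensor, perfectness) are finite linear
  systems in a basis, and are solved there instead of being drawn from representation
  theory.\<close>

lemma exhaust_8: "x = 0 \<or> x = 1 \<or> x = 2 \<or> x = 3 \<or> x = 4 \<or> x = 5 \<or> x = 6 \<or> x = 7" for x :: 8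
proof (induct x)
  case (of_int z)
  then have "z = 0 \<or> z = 1 \<or> z = 2 \<or> z = 3 \<or> z = 4 \<or> z = 5 \<or> z = 6 \<or> z = 7"
    by fastforce
  then show ?case by auto
qed

lemma forall_8: "(\<forall>i::8. P i) \<longleftrightarrow> P 0 \<and> P 1 \<and> P 2 \<and> P 3 \<and> P 4 \<and> P 5 \<and> P 6 \<and> P 7"
  by (metis exhaust_8)

lemma UNIV_8: "UNIV = {0, 1, 2, 3, 4, 5, 6, 7 :: 8}"
  using exhaust_8 by auto

lemma sum_8: "sum f (UNIV :: 8 set) = f 0 + f 1 + f 2 + f 3 + f 4 + f 5 + f 6 + f 7"
  unfolding UNIV_8 by (simp add: ac_simps)

text \<open>Reduces a symmetric statement about pairs of basis vectors to the diagonal and 28 pairs,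
  the form in which the linear systems below are solved.\<close>

lemma pairs_8:
  assumes "\<And>i. Q i i" "\<And>i j. Q i j \<Longrightarrow> Q j i"
    and "Q 0 1" "Q 0 2" "Q 0 3" "Q 0 4" "Q 0 5" "Q 0 6" "Q 0 7"
    and "Q 1 2" "Q 1 3" "Q 1 4" "Q 1 5" "Q 1 6" "Q 1 7"
    and "Q 2 3" "Q 2 4" "Q 2 5" "Q 2 6" "Q 2 7"
    and "Q 3 4" "Q 3 5" "Q 3 6" "Q 3 7"
    and "Q 4 5" "Q 4 6" "Q 4 7"
    and "Q 5 6" "Q 5 7"
    and "Q 6 7"
  shows "Q (i::8) (j::8)"
proof -
  have "\<forall>i j. Q i j"
    unfolding forall_8 by (intro conjI; (rule assms(1) | fact | rule assms(2), fact))
  then show ?thesis by blast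
qed

lemma bilinear_zero: "bilinear f \<Longrightarrow> f 0 y = 0" "bilinear f \<Longrightarrow> f x 0 = 0"
  by (auto simp: bilinear_lzero bilinear_rzero)

lemmas bilinear_simps = bilinear_zero bilinear_ladd bilinear_radd bilinear_lsub bilinear_rsub
  bilinear_lneg bilinear_rneg bilinear_lmul bilinear_rmul

text \<open>\<open>b 0, \<dots>, b 7\<close> are \<open>e_1, \<dots>, e_7, \<surd>3 e_8\<close>: with this scaling all structure constants
  are integers.\<close>

locale psu3_algebra =
  fixes ip :: "'v::real_vector \<Rightarrow> 'v \<Rightarrow> real"
    and br :: "'v \<Rightarrow> 'v \<Rightarrow> 'v"
    and b :: "8 \<Rightarrow> 'v"
  assumes bilinear_ip: "bilinear ip"
    and ip_sym: "ip x y = ip y x"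
    and ip_b: "ip (b i) (b j) = (if i = j then if i = 7 then 3 else 1 else 0)"
    and expand_b: "x = (\<Sum>i\<in>UNIV. (ip x (b i) / ip (b i) (b i)) *\<^sub>R b i)"
    and bilinear_br: "bilinear br"
    and br_skew: "br x y = - br y x"
    and ip_br: "ip (br x y) z = ip x (br y z)"
    and br_b:
      "br (b 0) (b 1) = b 6 + b 7" "br (b 0) (b 2) = - b 5"
      "br (b 0) (b 3) = - b 4" "br (b 0) (b 4) = b 3"
      "br (b 0) (b 5) = b 2" "br (b 0) (b 6) = - b 1"
      "br (b 0) (b 7) = - (3 *\<^sub>R b 1)" "br (b 1) (b 2) = - b 4"
      "br (b 1) (b 3) = b 5" "br (b 1) (b 4) = b 2"
      "br (b 1) (b 5) = - b 3" "br (b 1) (b 6) = b 0"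
      "br (b 1) (b 7) = 3 *\<^sub>R b 0" "br (b 2) (b 3) = b 6 - b 7"
      "br (b 2) (b 4) = - b 1" "br (b 2) (b 5) = - b 0"
      "br (b 2) (b 6) = - b 3" "br (b 2) (b 7) = 3 *\<^sub>R b 3"
      "br (b 3) (b 4) = - b 0" "br (b 3) (b 5) = b 1"
      "br (b 3) (b 6) = b 2" "br (b 3) (b 7) = - (3 *\<^sub>R b 2)"
      "br (b 4) (b 5) = - (2 *\<^sub>R b 6)" "br (b 4) (b 6) = 2 *\<^sub>R b 5"
      "br (b 4) (b 7) = 0" "br (b 5) (b 6) = - (2 *\<^sub>R b 4)"
      "br (b 5) (b 7) = 0" "br (b 6) (b 7) = 0"
begin

section \<open>Linear algebra in the basis, perfectness and the Jacobi identity\<close>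

lemmas ip_simps = bilinear_simps[OF bilinear_ip]
lemmas br_simps = bilinear_simps[OF bilinear_br]

lemma br_self [simp]: "br x x = 0"
  using br_skew[of x x] by (simp add: eq_neg_iff_add_eq_0 flip: scaleR_2)

lemma br_b_swap:
  "br (b 1) (b 0) = - br (b 0) (b 1)" "br (b 2) (b 0) = - br (b 0) (b 2)"
  "br (b 3) (b 0) = - br (b 0) (b 3)" "br (b 4) (b 0) = - br (b 0) (b 4)"
  "br (b 5) (b 0) = - br (b 0) (b 5)" "br (b 6) (b 0) = - br (b 0) (b 6)"
  "br (b 7) (b 0) = - br (b 0) (b 7)" "br (b 2) (b 1) = - br (b 1) (b 2)"
  "br (b 3) (b 1) = - br (b 1) (b 3)" "br (b 4) (b 1) = - br (b 1) (b 4)"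
  "br (b 5) (b 1) = - br (b 1) (b 5)" "br (b 6) (b 1) = - br (b 1) (b 6)"
  "br (b 7) (b 1) = - br (b 1) (b 7)" "br (b 3) (b 2) = - br (b 2) (b 3)"
  "br (b 4) (b 2) = - br (b 2) (b 4)" "br (b 5) (b 2) = - br (b 2) (b 5)"
  "br (b 6) (b 2) = - br (b 2) (b 6)" "br (b 7) (b 2) = - br (b 2) (b 7)"
  "br (b 4) (b 3) = - br (b 3) (b 4)" "br (b 5) (b 3) = - br (b 3) (b 5)"
  "br (b 6) (b 3) = - br (b 3) (b 6)" "br (b 7) (b 3) = - br (b 3) (b 7)"
  "br (b 5) (b 4) = - br (b 4) (b 5)" "br (b 6) (b 4) = - br (b 4) (b 6)"
  "br (b 7) (b 4) = - br (b 4) (b 7)" "br (b 6) (b 5) = - br (b 5) (b 6)"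
  "br (b 7) (b 5) = - br (b 5) (b 7)" "br (b 7) (b 6) = - br (b 6) (b 7)"
  by (rule br_skew)+

lemma span_b: "span (range b) = UNIV"
proof (intro UNIV_eq_I[symmetric])
  fix x
  have "(\<Sum>i\<in>UNIV. (ip x (b i) / ip (b i) (b i)) *\<^sub>R b i) \<in> span (range b)"
    by (intro span_sum span_scale span_base rangeI)
  then show "x \<in> span (range b)"
    by (simp flip: expand_b)
qed

lemma bilinear_eqI:
  assumes "bilinear f" "bilinear h" "\<And>i j. f (b i) (b j) = h (b i) (b j)"
  shows "f x y = h x y"
  by (rule bilinear_eq[OF assms(1,2), of UNIV "range b" UNIV "range b"]) (auto simp: span_b assms(3))

lemma linear_eqI:
  assumes "linear f" "linear h" "\<And>i. f (b i) = h (b i)"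
  shows "f x = h x"
  by (rule linear_eq_on[OF assms(1,2), of x "range b"]) (auto simp: span_b assms(3))

lemma ip_eqI:
  assumes "\<And>z. ip x z = ip y z"
  shows "x = y"
  using expand_b[of x] expand_b[of y] by (simp only: assms)

text \<open>Perfectness of psu(3) as an induction rule: every \<open>b i\<close> is a multiple of a
  bracket or, for \<open>b 7\<close>, a combination of two brackets.\<close>

lemma br_span_induct:
  assumes "\<And>x y. P (br x y)" "\<And>x y. P x \<Longrightarrow> P y \<Longrightarrow> P (x + y)" "\<And>c x. P x \<Longrightarrow> P (c *\<^sub>R x)"
  shows "P v"
proof -
  have "b 0 = br (b 1) (b 6)" "b 1 = br (b 6) (b 0)" "b 2 = br (b 0) (b 5)" "b 3 = br (b 0) (b 4)"
    "b 4 = br (b 3) (b 0)" "b 5 = br (b 2) (b 0)" "b 6 = (-1/2) *\<^sub>R br (b 4) (b 5)"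
    "b 7 = br (b 0) (b 1) + (1/2) *\<^sub>R br (b 4) (b 5)"
    by (simp_all add: br_b br_b_swap br_simps)
  then have "P (b i)" for i
    using assms exhaust_8[of i] by metis
  moreover have "P 0"
    using assms(1)[of 0 0] by (simp add: br_simps)
  moreover have "P (sum f I)" if "\<And>i. P (f i)" "finite I" for f and I :: "8 set"
    using that(2) by induct (use that(1) assms(2) \<open>P 0\<close> in auto)
  ultimately have "P (\<Sum>i\<in>UNIV. (ip v (b i) / ip (b i) (b i)) *\<^sub>R b i)"
    by (simp add: assms(3))
  then show ?thesis
    by (simp flip: expand_b)
qed

text \<open>The elements acting as derivations form a subalgebra, and \<open>b 0\<close>, \<open>b 2\<close>, \<open>b 4\<close> generate
  the whole algebra.\<close>

lemma jacobi: "br a (br x y) = br (br a x) y + br x (br a y)"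
proof -
  define P where "P a \<longleftrightarrow> (\<forall>x y. br a (br x y) = br (br a x) y + br x (br a y))" for a
  have basis: "P a" if "\<And>i j. br a (br (b i) (b j)) = br (br a (b i)) (b j) + br (b i) (br a (b j))" for a
  proof -
    have "bilinear (\<lambda>x y. br a (br x y))" "bilinear (\<lambda>x y. br (br a x) y + br x (br a y))"
      by (auto simp: bilinear_def br_simps algebra_simps intro!: linearI)
    from bilinear_eqI[OF this that] show ?thesis
      unfolding P_def by blast
  qed
  have scaleR_3: "3 *\<^sub>R v = v + v + v" for v :: 'v
    using scaleR_add_left[of 2 1 v] by (simp add: scaleR_2)
  note ev = br_b br_b_swap br_simps scaleR_2 scaleR_3 scaleR_add_right scaleR_diff_right
  have "P (b 0)"
    by (rule basis, unfold atomize_all forall_8) (simp add: ev)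
  moreover have "P (b 2)"
    by (rule basis, unfold atomize_all forall_8) (simp add: ev)
  moreover have "P (b 4)"
    by (rule basis, unfold atomize_all forall_8) (simp add: ev)
  moreover have br: "P (br u v)" if "P u" "P v" for u v
    unfolding P_def
  proof (intro allI)
    fix x y
    \<comment> \<open>\<open>P u\<close> alone says that \<open>br u v\<close> acts as the
      commutator of \<open>br u\<close> and \<open>br v\<close>; a commutator of derivations is a
      derivation.\<close>
    have ad: "br (br u v) z = br u (br v z) - br v (br u z)" for z
      using that(1) unfolding P_def by simp
    have du: "br u (br p q) = br (br u p) q + br p (br u q)"
      and dv: "br v (br p q) = br (br v p) q + br p (br v q)" for p q
      using that unfolding P_def by blast+
    have "br (br u v) (br x y) = br u (br v (br x y)) - br v (br u (br x y))"
      by (rule ad)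
    also have "\<dots> = br (br u (br v x) - br v (br u x)) y + br x (br u (br v y) - br v (br u y))"
      by (simp add: br_simps du[of x y] dv[of x y] du[of "br v x" y] du[of x "br v y"]
          dv[of "br u x" y] dv[of x "br u y"])
    finally show "br (br u v) (br x y) = br (br (br u v) x) y + br x (br (br u v) y)"
      by (simp only: ad)
  qed
  moreover have add: "P (u + v)" if "P u" "P v" for u v
    using that unfolding P_def by (simp add: br_simps)
  moreover have scale: "P (c *\<^sub>R u)" if "P u" for c u
    using that unfolding P_def by (simp add: br_simps scaleR_add_right)
  ultimately have odd: "P (b 5)" "P (b 3)" "P (b 1)"
    using br[of "b 2" "b 0"] br[of "b 0" "b 4"] br[of "b 4" "b 2"] by (simp_all add: br_b br_b_swap)
  have 6: "P (b 6)"
    using scale[OF br[OF \<open>P (b 4)\<close> \<open>P (b 5)\<close>], of "-1/2"] by (simp add: br_b)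
  have 7: "P (b 7)"
    using add[OF br[OF \<open>P (b 0)\<close> \<open>P (b 1)\<close>] scale[OF 6, of "-1"]] by (simp add: br_b)
  have b: "P (b i)" for i
    using exhaust_8[of i] 6 7 odd \<open>P (b 0)\<close> \<open>P (b 2)\<close> \<open>P (b 4)\<close> by metis
  have lin: "linear (\<lambda>a. br a (br x y))" "linear (\<lambda>a. br (br a x) y + br x (br a y))" for x y
    by (auto simp: br_simps algebra_simps intro!: linearI)
  show ?thesis
    using linear_eqI[OF lin] b unfolding P_def by blast
qed

text \<open>Vanishing of the second cohomology with real coefficients (Whitehead's second lemma),
  solved as a linear system: a few values of \<open>\<alpha>\<close> determine the eight
  coefficients of \<open>a\<close>, and instances of \<open>closed_b\<close> express the remaining
  pairs through them.\<close>

lemma closed_two_form_exact: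
  fixes \<alpha> :: "'v \<Rightarrow> 'v \<Rightarrow> real"
  assumes lin: "bilinear \<alpha>" and skew: "\<And>x y. \<alpha> x y = - \<alpha> y x"
    and closed: "\<And>x y z. \<alpha> x (br y z) + \<alpha> y (br z x) + \<alpha> z (br x y) = 0"
  obtains a where "\<And>x y. \<alpha> x y = ip a (br x y)"
proof -
  \<comment> \<open>The coefficient of \<open>b k\<close> is
    \<open>ip a (b k) / ip (b k) (b k)\<close>, read off a bracket that is a multiple of
    \<open>b k\<close>, for example \<open>br (b 2) (b 5) = - b 0\<close>. For \<open>b 7\<close>
    the difference \<open>br (b 0) (b 1) - br (b 2) (b 3) = 2 *\<^sub>R b 7\<close> serves; the 6 is
    twice the squared length 3.\<close>
  define a where "a = - \<alpha> (b 2) (b 5) *\<^sub>R b 0 - \<alpha> (b 2) (b 4) *\<^sub>R b 1 + \<alpha> (b 0) (b 5) *\<^sub>R b 2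
    + \<alpha> (b 0) (b 4) *\<^sub>R b 3 - \<alpha> (b 0) (b 3) *\<^sub>R b 4 - \<alpha> (b 0) (b 2) *\<^sub>R b 5
    - (\<alpha> (b 4) (b 5) / 2) *\<^sub>R b 6 + ((\<alpha> (b 0) (b 1) - \<alpha> (b 2) (b 3)) / 6) *\<^sub>R b 7"
  note ev = br_b br_b_swap br_simps bilinear_simps[OF lin] ip_simps ip_b a_def
  have self: "\<alpha> x x = 0" for x
    using skew[of x x] by simp
  have closed_b: "\<alpha> (b i) (br (b j) (b k)) + \<alpha> (b j) (br (b k) (b i)) + \<alpha> (b k) (br (b i) (b j)) = 0" for i j k
    by (rule closed)
  have swap: "\<alpha> (b 1) (b 0) = - \<alpha> (b 0) (b 1)"
     "\<alpha> (b 2) (b 0) = - \<alpha> (b 0) (b 2)" "\<alpha> (b 3) (b 0) = - \<alpha> (b 0) (b 3)"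
     "\<alpha> (b 4) (b 0) = - \<alpha> (b 0) (b 4)" "\<alpha> (b 5) (b 0) = - \<alpha> (b 0) (b 5)"
     "\<alpha> (b 6) (b 0) = - \<alpha> (b 0) (b 6)" "\<alpha> (b 7) (b 0) = - \<alpha> (b 0) (b 7)"
     "\<alpha> (b 2) (b 1) = - \<alpha> (b 1) (b 2)"
     "\<alpha> (b 3) (b 1) = - \<alpha> (b 1) (b 3)" "\<alpha> (b 4) (b 1) = - \<alpha> (b 1) (b 4)"
     "\<alpha> (b 5) (b 1) = - \<alpha> (b 1) (b 5)" "\<alpha> (b 6) (b 1) = - \<alpha> (b 1) (b 6)"
     "\<alpha> (b 7) (b 1) = - \<alpha> (b 1) (b 7)" "\<alpha> (b 3) (b 2) = - \<alpha> (b 2) (b 3)"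
     "\<alpha> (b 4) (b 2) = - \<alpha> (b 2) (b 4)" "\<alpha> (b 5) (b 2) = - \<alpha> (b 2) (b 5)"
     "\<alpha> (b 6) (b 2) = - \<alpha> (b 2) (b 6)" "\<alpha> (b 7) (b 2) = - \<alpha> (b 2) (b 7)"
     "\<alpha> (b 4) (b 3) = - \<alpha> (b 3) (b 4)"
     "\<alpha> (b 5) (b 3) = - \<alpha> (b 3) (b 5)" "\<alpha> (b 6) (b 3) = - \<alpha> (b 3) (b 6)"
     "\<alpha> (b 7) (b 3) = - \<alpha> (b 3) (b 7)" "\<alpha> (b 5) (b 4) = - \<alpha> (b 4) (b 5)"
     "\<alpha> (b 6) (b 4) = - \<alpha> (b 4) (b 6)" "\<alpha> (b 7) (b 4) = - \<alpha> (b 4) (b 7)"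
     "\<alpha> (b 6) (b 5) = - \<alpha> (b 5) (b 6)"
     "\<alpha> (b 7) (b 5) = - \<alpha> (b 5) (b 7)" "\<alpha> (b 7) (b 6) = - \<alpha> (b 6) (b 7)"
    
    by (rule skew)+
  have swap_goal: "\<alpha> (b j) (b i) = ip a (br (b j) (b i))" if "\<alpha> (b i) (b j) = ip a (br (b i) (b j))" for i j
    using that skew[of "b j" "b i"] br_skew[of "b j" "b i"] by (simp add: ip_simps)
  have self_goal: "\<alpha> (b i) (b i) = ip a (br (b i) (b i))" for i
    by (simp add: self ip_simps)
  have "\<alpha> (b 0) (b 1) = ip a (br (b 0) (b 1))"
    using closed_b[of 0 2 4] by (simp add: ev swap self field_simps)
  have "\<alpha> (b 0) (b 2) = ip a (br (b 0) (b 2))"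
    by (simp add: ev swap self field_simps)
  have "\<alpha> (b 0) (b 3) = ip a (br (b 0) (b 3))"
    by (simp add: ev swap self field_simps)
  have "\<alpha> (b 0) (b 4) = ip a (br (b 0) (b 4))"
    by (simp add: ev swap self field_simps)
  have "\<alpha> (b 0) (b 5) = ip a (br (b 0) (b 5))"
    by (simp add: ev swap self field_simps)
  have "\<alpha> (b 0) (b 6) = ip a (br (b 0) (b 6))"
    using closed_b[of 0 4 5] closed_b[of 2 5 6] by (simp add: ev swap self field_simps)
  have "\<alpha> (b 0) (b 7) = ip a (br (b 0) (b 7))"
    using closed_b[of 3 4 7] by (simp add: ev swap self field_simps)
  have "\<alpha> (b 1) (b 2) = ip a (br (b 1) (b 2))"
    using closed_b[of 0 2 7] closed_b[of 1 3 7] by (simp add: ev swap self field_simps)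
  have "\<alpha> (b 1) (b 3) = ip a (br (b 1) (b 3))"
    using closed_b[of 0 3 7] closed_b[of 1 2 7] by (simp add: ev swap self field_simps)
  have "\<alpha> (b 1) (b 4) = ip a (br (b 1) (b 4))"
    using closed_b[of 0 4 6] closed_b[of 1 5 6] by (simp add: ev swap self field_simps)
  have "\<alpha> (b 1) (b 5) = ip a (br (b 1) (b 5))"
    using closed_b[of 0 5 6] closed_b[of 1 4 6] by (simp add: ev swap self field_simps)
  have "\<alpha> (b 1) (b 6) = ip a (br (b 1) (b 6))"
    using closed_b[of 0 6 7] closed_b[of 3 5 7] by (simp add: ev swap self field_simps)
  have "\<alpha> (b 1) (b 7) = ip a (br (b 1) (b 7))"
    using closed_b[of 3 5 7] by (simp add: ev swap self field_simps)
  have "\<alpha> (b 2) (b 3) = ip a (br (b 2) (b 3))"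
    using closed_b[of 0 2 4] by (simp add: ev swap self field_simps)
  have "\<alpha> (b 2) (b 4) = ip a (br (b 2) (b 4))"
    by (simp add: ev swap self field_simps)
  have "\<alpha> (b 2) (b 5) = ip a (br (b 2) (b 5))"
    by (simp add: ev swap self field_simps)
  have "\<alpha> (b 2) (b 6) = ip a (br (b 2) (b 6))"
    using closed_b[of 0 5 6] closed_b[of 1 4 6] by (simp add: ev swap self field_simps)
  have "\<alpha> (b 2) (b 7) = ip a (br (b 2) (b 7))"
    using closed_b[of 1 4 7] by (simp add: ev swap self field_simps)
  have "\<alpha> (b 3) (b 4) = ip a (br (b 3) (b 4))"
    using closed_b[of 1 4 5] closed_b[of 2 4 6] by (simp add: ev swap self field_simps)
  have "\<alpha> (b 3) (b 5) = ip a (br (b 3) (b 5))"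
    using closed_b[of 0 4 5] closed_b[of 2 5 6] by (simp add: ev swap self field_simps)
  have "\<alpha> (b 3) (b 6) = ip a (br (b 3) (b 6))"
    using closed_b[of 0 4 6] closed_b[of 1 5 6] by (simp add: ev swap self field_simps)
  have "\<alpha> (b 3) (b 7) = ip a (br (b 3) (b 7))"
    using closed_b[of 1 5 7] by (simp add: ev swap self field_simps)
  have "\<alpha> (b 4) (b 5) = ip a (br (b 4) (b 5))"
    by (simp add: ev swap self field_simps)
  have "\<alpha> (b 4) (b 6) = ip a (br (b 4) (b 6))"
    using closed_b[of 0 1 4] closed_b[of 0 3 6] closed_b[of 0 3 7] by (simp add: ev swap self field_simps)
  have "\<alpha> (b 4) (b 7) = ip a (br (b 4) (b 7))"
    using closed_b[of 5 6 7] by (simp add: ev swap self field_simps)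
  have "\<alpha> (b 5) (b 6) = ip a (br (b 5) (b 6))"
    using closed_b[of 0 1 5] closed_b[of 0 2 6] closed_b[of 0 2 7] by (simp add: ev swap self field_simps)
  have "\<alpha> (b 5) (b 7) = ip a (br (b 5) (b 7))"
    using closed_b[of 4 6 7] by (simp add: ev swap self field_simps)
  have "\<alpha> (b 6) (b 7) = ip a (br (b 6) (b 7))"
    using closed_b[of 0 1 6] by (simp add: ev swap self field_simps)
  have "\<alpha> (b i) (b j) = ip a (br (b i) (b j))" for i j
    by (rule pairs_8[where Q = "\<lambda>i j. \<alpha> (b i) (b j) = ip a (br (b i) (b j))"];
      (fact | rule self_goal | (rule swap_goal, assumption)))
  moreover have "bilinear (\<lambda>x y. ip a (br x y))"
    by (auto simp: bilinear_def ip_simps br_simps intro!: linearI)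
  ultimately have "\<alpha> x y = ip a (br x y)" for x y
    using bilinear_eqI[OF lin] by blast
  then show ?thesis by (rule that)
qed

lemma ip_br_eqI:
  assumes "\<And>x y. ip u (br x y) = ip v (br x y)"
  shows "u = v"
proof (rule ip_eqI)
  show "ip u z = ip v z" for z
    by (rule br_span_induct[where P = "\<lambda>z. ip u z = ip v z"]) (simp_all add: assms ip_simps)
qed

text \<open>Faithfulness of the adjoint representation, from perfectness and invariance of
  \<open>ip\<close>. It turns identities between curvature operators into identities between
  elements of the algebra.\<close>

lemma center_trivial:
  assumes "\<And>z. br u z = br v z"
  shows "u = v"
proof (rule ip_br_eqI)
  show "ip u (br x y) = ip v (br x y)" for x y
    by (simp add: assms flip: ip_br)
qed

text \<open>For a skew derivation the form \<open>ip (D x) y\<close> is a closed 2-cochain. If it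
  equals \<open>ip a (br x y)\<close>, invariance of \<open>ip\<close> shows that \<open>D\<close>
  is the bracket with \<open>a\<close>.\<close>

lemma skew_derivation_inner:
  assumes lin: "linear D" and skew: "\<And>x y. ip (D x) y = - ip x (D y)"
    and der: "\<And>x y. D (br x y) = br (D x) y + br x (D y)"
  obtains a where "\<And>z. D z = br a z"
proof -
  let ?\<alpha> = "\<lambda>x y. ip (D x) y"
  have "bilinear ?\<alpha>"
    using lin by (auto simp: bilinear_def ip_simps linear_iff)
  moreover have "?\<alpha> x y = - ?\<alpha> y x" for x y
    using skew ip_sym by metis
  moreover have "?\<alpha> x (br y z) + ?\<alpha> y (br z x) + ?\<alpha> z (br x y) = 0" for x y z
  proof -
    have "ip (D z) (br x y) = - ip (D (br x y)) z"
      using skew ip_sym by metis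
    also have "\<dots> = - (ip (br (D x) y) z + ip (br x (D y)) z)"
      by (simp add: der ip_simps)
    also have "ip (br x (D y)) z = - ip (br (D y) x) z"
      using br_skew[of x "D y"] by (simp add: ip_simps)
    finally show ?thesis
      using br_skew[of z x] by (simp add: ip_br ip_simps)
  qed
  ultimately obtain a where a: "\<And>x y. ?\<alpha> x y = ip a (br x y)"
    by (rule closed_two_form_exact) blast
  have "D z = br a z" for z
    by (rule ip_eqI) (simp add: a ip_br)
  then show ?thesis by (rule that)
qed

text \<open>On basis vectors \<open>cyc\<close> is a homogeneous linear system for the entries of
  \<open>q\<close>, and the quadruples used below cut its solutions down to the multiples of
  \<open>ip\<close>. The factor is \<open>q (b 0) (b 0)\<close> because \<open>b 0\<close> has
  length one.\<close>

lemma bianchi_form_unique: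
  assumes lin: "bilinear q" and sym: "\<And>x y. q x y = q y x"
    and cyc: "\<And>x y z w. q (br x y) (br z w) + q (br y z) (br x w) + q (br z x) (br y w) = 0"
  shows "q x y = q (b 0) (b 0) * ip x y"
proof -
  note ev = br_b br_b_swap br_simps bilinear_simps[OF lin] ip_simps ip_b
  have swap: "q (b 1) (b 0) = q (b 0) (b 1)"
     "q (b 2) (b 0) = q (b 0) (b 2)" "q (b 3) (b 0) = q (b 0) (b 3)"
     "q (b 4) (b 0) = q (b 0) (b 4)" "q (b 5) (b 0) = q (b 0) (b 5)"
     "q (b 6) (b 0) = q (b 0) (b 6)" "q (b 7) (b 0) = q (b 0) (b 7)"
     "q (b 2) (b 1) = q (b 1) (b 2)"
     "q (b 3) (b 1) = q (b 1) (b 3)" "q (b 4) (b 1) = q (b 1) (b 4)"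
     "q (b 5) (b 1) = q (b 1) (b 5)" "q (b 6) (b 1) = q (b 1) (b 6)"
     "q (b 7) (b 1) = q (b 1) (b 7)" "q (b 3) (b 2) = q (b 2) (b 3)"
     "q (b 4) (b 2) = q (b 2) (b 4)" "q (b 5) (b 2) = q (b 2) (b 5)"
     "q (b 6) (b 2) = q (b 2) (b 6)" "q (b 7) (b 2) = q (b 2) (b 7)"
     "q (b 4) (b 3) = q (b 3) (b 4)"
     "q (b 5) (b 3) = q (b 3) (b 5)" "q (b 6) (b 3) = q (b 3) (b 6)"
     "q (b 7) (b 3) = q (b 3) (b 7)" "q (b 5) (b 4) = q (b 4) (b 5)"
     "q (b 6) (b 4) = q (b 4) (b 6)" "q (b 7) (b 4) = q (b 4) (b 7)"
     "q (b 6) (b 5) = q (b 5) (b 6)"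
     "q (b 7) (b 5) = q (b 5) (b 7)" "q (b 7) (b 6) = q (b 6) (b 7)"
    
    by (rule sym)+
  have d0: "q (b 0) (b 0) = q (b 0) (b 0) * ip (b 0) (b 0)"
    by (simp add: ev)
  have d1: "q (b 1) (b 1) = q (b 0) (b 0) * ip (b 1) (b 1)"
    using cyc[of "b 0" "b 2" "b 4" "b 7"] cyc[of "b 1" "b 2" "b 5" "b 7"] by (simp add: ev swap field_simps)
  have d2: "q (b 2) (b 2) = q (b 0) (b 0) * ip (b 2) (b 2)"
    using cyc[of "b 1" "b 3" "b 4" "b 7"] by (simp add: ev swap field_simps)
  have d3: "q (b 3) (b 3) = q (b 0) (b 0) * ip (b 3) (b 3)"
    using cyc[of "b 1" "b 2" "b 5" "b 7"] by (simp add: ev swap field_simps)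
  have d4: "q (b 4) (b 4) = q (b 0) (b 0) * ip (b 4) (b 4)"
    using cyc[of "b 1" "b 2" "b 5" "b 6"] cyc[of "b 1" "b 2" "b 5" "b 7"] by (simp add: ev swap field_simps)
  have d5: "q (b 5) (b 5) = q (b 0) (b 0) * ip (b 5) (b 5)"
    using cyc[of "b 1" "b 3" "b 4" "b 6"] cyc[of "b 1" "b 3" "b 4" "b 7"] by (simp add: ev swap field_simps)
  have d6: "q (b 6) (b 6) = q (b 0) (b 0) * ip (b 6) (b 6)"
    using cyc[of "b 0" "b 1" "b 4" "b 5"] cyc[of "b 2" "b 3" "b 4" "b 5"] d1 d2 d3 by (simp add: ev swap field_simps)
  have d7: "q (b 7) (b 7) = q (b 0) (b 0) * ip (b 7) (b 7)"
    using cyc[of "b 0" "b 1" "b 2" "b 3"] d6 d4 d5 by (simp add: ev swap field_simps)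
  have "q (b 0) (b 1) = q (b 0) (b 0) * ip (b 0) (b 1)"
    using cyc[of "b 0" "b 2" "b 5" "b 6"] cyc[of "b 0" "b 3" "b 4" "b 6"] by (simp add: ev swap field_simps)
  have "q (b 0) (b 2) = q (b 0) (b 0) * ip (b 0) (b 2)"
    using cyc[of "b 1" "b 3" "b 6" "b 7"] by (simp add: ev swap field_simps)
  have "q (b 0) (b 3) = q (b 0) (b 0) * ip (b 0) (b 3)"
    using cyc[of "b 1" "b 2" "b 6" "b 7"] by (simp add: ev swap field_simps)
  have "q (b 0) (b 4) = q (b 0) (b 0) * ip (b 0) (b 4)"
    using cyc[of "b 1" "b 5" "b 6" "b 7"] by (simp add: ev swap field_simps)
  have "q (b 0) (b 5) = q (b 0) (b 0) * ip (b 0) (b 5)"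
    using cyc[of "b 1" "b 4" "b 6" "b 7"] by (simp add: ev swap field_simps)
  have "q (b 0) (b 6) = q (b 0) (b 0) * ip (b 0) (b 6)"
    using cyc[of "b 1" "b 4" "b 5" "b 7"] by (simp add: ev swap field_simps)
  have "q (b 0) (b 7) = q (b 0) (b 0) * ip (b 0) (b 7)"
    using cyc[of "b 1" "b 2" "b 3" "b 7"] cyc[of "b 1" "b 4" "b 5" "b 6"] by (simp add: ev swap field_simps)
  have "q (b 1) (b 2) = q (b 0) (b 0) * ip (b 1) (b 2)"
    using cyc[of "b 0" "b 3" "b 6" "b 7"] by (simp add: ev swap field_simps)
  have "q (b 1) (b 3) = q (b 0) (b 0) * ip (b 1) (b 3)"
    using cyc[of "b 0" "b 2" "b 6" "b 7"] by (simp add: ev swap field_simps)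
  have "q (b 1) (b 4) = q (b 0) (b 0) * ip (b 1) (b 4)"
    using cyc[of "b 0" "b 5" "b 6" "b 7"] by (simp add: ev swap field_simps)
  have "q (b 1) (b 5) = q (b 0) (b 0) * ip (b 1) (b 5)"
    using cyc[of "b 0" "b 4" "b 6" "b 7"] by (simp add: ev swap field_simps)
  have "q (b 1) (b 6) = q (b 0) (b 0) * ip (b 1) (b 6)"
    using cyc[of "b 0" "b 4" "b 5" "b 7"] by (simp add: ev swap field_simps)
  have "q (b 1) (b 7) = q (b 0) (b 0) * ip (b 1) (b 7)"
    using cyc[of "b 0" "b 2" "b 3" "b 7"] cyc[of "b 0" "b 4" "b 5" "b 6"] by (simp add: ev swap field_simps)
  have "q (b 2) (b 3) = q (b 0) (b 0) * ip (b 2) (b 3)"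
    using cyc[of "b 0" "b 2" "b 5" "b 6"] cyc[of "b 1" "b 2" "b 4" "b 6"] by (simp add: ev swap field_simps)
  have "q (b 2) (b 4) = q (b 0) (b 0) * ip (b 2) (b 4)"
    using cyc[of "b 3" "b 5" "b 6" "b 7"] by (simp add: ev swap field_simps)
  have "q (b 2) (b 5) = q (b 0) (b 0) * ip (b 2) (b 5)"
    using cyc[of "b 3" "b 4" "b 6" "b 7"] by (simp add: ev swap field_simps)
  have "q (b 2) (b 6) = q (b 0) (b 0) * ip (b 2) (b 6)"
    using cyc[of "b 3" "b 4" "b 5" "b 7"] by (simp add: ev swap field_simps)
  have "q (b 2) (b 7) = q (b 0) (b 0) * ip (b 2) (b 7)"
    using cyc[of "b 0" "b 1" "b 3" "b 7"] cyc[of "b 3" "b 4" "b 5" "b 6"] by (simp add: ev swap field_simps)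
  have "q (b 3) (b 4) = q (b 0) (b 0) * ip (b 3) (b 4)"
    using cyc[of "b 2" "b 5" "b 6" "b 7"] by (simp add: ev swap field_simps)
  have "q (b 3) (b 5) = q (b 0) (b 0) * ip (b 3) (b 5)"
    using cyc[of "b 2" "b 4" "b 6" "b 7"] by (simp add: ev swap field_simps)
  have "q (b 3) (b 6) = q (b 0) (b 0) * ip (b 3) (b 6)"
    using cyc[of "b 2" "b 4" "b 5" "b 7"] by (simp add: ev swap field_simps)
  have "q (b 3) (b 7) = q (b 0) (b 0) * ip (b 3) (b 7)"
    using cyc[of "b 0" "b 1" "b 2" "b 7"] cyc[of "b 2" "b 4" "b 5" "b 6"] by (simp add: ev swap field_simps)
  have "q (b 4) (b 5) = q (b 0) (b 0) * ip (b 4) (b 5)"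
    using cyc[of "b 0" "b 2" "b 5" "b 6"] cyc[of "b 0" "b 3" "b 4" "b 7"] by (simp add: ev swap field_simps)
  have "q (b 4) (b 6) = q (b 0) (b 0) * ip (b 4) (b 6)"
    using cyc[of "b 0" "b 1" "b 5" "b 6"] cyc[of "b 2" "b 3" "b 5" "b 6"] by (simp add: ev swap field_simps)
  have "q (b 4) (b 7) = q (b 0) (b 0) * ip (b 4) (b 7)"
    using cyc[of "b 0" "b 1" "b 5" "b 6"] cyc[of "b 0" "b 1" "b 5" "b 7"] cyc[of "b 2" "b 3" "b 5" "b 6"] by (simp add: ev swap field_simps)
  have "q (b 5) (b 6) = q (b 0) (b 0) * ip (b 5) (b 6)"
    using cyc[of "b 0" "b 1" "b 4" "b 6"] cyc[of "b 2" "b 3" "b 4" "b 6"] by (simp add: ev swap field_simps)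
  have "q (b 5) (b 7) = q (b 0) (b 0) * ip (b 5) (b 7)"
    using cyc[of "b 0" "b 1" "b 4" "b 6"] cyc[of "b 0" "b 1" "b 4" "b 7"] cyc[of "b 2" "b 3" "b 4" "b 6"] by (simp add: ev swap field_simps)
  have "q (b 6) (b 7) = q (b 0) (b 0) * ip (b 6) (b 7)"
    using cyc[of "b 0" "b 1" "b 4" "b 5"] cyc[of "b 2" "b 3" "b 4" "b 5"] d2 d3 d1 by (simp add: ev swap field_simps)
  have diag: "\<forall>i. q (b i) (b i) = q (b 0) (b 0) * ip (b i) (b i)"
    unfolding forall_8 by (intro conjI; fact)
  have swap_goal: "q (b j) (b i) = q (b 0) (b 0) * ip (b j) (b i)"
    if "q (b i) (b j) = q (b 0) (b 0) * ip (b i) (b j)" for i j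
    unfolding sym[of "b j" "b i"] ip_sym[of "b j" "b i"] by (rule that)
  have "q (b i) (b j) = q (b 0) (b 0) * ip (b i) (b j)" for i j
    by (rule pairs_8[where Q = "\<lambda>i j. q (b i) (b j) = q (b 0) (b 0) * ip (b i) (b j)"];
      (fact | rule diag[rule_format] | (rule swap_goal, assumption)))
  moreover have "bilinear (\<lambda>x y. q (b 0) (b 0) * ip x y)"
    by (auto simp: bilinear_def ip_simps algebra_simps intro!: linearI)
  ultimately show ?thesis
    using bilinear_eqI[OF lin] by blast
qed

text \<open>Since the bracket operators are skew, \<open>ip (br (r x y) z) w\<close> has all
  symmetries of a Riemannian curvature tensor. Pair symmetry makes \<open>r x y\<close> depend on
  \<open>br x y\<close> alone, and \<open>bianchi_form_unique\<close> identifies the symmetric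
  operator in between.\<close>

lemma curvature_unique:
  assumes skew: "\<And>x y. r x y = - r y x"
    and bianchi: "\<And>x y z. br (r x y) z + br (r y z) x + br (r z x) y = 0"
  obtains c where "\<And>x y. r x y = c *\<^sub>R br x y"
proof -
  define f where "f x y z w = ip (r x y) (br z w)" for x y z w
  have f1: "f x y z w = - f y x z w" for x y z w
    unfolding f_def using skew[of x y] by (simp add: ip_simps)
  have f2: "f x y z w = - f x y w z" for x y z w
    unfolding f_def using br_skew[of z w] by (simp add: ip_simps)
  have f3: "f x y z w + f y z x w + f z x y w = 0" for x y z w
    using arg_cong[OF bianchi[of x y z], of "\<lambda>u. ip u w"] unfolding f_def by (simp add: ip_simps ip_br)
  have pair: "f x y z w = f z w x y" for x y z w
    using f3[of x y z w] f3[of y z w x] f3[of z w x y] f3[of w x y z]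
      f2[of x y w z] f2[of y z w x] f2[of z w y x] f2[of w x z y]
      f1[of x z w y] f2[of z x w y] f1[of y w x z] f2[of w y x z]
    by linarith
  \<comment> \<open>On a bracket \<open>v = br z w\<close> the witness is \<open>r z w\<close>, by
    pair symmetry; perfectness extends this to all \<open>v\<close>.\<close>
  have "\<exists>u. \<forall>x y. ip (r x y) v = ip u (br x y)" for v
  proof (rule br_span_induct[where P = "\<lambda>v. \<exists>u. \<forall>x y. ip (r x y) v = ip u (br x y)"])
    show "\<exists>u. \<forall>x y. ip (r x y) (br z w) = ip u (br x y)" for z w
      using pair unfolding f_def by blast
    show "\<exists>u. \<forall>x y. ip (r x y) (v + v') = ip u (br x y)"
      if uv: "\<exists>u. \<forall>x y. ip (r x y) v = ip u (br x y)" "\<exists>u. \<forall>x y. ip (r x y) v' = ip u (br x y)" for v v'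
    proof -
      obtain u u' where "\<forall>x y. ip (r x y) v = ip u (br x y)" "\<forall>x y. ip (r x y) v' = ip u' (br x y)"
        using uv by blast
      then show ?thesis
        by (intro exI[of _ "u + u'"]) (simp add: ip_simps)
    qed
    show "\<exists>u. \<forall>x y. ip (r x y) (c *\<^sub>R v) = ip u (br x y)"
      if uv: "\<exists>u. \<forall>x y. ip (r x y) v = ip u (br x y)" for c v
    proof -
      obtain u where "\<forall>x y. ip (r x y) v = ip u (br x y)"
        using uv by blast
      then show ?thesis
        by (intro exI[of _ "c *\<^sub>R u"]) (simp add: ip_simps)
    qed
  qed
  then obtain Q where Q: "\<And>v x y. ip (r x y) v = ip (Q v) (br x y)"
    by metis
  \<comment> \<open>\<open>Q\<close> was obtained by choice; it is linear because the numbers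
    \<open>ip u (br x y)\<close> determine \<open>u\<close>.\<close>
  have "Q (u + v) = Q u + Q v" for u v
    by (rule ip_br_eqI) (simp add: ip_simps flip: Q)
  moreover have "Q (c *\<^sub>R v) = c *\<^sub>R Q v" for c v
    by (rule ip_br_eqI) (simp add: ip_simps flip: Q)
  ultimately have "bilinear (\<lambda>x y. ip (Q x) y)"
    by (auto simp: bilinear_def ip_simps intro!: linearI)
  moreover have sym: "ip (Q x) y = ip (Q y) x" for x y
  proof -
    have "ip (Q (br z w)) (br x y) = ip (Q (br x y)) (br z w)" for x y z w
      using pair[of x y z w] unfolding f_def by (simp add: Q)
    then have "ip (Q (br z w)) y = ip (Q y) (br z w)" for y z w
      by (rule_tac br_span_induct[where P = "\<lambda>y. ip (Q (br z w)) y = ip (Q y) (br z w)"])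
        (simp_all add: ip_simps \<open>\<And>u v. Q (u + v) = Q u + Q v\<close> \<open>\<And>c v. Q (c *\<^sub>R v) = c *\<^sub>R Q v\<close>)
    then show ?thesis
      by (rule_tac br_span_induct[where P = "\<lambda>x. ip (Q x) y = ip (Q y) x"])
        (simp_all add: ip_simps \<open>\<And>u v. Q (u + v) = Q u + Q v\<close> \<open>\<And>c v. Q (c *\<^sub>R v) = c *\<^sub>R Q v\<close>)
  qed
  moreover have "ip (Q (br x y)) (br z w) + ip (Q (br y z)) (br x w) + ip (Q (br z x)) (br y w) = 0" for x y z w
    using f3[of x y z w] sym unfolding f_def Q by metis
  ultimately have "ip (Q x) y = ip (Q (b 0)) (b 0) * ip x y" for x y
    by (rule bianchi_form_unique)
  then obtain c where q: "\<And>x y. ip (Q x) y = c * ip x y"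
    by blast
  have "r x y = c *\<^sub>R br x y" for x y
  proof (rule ip_eqI)
    have "ip (r x y) z = c * ip z (br x y)" for z
      by (simp add: Q q)
    then show "ip (r x y) z = ip (c *\<^sub>R br x y) z" for z
      using ip_sym[of z "br x y"] by (simp add: ip_simps)
  qed
  then show ?thesis by (rule that)
qed

text \<open>\<open>r\<close> and \<open>t\<close> stand for the curvature and the torsion of a connection with parallel torsion
  at a point, and \<open>s\<close> for the covariant derivative of the curvature.\<close>

lemma curvature_derivative_zero:
  assumes t: "bilinear t" and r: "bilinear r" and s: "\<And>v w. linear (\<lambda>u. s u v w)"
    and r_skew: "\<And>x y. r x y = - r y x"
    and s_skew: "\<And>u x y. s u x y = - s u y x"
    and s_t: "\<And>u v w x y. br (s u v w) (t x y) = t (br (s u v w) x) y + t x (br (s u v w) y)"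
    and r_bianchi: "\<And>x y z. br (r x y) z + br (r y z) x + br (r z x) y = t (t x y) z + t (t y z) x + t (t z x) y"
    and s_bianchi: "\<And>u x y z. br (s u x y) z + br (s u y z) x + br (s u z x) y = 0"
    and bianchi2: "\<And>x y z. s x y z + s y z x + s z x y + (r (t x y) z + r (t y z) x + r (t z x) y) = 0"
  shows "s u v w = 0"
proof -
  note t_simps = bilinear_simps[OF t] and r_simps = bilinear_simps[OF r]
  have "\<exists>c. \<forall>v w. s u v w = c *\<^sub>R br v w" for u
    using curvature_unique[of "s u"] s_skew s_bianchi by metis
  then obtain l where l: "\<And>u v w. s u v w = l u *\<^sub>R br v w"
    by metis
  \<comment> \<open>\<open>br (b 0) (b 2)\<close> is the unit vector \<open>- b 5\<close>, so
    pairing with it recovers the chosen \<open>l\<close> and shows that it is linear.\<close>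
  have "l u = ip (s u (b 0) (b 2)) (- b 5)" for u
    unfolding l by (simp add: br_b ip_simps ip_b)
  moreover have "linear (\<lambda>u. ip (s u (b 0) (b 2)) (- b 5))"
    using s[of "b 0" "b 2"] by (auto simp: linear_iff ip_simps)
  ultimately have lin_l: "linear l"
    by presburger
  note l_simps = linear_add[OF lin_l] linear_scale[OF lin_l] linear_neg[OF lin_l] linear_diff[OF lin_l]
  have "\<forall>u. l u = 0"
  proof (rule ccontr)
    assume "\<not> (\<forall>u. l u = 0)"
    then obtain u where u: "l u \<noteq> 0" by blast
    \<comment> \<open>In \<open>s_t\<close> the nonzero factor \<open>l u\<close> cancels, which
      leaves brackets acting on \<open>t\<close> by derivations; perfectness gives all
      \<open>a\<close>.\<close>
    have tau: "br a (t x y) = t (br a x) y + t x (br a y)" for a x y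
    proof (rule br_span_induct[where P = "\<lambda>a. br a (t x y) = t (br a x) y + t x (br a y)"])
      show "br (br v w) (t x y) = t (br (br v w) x) y + t x (br (br v w) y)" for v w
        using s_t[of u v w x y] u by (simp add: l br_simps t_simps flip: scaleR_add_right)
    qed (simp_all add: br_simps t_simps algebra_simps)
    have "\<exists>c. \<forall>v w. br a (r v w) - r (br a v) w - r v (br a w) = c *\<^sub>R br v w" for a
    proof -
      let ?r = "\<lambda>v w. br a (r v w) - r (br a v) w - r v (br a w)"
      have "?r v w = - ?r w v" for v w
        using r_skew[of v w] r_skew[of "br a v" w] r_skew[of v "br a w"] by (simp add: br_simps)
      \<comment> \<open>By Jacobi, the Bianchi sum of the action of \<open>a\<close> on
        \<open>r\<close> is the action of \<open>a\<close> on the Bianchi sum of \<open>r\<close>.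
        The latter is built from \<open>t\<close> alone and so is invariant by
        \<open>tau\<close>.\<close>
      moreover have "br (?r x y) z + br (?r y z) x + br (?r z x) y = 0" for x y z
      proof -
        have ad: "br (br a p) q = br a (br p q) - br p (br a q)" for p q
          using jacobi[of a p q] by simp
        let ?T = "\<lambda>x y z. t (t x y) z + t (t y z) x + t (t z x) y"
        have "br (?r x y) z + br (?r y z) x + br (?r z x) y = br a (?T x y z)
          - ?T (br a x) y z - ?T x (br a y) z - ?T x y (br a z)"
          unfolding r_bianchi[symmetric] by (simp add: br_simps ad algebra_simps)
        also have "\<dots> = 0"
          by (simp add: br_simps tau t_simps algebra_simps)
        finally show ?thesis .
      qed
      ultimately show ?thesis
        by (metis (no_types, lifting) curvature_unique[of ?r])
    qed
    then obtain m where "\<And>a v w. br a (r v w) - r (br a v) w - r v (br a w) = m a *\<^sub>R br v w"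
      by metis
    then have m: "br a (r v w) = m a *\<^sub>R br v w + r (br a v) w + r v (br a w)" for a v w
      by (metis (no_types, lifting) diff_diff_eq diff_eq_eq add.assoc add.commute)
    have rho: "br a (r v w) = r (br a v) w + r v (br a w)" for a v w
    proof (rule br_span_induct[where P = "\<lambda>a. br a (r v w) = r (br a v) w + r v (br a w)"])
      \<comment> \<open>Apply \<open>c\<close> and \<open>d\<close> to \<open>r\<close> in both
        orders and subtract: the terms with \<open>m\<close> cancel because \<open>br\<close> itself
        is invariant, which is \<open>2\<close>.\<close>
      show "br (br c d) (r v w) = r (br (br c d) v) w + r v (br (br c d) w)" for c d
      proof -
        have ad: "br (br c d) p = br c (br d p) - br d (br c p)" for p
          using jacobi[of c d p] by simp
        have 1: "br c (br d (r v w)) = m d *\<^sub>R br c (br v w) + (m c *\<^sub>R br (br d v) w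
          + r (br c (br d v)) w + r (br d v) (br c w)) + (m c *\<^sub>R br v (br d w) + r (br c v) (br d w)
          + r v (br c (br d w)))" for c d
          unfolding m[of d v w] by (simp only: br_simps m)
        have 2: "m c *\<^sub>R br d (br v w) = m c *\<^sub>R br (br d v) w + m c *\<^sub>R br v (br d w)" for c d
          by (simp only: jacobi[of d v w] scaleR_add_right)
        show ?thesis
          unfolding ad 1 2 by (simp add: r_simps)
      qed
    qed (simp_all add: br_simps r_simps algebra_simps)
    \<comment> \<open>\<open>?N\<close> is invariant under \<open>a\<close>, and so is the bracket.
      Comparing the two expansions of \<open>br a (?L x y z)\<close> therefore leaves only the
      action of \<open>a\<close> on \<open>l\<close>.\<close>
    have l_br: "l (br a x) *\<^sub>R br y z + l (br a y) *\<^sub>R br z x + l (br a z) *\<^sub>R br x y = 0" for a x y z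
    proof -
      let ?L = "\<lambda>x y z. l x *\<^sub>R br y z + l y *\<^sub>R br z x + l z *\<^sub>R br x y"
      let ?N = "\<lambda>x y z. - (r (t x y) z + r (t y z) x + r (t z x) y)"
      have L: "?L x y z = ?N x y z" for x y z
        using bianchi2[of x y z] unfolding l by (simp only: eq_neg_iff_add_eq_0)
      have "br a (?L x y z) = ?L (br a x) y z + ?L x (br a y) z + ?L x y (br a z)"
        unfolding L by (simp add: br_simps r_simps rho tau algebra_simps)
      moreover have "br a (?L x y z) = l x *\<^sub>R (br (br a y) z + br y (br a z))
        + l y *\<^sub>R (br (br a z) x + br z (br a x)) + l z *\<^sub>R (br (br a x) y + br x (br a y))"
        by (simp only: br_simps jacobi[of a y z] jacobi[of a z x] jacobi[of a x y])
      ultimately show ?thesis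
        by (simp add: algebra_simps)
    qed
    have l_b: "l (br a x) * ip (br y z) w + l (br a y) * ip (br z x) w + l (br a z) * ip (br x y) w = 0"
      for a x y z w
      using arg_cong[OF l_br[of a x y z], of "\<lambda>p. ip p w"] by (simp add: ip_simps)
    note ev = br_b br_b_swap ip_simps ip_b
    \<comment> \<open>For each basis vector a pair \<open>y\<close>, \<open>z\<close> and a test
      vector \<open>w\<close> are chosen such that \<open>br y z\<close> has a component along
      \<open>w\<close>, while the brackets of \<open>y\<close> and \<open>z\<close> with the given
      vector are orthogonal to \<open>w\<close>.\<close>
    have "l (br a (b 0)) = 0" "l (br a (b 1)) = 0" "l (br a (b 2)) = 0" "l (br a (b 3)) = 0"
      "l (br a (b 4)) = 0" "l (br a (b 5)) = 0" "l (br a (b 6)) = 0" "l (br a (b 7)) = 0" for a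
      using l_b[of a "b 0" "b 4" "b 5" "b 6"] l_b[of a "b 1" "b 4" "b 5" "b 6"]
        l_b[of a "b 2" "b 4" "b 5" "b 6"] l_b[of a "b 3" "b 4" "b 5" "b 6"]
        l_b[of a "b 4" "b 0" "b 1" "b 6"] l_b[of a "b 5" "b 0" "b 1" "b 6"]
        l_b[of a "b 6" "b 0" "b 1" "b 7"] l_b[of a "b 7" "b 0" "b 1" "b 6"]
      by (simp_all add: ev)
    then have "l (br a (b i)) = 0" for a i
      using exhaust_8[of i] by metis
    moreover have "linear (\<lambda>x. l (br a x))" for a
      by (auto simp: linear_iff br_simps l_simps)
    ultimately have "l (br a x) = 0" for a x
      using linear_eqI[OF _ linear_zero] by blast
    then have "l u = 0"
      by (rule br_span_induct) (simp_all add: l_simps)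
    with u show False ..
  qed
  then show ?thesis
    by (simp add: l)
qed

end

section \<open>Symmetry of second derivatives\<close>

lemma smooth_on_has_derivative:
  assumes "smooth_on U f" "x \<in> U"
  shows "(f has_derivative frechet_derivative f (at x)) (at x)"
proof -
  have "ck_on 1 U f"
    using assms(1) unfolding smooth_on_def by blast
  then show ?thesis
    using assms(2) frechet_derivative_works by (auto simp: One_nat_def)
qed

lemma smooth_on_frechet_derivative:
  assumes "smooth_on U f"
  shows "smooth_on U (\<lambda>x. frechet_derivative f (at x) v)"
  unfolding smooth_on_def
proof
  fix k
  have "ck_on (Suc k) U f"
    using assms unfolding smooth_on_def by blast
  then show "ck_on k U (\<lambda>x. frechet_derivative f (at x) v)"
    by simp
qed

lemma smooth_on_continuous_on: "smooth_on U f \<Longrightarrow> continuous_on U f"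
  unfolding smooth_on_def by (metis ck_on.simps(1))

text \<open>The mean value theorem twice: along \<open>u\<close> for the difference of
  \<open>f\<close> between two parallel segments, then along \<open>v\<close> for the derivative in
  direction \<open>u\<close>. The bound on \<open>h\<close> keeps the parallelogram in the
  ball.\<close>

lemma second_difference:
  fixes f :: "'a::euclidean_space \<Rightarrow> real"
  assumes f': "\<And>y. y \<in> U \<Longrightarrow> (f has_derivative f' y) (at y)"
    and f'': "\<And>y w. y \<in> U \<Longrightarrow> ((\<lambda>y. f' y w) has_derivative f'' y w) (at y)"
    and ball: "ball x e \<subseteq> U" and h: "h > 0" "h * (norm u + norm v) < e"
  obtains y where "y \<in> ball x e"
    "f (x + h *\<^sub>R u + h *\<^sub>R v) - f (x + h *\<^sub>R u) - f (x + h *\<^sub>R v) + f x = h * h * f'' y u v"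
proof -
  have mem: "x + s *\<^sub>R u + t *\<^sub>R v \<in> ball x e" if "0 \<le> s" "s \<le> h" "0 \<le> t" "t \<le> h" for s t
  proof -
    have "norm (s *\<^sub>R u + t *\<^sub>R v) \<le> s * norm u + t * norm v"
      using norm_triangle_ineq[of "s *\<^sub>R u" "t *\<^sub>R v"] that by simp
    also have "\<dots> \<le> h * norm u + h * norm v"
      using that by (intro add_mono mult_right_mono) auto
    also have "\<dots> < e"
      using h(2) by (simp add: distrib_left)
    finally have "dist (x + (s *\<^sub>R u + t *\<^sub>R v)) x < e"
      by (simp only: dist_norm add_diff_cancel_left')
    then show ?thesis
      by (simp add: dist_commute add.assoc)
  qed
  have line: "((\<lambda>s. g (p + s *\<^sub>R w)) has_real_derivative g' w) (at s)"
    if "(g has_derivative g') (at (p + s *\<^sub>R w))" for g :: "'a \<Rightarrow> real" and g' p w s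
  proof -
    have "((\<lambda>s. p + s *\<^sub>R w) has_derivative (\<lambda>t. t *\<^sub>R w)) (at s)"
      by (auto intro!: derivative_eq_intros)
    then have "((\<lambda>s. g (p + s *\<^sub>R w)) has_derivative (\<lambda>t. g' (t *\<^sub>R w))) (at s)"
      using that by (rule has_derivative_compose)
    moreover have "g' (t *\<^sub>R w) = g' w * t" for t
      using has_derivative_linear[OF that] by (simp add: linear_scale)
    ultimately show ?thesis
      by (simp add: has_field_derivative_def)
  qed
  have "\<exists>s>0. s < h \<and> (\<lambda>s. f (x + h *\<^sub>R v + s *\<^sub>R u) - f (x + s *\<^sub>R u)) h
      - (\<lambda>s. f (x + h *\<^sub>R v + s *\<^sub>R u) - f (x + s *\<^sub>R u)) 0
    = (h - 0) * (f' (x + h *\<^sub>R v + s *\<^sub>R u) u - f' (x + s *\<^sub>R u) u)"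
  proof (rule MVT2[OF h(1)])
    fix s assume "0 \<le> s" "s \<le> h"
    then have "x + h *\<^sub>R v + s *\<^sub>R u \<in> U" "x + s *\<^sub>R u \<in> U"
      using mem[of s h] mem[of s 0] h ball by (auto simp: ac_simps)
    then show "((\<lambda>s. f (x + h *\<^sub>R v + s *\<^sub>R u) - f (x + s *\<^sub>R u)) has_real_derivative
        f' (x + h *\<^sub>R v + s *\<^sub>R u) u - f' (x + s *\<^sub>R u) u) (at s)"
      by (intro DERIV_diff line f')
  qed
  then obtain s where s: "0 < s" "s < h" and 1: "f (x + h *\<^sub>R u + h *\<^sub>R v) - f (x + h *\<^sub>R u) - f (x + h *\<^sub>R v) + f x
      = h * (f' (x + s *\<^sub>R u + h *\<^sub>R v) u - f' (x + s *\<^sub>R u + 0 *\<^sub>R v) u)"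
    by (auto simp: algebra_simps)
  have "\<exists>t>0. t < h \<and> (\<lambda>t. f' (x + s *\<^sub>R u + t *\<^sub>R v) u) h - (\<lambda>t. f' (x + s *\<^sub>R u + t *\<^sub>R v) u) 0
    = (h - 0) * f'' (x + s *\<^sub>R u + t *\<^sub>R v) u v"
  proof (rule MVT2[OF h(1)])
    fix t assume "0 \<le> t" "t \<le> h"
    then have "x + s *\<^sub>R u + t *\<^sub>R v \<in> U"
      using mem[of s t] s ball by auto
    then show "((\<lambda>t. f' (x + s *\<^sub>R u + t *\<^sub>R v) u) has_real_derivative
        f'' (x + s *\<^sub>R u + t *\<^sub>R v) u v) (at t)"
      by (intro line f'')
  qed
  then obtain t where t: "0 < t" "t < h"
    and 2: "f' (x + s *\<^sub>R u + h *\<^sub>R v) u - f' (x + s *\<^sub>R u + 0 *\<^sub>R v) u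
      = h * f'' (x + s *\<^sub>R u + t *\<^sub>R v) u v"
    by auto
  show ?thesis
    using that[OF mem[of s t]] s t 1 unfolding 2 by simp
qed

text \<open>Schwarz's theorem: the second difference is symmetric in \<open>u\<close> and
  \<open>v\<close>, so the two mixed derivatives agree at suitable points arbitrarily close to
  \<open>x\<close>, and continuity carries this to \<open>x\<close>.\<close>

lemma mixed_derivatives_real:
  fixes f :: "'a::euclidean_space \<Rightarrow> real"
  assumes U: "open U" "x \<in> U"
    and f': "\<And>y. y \<in> U \<Longrightarrow> (f has_derivative f' y) (at y)"
    and f'': "\<And>y w. y \<in> U \<Longrightarrow> ((\<lambda>y. f' y w) has_derivative f'' y w) (at y)"
    and cont: "\<And>w z. continuous_on U (\<lambda>y. f'' y w z)"
  shows "f'' x u v = f'' x v u"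
proof (rule ccontr)
  assume neq: "f'' x u v \<noteq> f'' x v u"
  define d where "d = \<bar>f'' x u v - f'' x v u\<bar> / 2"
  have d: "d > 0" using neq by (simp add: d_def)
  have "isCont (\<lambda>y. f'' y u v) x" "isCont (\<lambda>y. f'' y v u) x"
    using U cont continuous_on_eq_continuous_at by blast+
  then obtain e1 e2 where e1: "e1 > 0" "\<And>y. dist y x < e1 \<Longrightarrow> dist (f'' y u v) (f'' x u v) < d"
    and e2: "e2 > 0" "\<And>y. dist y x < e2 \<Longrightarrow> dist (f'' y v u) (f'' x v u) < d"
    using d unfolding continuous_at_eps_delta by metis
  obtain e3 where e3: "e3 > 0" "ball x e3 \<subseteq> U"
    using U open_contains_ball by blast
  define e where "e = min e1 (min e2 e3)"
  \<comment> \<open>The summand 1 keeps \<open>m\<close> positive when \<open>u\<close> and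
    \<open>v\<close> both vanish.\<close>
  define m where "m = norm u + norm v + 1"
  define h where "h = e / (2 * m)"
  have m: "m > 0" by (simp add: m_def add_nonneg_pos)
  have e: "e > 0" "ball x e \<subseteq> U"
    using e1 e2 e3 by (auto simp: e_def)
  then have h: "h > 0"
    using m by (simp add: h_def)
  have "h * (norm u + norm v) \<le> h * m"
    using h by (intro mult_left_mono) (auto simp: m_def)
  also have "\<dots> < e"
    using m e by (simp add: h_def)
  finally have h2: "h * (norm u + norm v) < e" "h * (norm v + norm u) < e"
    by (simp_all add: add.commute)
  obtain y where y: "y \<in> ball x e" "f (x + h *\<^sub>R u + h *\<^sub>R v) - f (x + h *\<^sub>R u) - f (x + h *\<^sub>R v) + f x = h * h * f'' y u v"
    using second_difference[OF f' f'' e(2) h h2(1)] by blast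
  obtain z where z: "z \<in> ball x e" "f (x + h *\<^sub>R v + h *\<^sub>R u) - f (x + h *\<^sub>R v) - f (x + h *\<^sub>R u) + f x = h * h * f'' z v u"
    using second_difference[OF f' f'' e(2) h h2(2)] by blast
  have "h * h * f'' y u v = h * h * f'' z v u"
    unfolding y(2)[symmetric] z(2)[symmetric] by (simp add: algebra_simps)
  then have "f'' y u v = f'' z v u"
    using h by simp
  moreover have "dist y x < e1" "dist z x < e2"
    using y(1) z(1) by (simp_all add: e_def dist_commute)
  then have "dist (f'' y u v) (f'' x u v) < d" "dist (f'' z v u) (f'' x v u) < d"
    using e1(2) e2(2) by blast+
  ultimately show False
    unfolding d_def dist_real_def by argo
qed

lemma mixed_derivatives:
  fixes f :: "'a::euclidean_space \<Rightarrow> 'b::euclidean_space"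
  assumes f: "smooth_on U f" and U: "open U" "x \<in> U"
  shows "frechet_derivative (\<lambda>y. frechet_derivative f (at y) u) (at x) v
    = frechet_derivative (\<lambda>y. frechet_derivative f (at y) v) (at x) u"
proof (rule euclidean_eqI)
  fix i :: 'b
  let ?f' = "\<lambda>y w. frechet_derivative f (at y) w"
  let ?f'' = "\<lambda>y w. frechet_derivative (\<lambda>y. ?f' y w) (at y)"
  have "((\<lambda>y. f y \<bullet> i) has_derivative (\<lambda>w. ?f' y w \<bullet> i)) (at y)" if "y \<in> U" for y
    using that by (intro has_derivative_inner_left smooth_on_has_derivative[OF f])
  moreover have "((\<lambda>y. ?f' y w \<bullet> i) has_derivative (\<lambda>v. ?f'' y w v \<bullet> i)) (at y)" if "y \<in> U" for y w
    using that by (intro has_derivative_inner_left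
        smooth_on_has_derivative[OF smooth_on_frechet_derivative[OF f]])
  moreover have "continuous_on U (\<lambda>y. ?f'' y w z \<bullet> i)" for w z
    by (intro continuous_on_inner continuous_on_const smooth_on_continuous_on
        smooth_on_frechet_derivative f)
  ultimately show "?f'' x u v \<bullet> i = ?f'' x v u \<bullet> i"
    using mixed_derivatives_real[OF U, of "\<lambda>y. f y \<bullet> i" "\<lambda>y w. ?f' y w \<bullet> i"
        "\<lambda>y w v. ?f'' y w v \<bullet> i"] by blast
qed

text \<open>The device by which an identity valid throughout an open set is differentiated at a
  point.\<close>

lemma has_derivative_unique_open:
  assumes "open U" "x \<in> U" "\<And>y. y \<in> U \<Longrightarrow> f y = g y" "(f has_derivative f') (at x)" "(g has_derivative g') (at x)"
  shows "f' w = g' w"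
  using has_derivative_transform_within_open[OF assms(4) assms(1-3)] assms(5) has_derivative_unique by metis

lemma linear_derivative_family:
  assumes U: "open U" "x \<in> U"
    and lin: "\<And>y. y \<in> U \<Longrightarrow> linear (L y)"
    and L': "\<And>a. ((\<lambda>y. L y a) has_derivative (\<lambda>w. L' w a)) (at x)"
  shows "linear (L' w)"
proof (rule linearI)
  show "L' w (a + b) = L' w a + L' w b" for a b
    by (rule has_derivative_unique_open[OF U _ L' has_derivative_add[OF L' L'], of "a + b" a b w])
      (simp add: linear_add lin)
  show "L' w (c *\<^sub>R a) = c *\<^sub>R L' w a" for c a
    by (rule has_derivative_unique_open[OF U _ L' has_derivative_scaleR_right[OF L'], of "c *\<^sub>R a" c a w])
      (simp add: linear_scale lin)
qed

text \<open>Product rule when differentiability of \<open>L\<close> is known only for each fixed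
  argument. Expanding \<open>f y\<close> in the finite basis reduces it to finitely many such
  derivatives.\<close>

lemma has_derivative_linear_family:
  fixes f :: "'a::real_normed_vector \<Rightarrow> 'b::euclidean_space" and L :: "'a \<Rightarrow> 'b \<Rightarrow> 'c::real_normed_vector"
  assumes U: "open U" "x \<in> U"
    and lin: "\<And>y. y \<in> U \<Longrightarrow> linear (L y)"
    and L': "\<And>a. ((\<lambda>y. L y a) has_derivative (\<lambda>w. L' w a)) (at x)"
    and f': "(f has_derivative f') (at x)"
  shows "((\<lambda>y. L y (f y)) has_derivative (\<lambda>w. L' w (f x) + L x (f' w))) (at x)"
proof -
  have L'_lin: "linear (L' w)" for w
    by (rule linear_derivative_family[OF U lin L'])
  have sum: "l b = (\<Sum>i\<in>Basis. (b \<bullet> i) *\<^sub>R l i)" if "linear l" for l :: "'b \<Rightarrow> 'c" and b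
    using linear_sum[OF that, of "\<lambda>i. (b \<bullet> i) *\<^sub>R i" Basis] that
    by (simp add: euclidean_representation linear_scale)
  have "((\<lambda>y. \<Sum>i\<in>Basis. (f y \<bullet> i) *\<^sub>R L y i) has_derivative
      (\<lambda>w. \<Sum>i\<in>Basis. (f x \<bullet> i) *\<^sub>R L' w i + (f' w \<bullet> i) *\<^sub>R L x i)) (at x)"
    by (intro has_derivative_sum has_derivative_scaleR has_derivative_inner_left f' L')
  moreover have "(\<Sum>i\<in>Basis. (f x \<bullet> i) *\<^sub>R L' w i + (f' w \<bullet> i) *\<^sub>R L x i) = L' w (f x) + L x (f' w)" for w
    using sum[OF L'_lin, of w "f x"] sum[OF lin[OF U(2)], of "f' w"] by (simp add: sum.distrib)
  ultimately have "((\<lambda>y. \<Sum>i\<in>Basis. (f y \<bullet> i) *\<^sub>R L y i) has_derivative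
      (\<lambda>w. L' w (f x) + L x (f' w))) (at x)"
    by simp
  then show ?thesis
    by (rule has_derivative_transform_within_open[OF _ U]) (use sum lin in metis)
qed

section \<open>Connections in a chart\<close>

lemma has_derivative_bilinear_family:
  fixes f h :: "'a::real_normed_vector \<Rightarrow> 'b::euclidean_space" and B :: "'a \<Rightarrow> 'b \<Rightarrow> 'b \<Rightarrow> 'c::real_normed_vector"
  assumes U: "open U" "x \<in> U"
    and bil: "\<And>y. y \<in> U \<Longrightarrow> bilinear (B y)"
    and B': "\<And>a b. ((\<lambda>y. B y a b) has_derivative (\<lambda>w. B' w a b)) (at x)"
    and f: "(f has_derivative f') (at x)" and h: "(h has_derivative h') (at x)"
  shows "((\<lambda>y. B y (f y) (h y)) has_derivative
    (\<lambda>w. B' w (f x) (h x) + B x (f' w) (h x) + B x (f x) (h' w))) (at x)"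
proof -
  have *: "((\<lambda>y. B y (f y) b) has_derivative (\<lambda>w. B' w (f x) b + B x (f' w) b)) (at x)" for b
    by (rule has_derivative_linear_family[OF U _ B' f]) (use bil in \<open>auto simp: bilinear_def\<close>)
  show ?thesis
    by (rule has_derivative_linear_family[where L = "\<lambda>y. B y (f y)", OF U _ * h])
      (use bil in \<open>auto simp: bilinear_def\<close>)
qed

lemma bilinear_derivative_family:
  fixes B :: "'a::real_normed_vector \<Rightarrow> 'b::euclidean_space \<Rightarrow> 'b \<Rightarrow> 'c::real_normed_vector"
  assumes U: "open U" "x \<in> U"
    and bil: "\<And>y. y \<in> U \<Longrightarrow> bilinear (B y)"
    and B': "\<And>a b. ((\<lambda>y. B y a b) has_derivative (\<lambda>w. B' w a b)) (at x)"
  shows "bilinear (B' w)"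
  unfolding bilinear_def
proof (intro conjI allI)
  show "linear (B' w a)" for a
    by (rule linear_derivative_family[where L = "\<lambda>y. B y a" and L' = "\<lambda>w. B' w a", OF U _ B']) (use bil in \<open>auto simp: bilinear_def\<close>)
  show "linear (\<lambda>a. B' w a b)" for b
    by (rule linear_derivative_family[where L = "\<lambda>y a. B y a b" and L' = "\<lambda>w a. B' w a b", OF U _ B']) (use bil in \<open>auto simp: bilinear_def\<close>)
qed

locale connection_chart =
  fixes U :: "'a::euclidean_space set" and D :: "'a \<Rightarrow> 'a \<Rightarrow> 'a \<Rightarrow> 'a"
  assumes open_U: "open U"
    and bilinear_D: "x \<in> U \<Longrightarrow> bilinear (D x)"
    and smooth_D: "smooth_on U (\<lambda>x. D x a b)"
begin

section \<open>Torsion, curvature and the Bianchi identities in terms of constant vector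
  fields\<close>

definition D1 where "D1 x w a b = frechet_derivative (\<lambda>y. D y a b) (at x) w"
definition D2 where "D2 x z w a b = frechet_derivative (\<lambda>y. D1 y w a b) (at x) z"

text \<open>Constant vector fields commute, so the bracket term is absent and
  \<open>R x a b c\<close> is R(a, b) c.\<close>

definition R where
  "R x a b c = D1 x a b c - D1 x b a c + D x a (D x b c) - D x b (D x a c)"

definition T where "T x a b = D x a b - D x b a"

definition dR where
  "dR x w a b c = D2 x w a b c - D2 x w b a c + D1 x w a (D x b c) + D x a (D1 x w b c)
    - D1 x w b (D x a c) - D x b (D1 x w a c)"

definition dT where "dT x w a b = D1 x w a b - D1 x w b a"

text \<open>\<open>S\<close> is the covariant derivative of the curvature \<open>R\<close>; \<open>dR\<close> and \<open>dT\<close> are the directional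
  derivatives of the components.\<close>

definition S where
  "S x w a b c = dR x w a b c + D x w (R x a b c) - R x (D x w a) b c - R x a (D x w b) c
    - R x a b (D x w c)"

context
  fixes x assumes x: "x \<in> U"
begin

lemma has_derivative_D_const: "((\<lambda>y. D y a b) has_derivative (\<lambda>w. D1 x w a b)) (at x)"
  unfolding D1_def using smooth_on_has_derivative[OF smooth_D x] .

lemma has_derivative_D1_const: "((\<lambda>y. D1 y w a b) has_derivative (\<lambda>z. D2 x z w a b)) (at x)"
  unfolding D1_def D2_def
  using smooth_on_has_derivative[OF smooth_on_frechet_derivative[OF smooth_D] x] .

lemma D2_sym: "D2 x z w a b = D2 x w z a b"
  unfolding D2_def D1_def by (rule mixed_derivatives[OF smooth_D open_U x])

lemma bilinear_D1: "bilinear (D1 x w)"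
  by (rule bilinear_derivative_family[OF open_U x bilinear_D has_derivative_D_const])

lemma linear_D1: "linear (\<lambda>w. D1 x w a b)"
  by (rule has_derivative_linear[OF has_derivative_D_const])

lemmas D_simps = bilinear_simps[OF bilinear_D[OF x]] bilinear_simps[OF bilinear_D1]
  linear_add[OF linear_D1] linear_scale[OF linear_D1] linear_diff[OF linear_D1] linear_neg[OF linear_D1]

lemmas has_derivative_D = has_derivative_bilinear_family[OF open_U x bilinear_D has_derivative_D_const]

lemma bilinear_T: "bilinear (T x)"
  by (auto simp: bilinear_def T_def D_simps algebra_simps intro!: linearI)

lemma linear_R: "linear (R x a b)" "linear (\<lambda>b. R x a b c)" "linear (\<lambda>a. R x a b c)"
  by (auto simp: R_def D_simps algebra_simps intro!: linearI)

lemmas R_simps = bilinear_simps[OF bilinear_T]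
  linear_add[OF linear_R(1)] linear_scale[OF linear_R(1)] linear_diff[OF linear_R(1)] linear_neg[OF linear_R(1)]
  linear_add[OF linear_R(2)] linear_scale[OF linear_R(2)] linear_diff[OF linear_R(2)] linear_neg[OF linear_R(2)]
  linear_add[OF linear_R(3)] linear_scale[OF linear_R(3)] linear_diff[OF linear_R(3)] linear_neg[OF linear_R(3)]

lemma has_derivative_T_const: "((\<lambda>y. T y a b) has_derivative (\<lambda>w. dT x w a b)) (at x)"
  unfolding T_def dT_def by (intro has_derivative_diff has_derivative_D_const)

lemma has_derivative_R_const: "((\<lambda>y. R y a b c) has_derivative (\<lambda>w. dR x w a b c)) (at x)"
proof -
  have "((\<lambda>y. R y a b c) has_derivative (\<lambda>w. D2 x w a b c - D2 x w b a c
      + (D1 x w a (D x b c) + D x 0 (D x b c) + D x a (D1 x w b c))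
      - (D1 x w b (D x a c) + D x 0 (D x a c) + D x b (D1 x w a c)))) (at x)"
    unfolding R_def
    by (intro has_derivative_diff has_derivative_add has_derivative_D1_const has_derivative_D
        has_derivative_const has_derivative_D_const)
  then show ?thesis
    by (simp add: dR_def D_simps algebra_simps)
qed

lemma R_skew: "R x a b c = - R x b a c"
  by (simp add: R_def)

lemma linear_dR: "linear (\<lambda>w. dR x w a b c)"
  by (rule has_derivative_linear[OF has_derivative_R_const])

lemma linear_S_direction: "linear (\<lambda>w. S x w a b c)"
  by (auto simp: S_def linear_add[OF linear_dR] linear_scale[OF linear_dR] D_simps R_simps algebra_simps
      intro!: linearI)

lemma linear_dR_arg: "linear (dR x w a b)"
  by (rule linear_derivative_family[OF open_U x _ has_derivative_R_const])
    (auto intro: connection_chart.linear_R connection_chart_axioms)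

lemma linear_S: "linear (S x w a b)"
  by (auto simp: S_def linear_add[OF linear_dR_arg] linear_scale[OF linear_dR_arg] D_simps R_simps algebra_simps
      intro!: linearI)

lemma S_skew: "S x w a b c = - S x w b a c"
proof -
  have "dR x w a b c = - dR x w b a c"
    by (simp add: dR_def)
  then show ?thesis
    using R_skew[of "D x w a" b c] R_skew[of a "D x w b" c] R_skew[of a b "D x w c"]
      R_skew[of a b c] by (simp add: S_def D_simps)
qed

text \<open>First Bianchi identity of a connection with torsion. The last three groups form the
  cyclic sum of the covariant derivative of \<open>T\<close>.\<close>

lemma bianchi1:
  "R x a b c + R x b c a + R x c a b
    = T x (T x a b) c + T x (T x b c) a + T x (T x c a) b
      + (dT x a b c + D x a (T x b c) - T x (D x a b) c - T x b (D x a c))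
      + (dT x b c a + D x b (T x c a) - T x (D x b c) a - T x c (D x b a))
      + (dT x c a b + D x c (T x a b) - T x (D x c a) b - T x a (D x c b))"
  by (simp add: R_def T_def dT_def D_simps algebra_simps)

text \<open>The second derivatives of the Christoffel maps cancel by \<open>D2_sym\<close>, which
  gives \<open>1\<close>, the identity for \<open>R\<close> as an operator-valued 2-form. The
  Christoffel terms in the two form slots do not cancel, as \<open>D\<close> is not symmetric; by
  \<open>2\<close> they add up to \<open>R\<close> evaluated on \<open>T\<close>.\<close>

lemma bianchi2:
  "S x a b c z + S x b c a z + S x c a b z
    + (R x (T x a b) c z + R x (T x b c) a z + R x (T x c a) b z) = 0"
proof -
  have 1: "dR x a b c z + D x a (R x b c z) - R x b c (D x a z)
      + (dR x b c a z + D x b (R x c a z) - R x c a (D x b z))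
      + (dR x c a b z + D x c (R x a b z) - R x a b (D x c z)) = 0"
    by (simp add: dR_def R_def D_simps D2_sym[of b a] D2_sym[of c a] D2_sym[of c b] algebra_simps)
  have 2: "R x (T x a b) c z + R x (T x b c) a z + R x (T x c a) b z
      = R x (D x a b) c z + R x b (D x a c) z + (R x (D x b c) a z + R x c (D x b a) z)
      + (R x (D x c a) b z + R x a (D x c b) z)"
    using R_skew[of b "D x a c" z] R_skew[of c "D x b a" z] R_skew[of a "D x c b" z]
    by (simp add: T_def R_simps)
  show ?thesis
    unfolding 2 using 1 by (simp add: S_def algebra_simps)
qed

end

section \<open>Connections with parallel torsion\<close>

context
  assumes parallel_T: "x \<in> U \<Longrightarrow> dT x w a b + D x w (T x a b) - T x (D x w a) b - T x a (D x w b) = 0"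
begin

lemma dT_eq: "x \<in> U \<Longrightarrow> dT x w a b = T x (D x w a) b + T x a (D x w b) - D x w (T x a b)"
  using parallel_T[of x w a b] by (simp add: algebra_simps)

context
  fixes x assumes x: "x \<in> U"
begin

lemmas has_derivative_T = has_derivative_bilinear_family[OF open_U x bilinear_T has_derivative_T_const[OF x]]

lemma bianchi1_parallel: "R x a b c + R x b c a + R x c a b = T x (T x a b) c + T x (T x b c) a + T x (T x c a) b"
  unfolding bianchi1[OF x] dT_eq[OF x] by simp

text \<open>Ricci identity for the parallel tensor \<open>T\<close>: differentiate
  \<open>dT_eq\<close> once more and antisymmetrize in the two directions. The left side disappears
  by \<open>D2_sym\<close>, and the right side becomes the action of \<open>R\<close> on
  \<open>T\<close>.\<close>

lemma R_derivation_T: "R x a b (T x c d) = T x (R x a b c) d + T x c (R x a b d)"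
proof -
  \<comment> \<open>The arguments 0 are the derivatives of slots held constant in the product
    rule.\<close>
  have dd: "D2 x v w c d - D2 x v w d c =
      (T x (D1 x v w c) d + T x (D x w c) 0 + dT x v (D x w c) d)
      + (T x c (D1 x v w d) + dT x v c (D x w d)) - (D1 x v w (T x c d) + D x w (dT x v c d))" for v w
  proof -
    have l: "((\<lambda>y. dT y w c d) has_derivative (\<lambda>v. D2 x v w c d - D2 x v w d c)) (at x)"
      unfolding dT_def by (intro has_derivative_diff has_derivative_D1_const x)
    have "((\<lambda>y. T y (D y w c) d + T y c (D y w d) - D y w (T y c d)) has_derivative
       (\<lambda>v. (dT x v (D x w c) d + T x (D1 x v w c) d + T x (D x w c) 0)
         + (dT x v c (D x w d) + T x 0 (D x w d) + T x c (D1 x v w d))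
         - (D1 x v w (T x c d) + D x 0 (T x c d) + D x w (dT x v c d)))) (at x)"
      by (intro has_derivative_diff has_derivative_add has_derivative_T has_derivative_D[OF x]
          has_derivative_D_const has_derivative_T_const has_derivative_const x)
    from has_derivative_unique_open[OF open_U x dT_eq l this] show ?thesis
      by (simp add: D_simps[OF x] R_simps[OF x])
  qed
  have "D2 x a b c d - D2 x a b d c = D2 x b a c d - D2 x b a d c"
    by (simp add: D2_sym[OF x, of b a])
  then show ?thesis
    unfolding dd dT_eq[OF x] by (simp add: R_def D_simps[OF x] R_simps[OF x] algebra_simps)
qed

end

context
  fixes x assumes x: "x \<in> U"
begin

text \<open>Covariant derivative of \<open>bianchi1_parallel\<close>, which is available at every
  point of \<open>U\<close>. Its right side is composed of the parallel \<open>T\<close> and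
  contributes nothing.\<close>

lemma S_bianchi1: "S x w a b c + S x w b c a + S x w c a b = 0"
proof -
  have 1: "((\<lambda>y. R y a b c + R y b c a + R y c a b) has_derivative
      (\<lambda>w. dR x w a b c + dR x w b c a + dR x w c a b)) (at x)"
    by (intro has_derivative_add has_derivative_R_const x)
  have 2: "((\<lambda>y. T y (T y a b) c + T y (T y b c) a + T y (T y c a) b) has_derivative
      (\<lambda>w. (dT x w (T x a b) c + T x (dT x w a b) c + T x (T x a b) 0)
        + (dT x w (T x b c) a + T x (dT x w b c) a + T x (T x b c) 0)
        + (dT x w (T x c a) b + T x (dT x w c a) b + T x (T x c a) 0))) (at x)"
    by (intro has_derivative_add has_derivative_T[OF x] has_derivative_T_const has_derivative_const x)
  have "dR x w a b c + dR x w b c a + dR x w c a b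
      = (dT x w (T x a b) c + T x (dT x w a b) c) + (dT x w (T x b c) a + T x (dT x w b c) a)
        + (dT x w (T x c a) b + T x (dT x w c a) b)"
    using has_derivative_unique_open[OF open_U x _ 1 2, of w] bianchi1_parallel
    by (simp add: R_simps[OF x])
  also have "\<dots> = T x (T x (D x w a) b) c + T x (T x a (D x w b)) c + T x (T x a b) (D x w c)
      + (T x (T x (D x w b) c) a + T x (T x b (D x w c)) a + T x (T x b c) (D x w a))
      + (T x (T x (D x w c) a) b + T x (T x c (D x w a)) b + T x (T x c a) (D x w b))
      - D x w (T x (T x a b) c + T x (T x b c) a + T x (T x c a) b)"
    by (simp add: dT_eq[OF x] D_simps[OF x] R_simps[OF x] algebra_simps)
  finally have dR: "dR x w a b c + dR x w b c a + dR x w c a b = \<dots>" .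
  have "S x w a b c + S x w b c a + S x w c a b
    = (dR x w a b c + dR x w b c a + dR x w c a b) + D x w (R x a b c + R x b c a + R x c a b)
      - (R x (D x w a) b c + R x b c (D x w a) + R x c (D x w a) b)
      - (R x a (D x w b) c + R x (D x w b) c a + R x c a (D x w b))
      - (R x a b (D x w c) + R x b (D x w c) a + R x (D x w c) a b)"
    by (simp add: S_def D_simps[OF x])
  also have "\<dots> = 0"
    unfolding dR bianchi1_parallel[OF x] by simp
  finally show ?thesis .
qed

text \<open>Covariant derivative of \<open>R_derivation_T\<close>; as \<open>T\<close> is parallel,
  only the derivative of \<open>R\<close> survives.\<close>

lemma S_derivation_T: "S x w a b (T x c d) = T x (S x w a b c) d + T x c (S x w a b d)"
proof -
  have 1: "((\<lambda>y. R y a b (T y c d)) has_derivative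
      (\<lambda>w. dR x w a b (T x c d) + R x a b (dT x w c d))) (at x)"
    by (rule has_derivative_linear_family[OF open_U x linear_R(1) has_derivative_R_const[OF x] has_derivative_T_const[OF x]])
  have 2: "((\<lambda>y. T y (R y a b c) d + T y c (R y a b d)) has_derivative
      (\<lambda>w. (dT x w (R x a b c) d + T x (dR x w a b c) d + T x (R x a b c) 0)
        + (dT x w c (R x a b d) + T x 0 (R x a b d) + T x c (dR x w a b d)))) (at x)"
    by (intro has_derivative_add has_derivative_T[OF x] has_derivative_R_const has_derivative_const x)
  have "dR x w a b (T x c d) + R x a b (dT x w c d) = dT x w (R x a b c) d + T x (dR x w a b c) d
      + dT x w c (R x a b d) + T x c (dR x w a b d)"
    using has_derivative_unique_open[OF open_U x _ 1 2, of w] R_derivation_T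
    by (simp add: R_simps[OF x])
  then have dR: "dR x w a b (T x c d) = dT x w (R x a b c) d + T x (dR x w a b c) d
      + dT x w c (R x a b d) + T x c (dR x w a b d) - R x a b (dT x w c d)"
    by (simp add: algebra_simps)
  show ?thesis
    by (simp add: S_def dR dT_eq[OF x] R_derivation_T[OF x] D_simps[OF x] R_simps[OF x] algebra_simps)
qed

end
end

section \<open>Parallel bilinear forms\<close>

context
  fixes \<gamma> :: "'a \<Rightarrow> 'a \<Rightarrow> 'a \<Rightarrow> real"
  assumes bilinear: "\<And>x. x \<in> U \<Longrightarrow> bilinear (\<gamma> x)"
    and smooth: "\<And>a b. smooth_on U (\<lambda>x. \<gamma> x a b)"
    and parallel: "\<And>x w a b. x \<in> U \<Longrightarrow>
      frechet_derivative (\<lambda>y. \<gamma> y a b) (at x) w = \<gamma> x (D x w a) b + \<gamma> x a (D x w b)"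
begin

lemma parallel2_has_derivative:
  assumes x: "x \<in> U"
  shows "((\<lambda>y. \<gamma> y a b) has_derivative (\<lambda>w. \<gamma> x (D x w a) b + \<gamma> x a (D x w b))) (at x)"
  using smooth_on_has_derivative[OF smooth x] by (simp add: parallel[OF x, abs_def])

context
  fixes x assumes x: "x \<in> U"
begin

lemmas parallel2_deriv = parallel2_has_derivative[OF x]

lemma parallel2_slots:
  assumes "(f has_derivative f') (at x)"
  shows "((\<lambda>y. \<gamma> y (f y) b) has_derivative (\<lambda>w. \<gamma> x (D x w (f x)) b + \<gamma> x (f x) (D x w b) + \<gamma> x (f' w) b)) (at x)"
    and "((\<lambda>y. \<gamma> y a (f y)) has_derivative (\<lambda>w. \<gamma> x (D x w a) (f x) + \<gamma> x a (D x w (f x)) + \<gamma> x a (f' w))) (at x)"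
   by (rule has_derivative_linear_family[where L = "\<lambda>y a. \<gamma> y a b", OF open_U x _ parallel2_deriv assms]
      has_derivative_linear_family[where L = "\<lambda>y. \<gamma> y a", OF open_U x _ parallel2_deriv assms];
      use bilinear in \<open>auto simp: bilinear_def\<close>)+

lemmas parallel2_simps = bilinear_simps[OF bilinear[OF x]]

text \<open>Ricci identity: parallelism writes the second derivatives of
  \<open>\<gamma> x c d\<close> through \<open>D\<close> and \<open>D1\<close>, and exchanging the
  two directions leaves the curvature.\<close>

lemma R_skew_parallel2: "\<gamma> x (R x a b c) d + \<gamma> x c (R x a b d) = 0"
proof -
  have dd: "frechet_derivative (\<lambda>y. frechet_derivative (\<lambda>y. \<gamma> y c d) (at y) w) (at x) v
     = (\<gamma> x (D x v (D x w c)) d + \<gamma> x (D x w c) (D x v d) + \<gamma> x (D1 x v w c) d)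
       + (\<gamma> x (D x v c) (D x w d) + \<gamma> x c (D x v (D x w d)) + \<gamma> x c (D1 x v w d))" for v w
    by (rule has_derivative_unique_open[OF open_U x parallel
          smooth_on_has_derivative[OF smooth_on_frechet_derivative[OF smooth] x]])
      (intro has_derivative_add parallel2_slots has_derivative_D_const x | assumption)+
  show ?thesis
    using mixed_derivatives[OF smooth open_U x, of c d a b]
    unfolding dd by (simp add: R_def parallel2_simps algebra_simps)
qed

end

text \<open>Differentiate \<open>R_skew_parallel2\<close>. The terms in which \<open>D\<close> meets
  a slot are instances of that identity with the slot replaced, so only the covariant derivative of
  \<open>R\<close> is left.\<close>

lemma S_skew_parallel2:
  assumes x: "x \<in> U"
  shows "\<gamma> x (S x w a b c) d + \<gamma> x c (S x w a b d) = 0"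
proof -
  have "((\<lambda>y. \<gamma> y (R y a b c) d + \<gamma> y c (R y a b d)) has_derivative
    (\<lambda>w. (\<gamma> x (D x w (R x a b c)) d + \<gamma> x (R x a b c) (D x w d) + \<gamma> x (dR x w a b c) d)
       + (\<gamma> x (D x w c) (R x a b d) + \<gamma> x c (D x w (R x a b d)) + \<gamma> x c (dR x w a b d)))) (at x)"
    by (intro has_derivative_add parallel2_slots has_derivative_R_const x)
  from has_derivative_unique_open[OF open_U x R_skew_parallel2 this has_derivative_const, of w]
  show ?thesis
    using R_skew_parallel2[OF x, of "D x w a" b c d] R_skew_parallel2[OF x, of a "D x w b" c d]
      R_skew_parallel2[OF x, of a b "D x w c" d] R_skew_parallel2[OF x, of a b c "D x w d"]
    by (simp add: S_def parallel2_simps[OF x])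
qed

end

section \<open>Parallel trilinear forms\<close>

context
  fixes \<rho> :: "'a \<Rightarrow> 'a \<Rightarrow> 'a \<Rightarrow> 'a \<Rightarrow> real"
  assumes lin1: "\<And>x b c. x \<in> U \<Longrightarrow> linear (\<lambda>a. \<rho> x a b c)"
    and lin2: "\<And>x a c. x \<in> U \<Longrightarrow> linear (\<lambda>b. \<rho> x a b c)"
    and lin3: "\<And>x a b. x \<in> U \<Longrightarrow> linear (\<lambda>c. \<rho> x a b c)"
    and smooth: "\<And>a b c. smooth_on U (\<lambda>x. \<rho> x a b c)"
    and parallel: "\<And>x w a b c. x \<in> U \<Longrightarrow> frechet_derivative (\<lambda>y. \<rho> y a b c) (at x) w
      = \<rho> x (D x w a) b c + \<rho> x a (D x w b) c + \<rho> x a b (D x w c)"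
begin

lemma parallel3_has_derivative:
  assumes x: "x \<in> U"
  shows "((\<lambda>y. \<rho> y a b c) has_derivative
    (\<lambda>w. \<rho> x (D x w a) b c + \<rho> x a (D x w b) c + \<rho> x a b (D x w c))) (at x)"
  using smooth_on_has_derivative[OF smooth x] by (simp add: parallel[OF x, abs_def])

context
  fixes x assumes x: "x \<in> U"
begin

lemmas parallel3_deriv = parallel3_has_derivative[OF x]

lemma parallel3_slots:
  assumes "(f has_derivative f') (at x)"
  shows "((\<lambda>y. \<rho> y (f y) b c) has_derivative (\<lambda>w. \<rho> x (D x w (f x)) b c + \<rho> x (f x) (D x w b) c
      + \<rho> x (f x) b (D x w c) + \<rho> x (f' w) b c)) (at x)"
    and "((\<lambda>y. \<rho> y a (f y) c) has_derivative (\<lambda>w. \<rho> x (D x w a) (f x) c + \<rho> x a (D x w (f x)) c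
      + \<rho> x a (f x) (D x w c) + \<rho> x a (f' w) c)) (at x)"
    and "((\<lambda>y. \<rho> y a b (f y)) has_derivative (\<lambda>w. \<rho> x (D x w a) b (f x) + \<rho> x a (D x w b) (f x)
      + \<rho> x a b (D x w (f x)) + \<rho> x a b (f' w))) (at x)"
  by (rule has_derivative_linear_family[where L = "\<lambda>y a. \<rho> y a b c", OF open_U x lin1 parallel3_deriv assms]
      has_derivative_linear_family[where L = "\<lambda>y b. \<rho> y a b c", OF open_U x lin2 parallel3_deriv assms]
      has_derivative_linear_family[where L = "\<lambda>y c. \<rho> y a b c", OF open_U x lin3 parallel3_deriv assms]; assumption)+

lemmas parallel3_simps =
  linear_add[OF lin1[OF x]] linear_diff[OF lin1[OF x]] linear_add[OF lin2[OF x]] linear_diff[OF lin2[OF x]]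
  linear_add[OF lin3[OF x]] linear_diff[OF lin3[OF x]]

lemma R_parallel3: "\<rho> x (R x a b c) d e + \<rho> x c (R x a b d) e + \<rho> x c d (R x a b e) = 0"
proof -
  have dd: "frechet_derivative (\<lambda>y. frechet_derivative (\<lambda>y. \<rho> y c d e) (at y) w) (at x) v
     = (\<rho> x (D x v (D x w c)) d e + \<rho> x (D x w c) (D x v d) e + \<rho> x (D x w c) d (D x v e)
         + \<rho> x (D1 x v w c) d e)
       + (\<rho> x (D x v c) (D x w d) e + \<rho> x c (D x v (D x w d)) e + \<rho> x c (D x w d) (D x v e)
         + \<rho> x c (D1 x v w d) e)
       + (\<rho> x (D x v c) d (D x w e) + \<rho> x c (D x v d) (D x w e) + \<rho> x c d (D x v (D x w e))
         + \<rho> x c d (D1 x v w e))" for v w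
    by (rule has_derivative_unique_open[OF open_U x parallel
          smooth_on_has_derivative[OF smooth_on_frechet_derivative[OF smooth] x]])
      (intro has_derivative_add parallel3_slots has_derivative_D_const x | assumption)+
  show ?thesis
    using mixed_derivatives[OF smooth open_U x, of c d e a b]
    unfolding dd by (simp add: R_def parallel3_simps algebra_simps)
qed

end

lemma S_parallel3:
  assumes x: "x \<in> U"
  shows "\<rho> x (S x w a b c) d e + \<rho> x c (S x w a b d) e + \<rho> x c d (S x w a b e) = 0"
proof -
  have "((\<lambda>y. \<rho> y (R y a b c) d e + \<rho> y c (R y a b d) e + \<rho> y c d (R y a b e)) has_derivative
    (\<lambda>w. (\<rho> x (D x w (R x a b c)) d e + \<rho> x (R x a b c) (D x w d) e + \<rho> x (R x a b c) d (D x w e)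
         + \<rho> x (dR x w a b c) d e)
       + (\<rho> x (D x w c) (R x a b d) e + \<rho> x c (D x w (R x a b d)) e + \<rho> x c (R x a b d) (D x w e)
         + \<rho> x c (dR x w a b d) e)
       + (\<rho> x (D x w c) d (R x a b e) + \<rho> x c (D x w d) (R x a b e) + \<rho> x c d (D x w (R x a b e))
         + \<rho> x c d (dR x w a b e)))) (at x)"
    by (intro has_derivative_add parallel3_slots has_derivative_R_const x)
  from has_derivative_unique_open[OF open_U x R_parallel3 this has_derivative_const, of w]
  show ?thesis
    using R_parallel3[OF x, of "D x w a" b c d e] R_parallel3[OF x, of a "D x w b" c d e]
      R_parallel3[OF x, of a b "D x w c" d e] R_parallel3[OF x, of a b c "D x w d" e]
      R_parallel3[OF x, of a b c d "D x w e"]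
    by (simp add: S_def parallel3_simps[OF x])
qed

end
end

section \<open>The forms \<open>\<rho>\<close> and the projection onto \<open>Lam2_20\<close>\<close>

lemma less_8:
  "(0::8) < 1" "(0::8) < 2" "(0::8) < 3" "(0::8) < 4" "(0::8) < 5" "(0::8) < 6" "(0::8) < 7"
  "(1::8) < 2" "(1::8) < 3" "(1::8) < 4" "(1::8) < 5" "(1::8) < 6" "(1::8) < 7"
  "(2::8) < 3" "(2::8) < 4" "(2::8) < 5" "(2::8) < 6" "(2::8) < 7"
  "(3::8) < 4" "(3::8) < 5" "(3::8) < 6" "(3::8) < 7"
  "(4::8) < 5" "(4::8) < 6" "(4::8) < 7" "(5::8) < 6" "(5::8) < 7" "(6::8) < 7"
  by (simp_all add: less_bit0_def bit0.Rep_numeral bit0.Rep_0 bit0.Rep_1)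

lemma hook_axis: "hook X (axis K 1) = (\<Sum>i\<in>K. (X $ i * (- 1) ^ card (K \<inter> {..<i})) *\<^sub>R axis (K - {i}) 1)"
proof (subst vec_eq_iff, intro allI)
  fix L
  have 1: "L \<inter> {..<i} = K \<inter> {..<i}" if "K = insert i L" for i
    using that by auto
  have "hook X (axis K 1) $ L = (\<Sum>i\<in>UNIV. if i \<notin> L \<and> insert i L = K then X $ i * (- 1) ^ card (K \<inter> {..<i}) else 0)"
    unfolding hook_def using 1 unfolding Int_def lessThan_def mem_Collect_eq
    by (auto simp: axis_def intro!: sum.mono_neutral_cong_left)
  also have "\<dots> = (\<Sum>i\<in>UNIV. if i \<in> K \<and> L = K - {i} then X $ i * (- 1) ^ card (K \<inter> {..<i}) else 0)"
    by (intro sum.cong refl if_cong) auto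
  also have "\<dots> = (\<Sum>i\<in>K. (X $ i * (- 1) ^ card (K \<inter> {..<i})) *\<^sub>R axis (K - {i}) 1) $ L"
    by (auto simp: axis_def intro!: sum.mono_neutral_cong_right)
  finally show "hook X (axis K 1) $ L = (\<Sum>i\<in>K. (X $ i * (- 1) ^ card (K \<inter> {..<i})) *\<^sub>R axis (K - {i}) 1) $ L" .
qed

lemma linear_hook: "linear (hook X)"
  by (auto simp: hook_def vec_eq_iff algebra_simps sum.distrib sum_distrib_left intro!: linearI)

lemmas hook_simps = linear_add[OF linear_hook] linear_diff[OF linear_hook] linear_scale[OF linear_hook]

lemma hook_axis_3:
  assumes "i < j" "j < k"
  shows "hook X (axis {i, j, k} 1) = X $ i *\<^sub>R axis {j, k} 1 - X $ j *\<^sub>R axis {i, k} 1 + X $ k *\<^sub>R axis {i, j} 1"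
proof -
  have "i < k" "i \<noteq> j" "i \<noteq> k" "j \<noteq> k" "\<not> j < i" "\<not> k < i" "\<not> k < j"
    using assms by auto
  with assms show ?thesis
    by (simp add: hook_axis insert_Diff_if)
qed

lemma hook_axis_2:
  assumes "i < j"
  shows "hook X (axis {i, j} 1) = X $ i *\<^sub>R axis {j} 1 - X $ j *\<^sub>R axis {i} 1"
  using assms by (auto simp: hook_axis insert_Diff_if)

lemma hook_axis_1: "hook X (axis {i} 1) = X $ i *\<^sub>R axis {} 1"
  by (simp add: hook_axis)

text \<open>The 3 by 3 minor in the columns \<open>i\<close>, \<open>j\<close>, \<open>k\<close>,
  expanded along \<open>X\<close>.\<close>

definition det3 :: "8 \<Rightarrow> 8 \<Rightarrow> 8 \<Rightarrow> R8 \<Rightarrow> R8 \<Rightarrow> R8 \<Rightarrow> real" where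
  "det3 i j k X Y Z = X $ i * (Y $ j * Z $ k - Y $ k * Z $ j) - X $ j * (Y $ i * Z $ k - Y $ k * Z $ i)
    + X $ k * (Y $ i * Z $ j - Y $ j * Z $ i)"

lemma form_eval_axis_3:
  assumes "i < j" "j < k"
  shows "form_eval (axis {i, j, k} 1) [X, Y, Z] = det3 i j k X Y Z"
proof -
  have "i < k" using assms by simp
  with assms show ?thesis
    by (simp add: form_eval_def hook_axis_3 hook_axis_2 hook_axis_1 hook_simps det3_def algebra_simps)
qed

lemma form_eval_linear:
  "form_eval (\<alpha> + \<beta>) Xs = form_eval \<alpha> Xs + form_eval \<beta> Xs"
  "form_eval (\<alpha> - \<beta>) Xs = form_eval \<alpha> Xs - form_eval \<beta> Xs"
  "form_eval (c *\<^sub>R \<alpha>) Xs = c * form_eval \<alpha> Xs"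
proof -
  have "fold hook Xs (\<alpha> + \<beta>) = fold hook Xs \<alpha> + fold hook Xs \<beta>"
    "fold hook Xs (\<alpha> - \<beta>) = fold hook Xs \<alpha> - fold hook Xs \<beta>"
    "fold hook Xs (c *\<^sub>R \<alpha>) = c *\<^sub>R fold hook Xs \<alpha>"
    by (induction Xs arbitrary: \<alpha> \<beta>) (simp_all add: hook_simps)
  then show "form_eval (\<alpha> + \<beta>) Xs = form_eval \<alpha> Xs + form_eval \<beta> Xs"
  "form_eval (\<alpha> - \<beta>) Xs = form_eval \<alpha> Xs - form_eval \<beta> Xs"
  "form_eval (c *\<^sub>R \<alpha>) Xs = c * form_eval \<alpha> Xs"
    by (simp_all add: form_eval_def)
qed

lemma one_form_axis: "one_form (axis i 1) = axis {i} 1"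
  by (simp add: one_form_def axis_def if_distrib[of "\<lambda>c. c *\<^sub>R _"] cong: if_cong)

lemma bilinear_wedge: "bilinear (\<and>\<^sub>f)"
  by (auto simp: bilinear_def wedge_def vec_eq_iff algebra_simps sum.distrib sum_distrib_left intro!: linearI)

lemma wedge_axis_axis:
  "axis I 1 \<and>\<^sub>f axis J 1 = (if I \<inter> J = {} then shuffle_sign I J *\<^sub>R axis (I \<union> J) 1 else 0)"
proof (subst vec_eq_iff, intro allI)
  fix K
  have iff: "I \<subseteq> K \<and> K - I = J \<longleftrightarrow> I \<inter> J = {} \<and> K = I \<union> J"
    by blast
  have "(axis I 1 \<and>\<^sub>f axis J 1) $ K = (\<Sum>L\<in>Pow K. if L = I then if K - I = J then shuffle_sign I J else 0 else 0)"
    unfolding wedge_def axis_def vec_lambda_beta by (intro sum.cong refl) simp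
  also have "\<dots> = (if I \<inter> J = {} then shuffle_sign I J *\<^sub>R axis (I \<union> J) 1 else 0) $ K"
    using iff by (auto simp: sum.delta axis_def)
  finally show "(axis I 1 \<and>\<^sub>f axis J 1) $ K
    = (if I \<inter> J = {} then shuffle_sign I J *\<^sub>R axis (I \<union> J) 1 else 0) $ K" .
qed

lemma wedge_axis:
  assumes "\<forall>i\<in>I. \<forall>j\<in>J. i < j"
  shows "axis I 1 \<and>\<^sub>f axis J 1 = axis (I \<union> J) 1"
proof -
  have "{(i, j). i \<in> I \<and> j \<in> J \<and> j < i} = {}"
    using assms by (auto dest: order.asym)
  then have "shuffle_sign I J = 1"
    by (simp only: shuffle_sign_def card.empty power_0)
  moreover have "I \<inter> J = {}"
    using assms by fastforce
  ultimately show ?thesis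
    by (simp add: wedge_axis_axis)
qed

lemma e_wedge_Cons: "e_wedge (n # ns) = axis {of_nat (n - 1)} 1 \<and>\<^sub>f e_wedge ns"
  by (simp add: e_wedge_def one_form_axis)

lemma e_wedge_Nil: "e_wedge [] = axis {} 1"
  by (simp add: e_wedge_def)

text \<open>The labels 1 to 8 become the indices 0 to 7. All index lists in \<open>rho0_def\<close>
  are increasing, so the wedge products produce no signs.\<close>

lemma rho0_axis:
  "rho0 = axis {1, 3, 5} 1 - axis {1, 2, 4} 1 - axis {0, 3, 4} 1 - axis {0, 2, 5} 1
    + axis {0, 1, 6} 1 + axis {2, 3, 6} 1 - 2 *\<^sub>R axis {4, 5, 6} 1
    + sqrt 3 *\<^sub>R axis {0, 1, 7} 1 - sqrt 3 *\<^sub>R axis {2, 3, 7} 1"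
proof -
  have "e_wedge [i, j, k] = axis {of_nat (i - 1), of_nat (j - 1), of_nat (k - 1)} 1"
    if "(of_nat (i - 1) :: 8) < of_nat (j - 1)" "(of_nat (j - 1) :: 8) < of_nat (k - 1)" for i j k
  proof -
    have "(of_nat (i - 1) :: 8) < of_nat (k - 1)" using that by simp
    with that show ?thesis
      by (simp add: e_wedge_Cons e_wedge_Nil wedge_axis insert_commute)
  qed
  note e3 = this
  have e2: "e_wedge [i, j] \<and>\<^sub>f e_wedge [k] = axis {of_nat (i - 1), of_nat (j - 1), of_nat (k - 1)} 1"
    if "(of_nat (i - 1) :: 8) < of_nat (j - 1)" "(of_nat (j - 1) :: 8) < of_nat (k - 1)" for i j k
  proof -
    have "(of_nat (i - 1) :: 8) < of_nat (k - 1)" using that by simp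
    with that show ?thesis
      by (simp add: e_wedge_Cons e_wedge_Nil wedge_axis insert_commute)
  qed
  show ?thesis
    unfolding rho0_def by (simp add: bilinear_simps[OF bilinear_wedge] e2 e3 less_8 algebra_simps)
qed

lemma form_eval_rho0:
  "form_eval rho0 [X, Y, Z] = det3 1 3 5 X Y Z - det3 1 2 4 X Y Z - det3 0 3 4 X Y Z - det3 0 2 5 X Y Z
    + det3 0 1 6 X Y Z + det3 2 3 6 X Y Z - 2 * det3 4 5 6 X Y Z
    + sqrt 3 * det3 0 1 7 X Y Z - sqrt 3 * det3 2 3 7 X Y Z"
  by (simp add: rho0_axis form_eval_linear form_eval_axis_3 less_8)

lemma rho0_degree: "rho0 \<in> Lam 3"
  unfolding rho0_axis Lam_def by (auto simp: axis_def)

section \<open>Values of forms on two vectors\<close>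

definition coeff2 :: "form \<Rightarrow> 8 \<Rightarrow> 8 \<Rightarrow> real" where
  "coeff2 \<alpha> i j = (if i = j then 0 else (if j < i then - 1 else 1) * \<alpha> $ {i, j})"

lemma coeff2_skew: "coeff2 \<alpha> i j = - coeff2 \<alpha> j i"
  by (auto simp: coeff2_def insert_commute not_less_iff_gr_or_eq)

lemma form_eval_2: "form_eval \<alpha> [X, Y] = (\<Sum>j\<in>UNIV. \<Sum>i\<in>UNIV. X $ i * Y $ j * coeff2 \<alpha> i j)"
proof -
  have "card {l \<in> {j}. l < i} = (if j < i then 1 else 0)" for i j :: 8
    by (auto simp: Collect_conv_if)
  then have sign: "(- 1 :: real) ^ card {l \<in> {j}. l < i} = (if j < i then - 1 else 1)" for i j :: 8
    by (simp only:) simp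
  have "form_eval \<alpha> [X, Y] = (\<Sum>j\<in>UNIV. Y $ j * (\<Sum>i\<in>- {j}. X $ i * (if j < i then - 1 else 1) * \<alpha> $ {i, j}))"
    by (simp only: form_eval_def hook_def fold.simps comp_apply id_apply vec_lambda_beta sign) simp
  also have "\<dots> = (\<Sum>j\<in>UNIV. Y $ j * (\<Sum>i\<in>UNIV. X $ i * coeff2 \<alpha> i j))"
    by (intro sum.cong refl arg_cong[where f = "times _"] sum.mono_neutral_cong_left) (auto simp: coeff2_def)
  finally show ?thesis
    by (simp add: sum_distrib_left mult_ac)
qed

text \<open>Evaluation on two vectors sees only the coefficients at two-element sets. The contorsion
  is therefore skew whatever the degrees of the forms that build it.\<close>

lemma form_eval_2_skew: "form_eval \<alpha> [X, Y] = - form_eval \<alpha> [Y, X]"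
proof -
  have "form_eval \<alpha> [X, Y] = (\<Sum>j\<in>UNIV. \<Sum>i\<in>UNIV. X $ j * Y $ i * coeff2 \<alpha> j i)"
    unfolding form_eval_2 by (rule sum.swap)
  also have "\<dots> = (\<Sum>j\<in>UNIV. \<Sum>i\<in>UNIV. - (Y $ i * X $ j * coeff2 \<alpha> i j))"
    by (intro sum.cong refl) (subst coeff2_skew, simp)
  finally show ?thesis
    by (simp add: form_eval_2 sum_negf)
qed

lemma form_eval_2_basis: "form_eval \<alpha> [axis i 1, axis j 1] = coeff2 \<alpha> i j"
proof -
  have "form_eval \<alpha> [axis i 1, axis j 1] = (\<Sum>l\<in>UNIV. if l = j then \<Sum>k\<in>UNIV. if k = i then coeff2 \<alpha> k l else 0 else 0)"
    unfolding form_eval_2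
    by (intro sum.cong refl) (simp add: axis_def if_distrib[of "\<lambda>c. c * _"] cong: if_cong)
  then show ?thesis by simp
qed

lemma form_eval_hook: "form_eval \<alpha> (X # Xs) = form_eval (hook X \<alpha>) Xs"
  by (simp add: form_eval_def)

lemma linear_form_eval: "linear (\<lambda>\<alpha>. form_eval \<alpha> Xs)"
  by (rule linearI) (simp_all add: form_eval_linear)

lemma form_eval_wedge_one_forms:
  "form_eval (one_form (axis i 1) \<and>\<^sub>f one_form (axis j 1)) [X, Y] = X $ i * Y $ j - X $ j * Y $ i"
proof -
  have less: "form_eval (axis {i, j} 1) [X, Y] = X $ i * Y $ j - X $ j * Y $ i" if "i < j" for i j
    using that by (simp add: form_eval_def hook_axis_2 hook_axis_1 hook_simps)
  consider "i < j" | "i = j" | "j < i" by (rule linorder_cases)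
  then show ?thesis
  proof cases
    case 3
    then have "{(i', j'). i' \<in> {i} \<and> j' \<in> {j} \<and> j' < i'} = {(i, j)}"
      by auto
    then have "shuffle_sign {i} {j} = - 1"
      unfolding shuffle_sign_def by (simp only:) simp
    then show ?thesis
      using 3 less[OF 3] form_eval_linear(3)[of "-1" "axis {j, i} 1" "[X, Y]"]
      by (simp add: one_form_axis wedge_axis_axis insert_commute)
  next
    case 2
    then show ?thesis
      using form_eval_linear(3)[of 0 0 "[X, Y]"] by (simp add: one_form_axis wedge_axis_axis)
  next
    case 1
    then show ?thesis
      by (simp add: one_form_axis wedge_axis less insert_commute)
  qed
qed

text \<open>Every unordered pair occurs twice in the double sum, with equal contributions as
  \<open>a\<close> is skew; hence the factor 1/2.\<close>

lemma connection_matrix_form: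
  assumes "\<And>i j. a i j = - a j i"
  shows "form_eval ((1/2) *\<^sub>R (\<Sum>i\<in>UNIV. \<Sum>j\<in>UNIV. a i j *\<^sub>R (one_form (axis i 1) \<and>\<^sub>f one_form (axis j 1))))
    [axis k 1, axis l 1] = a k l"
proof -
  let ?e = "\<lambda>i. axis i 1 :: R8"
  have "form_eval ((1/2) *\<^sub>R (\<Sum>i\<in>UNIV. \<Sum>j\<in>UNIV. a i j *\<^sub>R (one_form (?e i) \<and>\<^sub>f one_form (?e j)))) [?e k, ?e l]
    = (1/2) * (\<Sum>i\<in>UNIV. \<Sum>j\<in>UNIV. a i j * (?e k $ i * ?e l $ j - ?e k $ j * ?e l $ i))"
    by (simp only: form_eval_linear linear_sum[OF linear_form_eval] form_eval_wedge_one_forms)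
  also have "(\<Sum>i\<in>UNIV. \<Sum>j\<in>UNIV. a i j * (?e k $ i * ?e l $ j - ?e k $ j * ?e l $ i))
    = (\<Sum>i\<in>UNIV. \<Sum>j\<in>UNIV. (if i = k then if j = l then a i j else 0 else 0)
        - (if i = l then if j = k then a i j else 0 else 0))"
    by (intro sum.cong refl) (auto simp: axis_def)
  also have "\<dots> = (\<Sum>i\<in>UNIV. (if i = k then a i l else 0) - (if i = l then a i k else 0))"
    by (intro sum.cong refl) (auto simp: sum_subtractf)
  also have "\<dots> = a k l - a l k"
    by (simp add: sum_subtractf)
  finally show ?thesis
    using assms[of l k] by simp
qed

section \<open>The orthogonal complement of \<open>Lam2_20\<close>\<close>

lemma subspace_Lam2_20: "subspace Lam2_20"
  unfolding Lam2_20_def Lam_def subspace_def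
  by (auto simp: bilinear_simps[OF bilinear_wedge])

text \<open>The description in \<open>pr_m_def\<close> is proper: orthogonal decompositions exist,
  and two candidates differ by an element of \<open>Lam2_20\<close> orthogonal to itself.\<close>

lemma pr_m_orthogonal:
  assumes "\<zeta> \<in> Lam2_20"
  shows "(\<omega> - pr_m \<omega>) \<bullet> \<zeta> = 0"
proof -
  have span: "span Lam2_20 = Lam2_20"
    using subspace_Lam2_20 by (simp add: span_eq_iff)
  obtain y z where yz: "y \<in> span Lam2_20" "\<And>w. w \<in> span Lam2_20 \<Longrightarrow> orthogonal z w" "\<omega> = y + z"
    using orthogonal_subspace_decomp_exists[of Lam2_20 \<omega>] by blast
  let ?P = "\<lambda>\<eta>. \<eta> \<in> Lam2_20 \<and> (\<forall>\<zeta>\<in>Lam2_20. (\<omega> - \<eta>) \<bullet> \<zeta> = 0)"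
  have "?P (pr_m \<omega>)"
    unfolding pr_m_def
  proof (rule theI[of ?P])
    show "?P y"
      using yz span by (auto simp: orthogonal_def)
    fix \<eta> assume "?P \<eta>"
    then have "(\<eta> - y) \<bullet> \<zeta> = 0" if "\<zeta> \<in> Lam2_20" for \<zeta>
      using that yz span by (auto simp: orthogonal_def inner_diff_left inner_add_left)
    moreover have "\<eta> - y \<in> Lam2_20"
      using \<open>?P \<eta>\<close> yz span subspace_diff[OF subspace_Lam2_20] by auto
    ultimately have "(\<eta> - y) \<bullet> (\<eta> - y) = 0"
      by blast
    then show "\<eta> = y" by simp
  qed
  then show ?thesis
    using assms by blast
qed

lemma shuffle_sign_insert:
  assumes "k \<notin> I" "k \<notin> L"
  shows "shuffle_sign (insert k I) L = shuffle_sign I L * (- 1) ^ card {j \<in> L. j < k}"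
proof -
  have "{(i, j). i \<in> insert k I \<and> j \<in> L \<and> j < i} = {(i, j). i \<in> I \<and> j \<in> L \<and> j < i} \<union> Pair k ` {j \<in> L. j < k}"
    by auto
  moreover have "{(i, j). i \<in> I \<and> j \<in> L \<and> j < i} \<inter> Pair k ` {j \<in> L. j < k} = {}"
    using assms by auto
  moreover have "card (Pair k ` {j \<in> L. j < k}) = card {j \<in> L. j < k}"
    by (rule card_image) (simp add: inj_on_def)
  ultimately have "card {(i, j). i \<in> insert k I \<and> j \<in> L \<and> j < i}
      = card {(i, j). i \<in> I \<and> j \<in> L \<and> j < i} + card {j \<in> L. j < k}"
    by (simp only: card_Un_disjoint finite)
  then show ?thesis
    by (simp add: shuffle_sign_def power_add)
qed

text \<open>The product is a 7-form, and its coefficients are, up to sign, the inner products of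
  \<omega> with the \<open>hook (axis k 1) rho0\<close>. So \<open>Lam2_20\<close> is the orthogonal
  complement of these forms among the 2-forms.\<close>

lemma wedge_hodge_rho0:
  assumes \<omega>: "\<omega> \<in> Lam 2"
  shows "\<omega> \<and>\<^sub>f hodge rho0 = (\<Sum>k\<in>UNIV. ((- 1) ^ card {j. j < k} * (\<omega> \<bullet> hook (axis k 1) rho0)) *\<^sub>R axis (- {k}) 1)"
    (is "_ = ?rhs")
proof (subst vec_eq_iff, intro allI)
  fix K
  have wedge: "(\<omega> \<and>\<^sub>f hodge rho0) $ K = (\<Sum>I\<in>Pow K. shuffle_sign I (K - I) * shuffle_sign (- (K - I)) (K - I)
      * \<omega> $ I * rho0 $ (- (K - I)))"
    unfolding wedge_def hodge_def vec_lambda_beta by (intro sum.cong refl) (simp only: mult_ac)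
  have rhs: "?rhs $ K = (\<Sum>k\<in>UNIV. if K = - {k} then (- 1) ^ card {j. j < k} * (\<omega> \<bullet> hook (axis k 1) rho0) else 0)"
    by (auto simp: axis_def intro!: sum.cong)
  show "(\<omega> \<and>\<^sub>f hodge rho0) $ K = ?rhs $ K"
  proof (cases "\<exists>k. K = - {k}")
    case True
    then obtain k where K: "K = - {k}" by blast
    have hook: "hook (axis k 1) rho0 $ I = (if k \<in> I then 0 else (- 1) ^ card {j \<in> I. j < k} * rho0 $ insert k I)" for I
    proof -
      have "hook (axis k 1) rho0 $ I = (\<Sum>i\<in>- I. if i = k then (- 1) ^ card {j \<in> I. j < i} * rho0 $ insert i I else 0)"
        unfolding hook_def vec_lambda_beta by (intro sum.cong refl) (auto simp: axis_def)
      then show ?thesis by simp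
    qed
    \<comment> \<open>The two shuffle signs share a factor that squares to one. The sign left over
      counts the indices below \<open>k\<close> outside \<open>I\<close>; it is the sign counting
      all indices below \<open>k\<close> times the sign in \<open>hook\<close>.\<close>
    have summand: "shuffle_sign I (K - I) * shuffle_sign (- (K - I)) (K - I) * \<omega> $ I * rho0 $ (- (K - I))
      = (- 1) ^ card {j. j < k} * (\<omega> $ I * hook (axis k 1) rho0 $ I)" if "I \<in> Pow K" for I
    proof -
      have k: "k \<notin> I" "k \<notin> K - I" and compl: "- (K - I) = insert k I"
        using that K by auto
      have "{j. j < k} = {j \<in> I. j < k} \<union> {j \<in> K - I. j < k}"
        using K by auto
      moreover have "{j \<in> I. j < k} \<inter> {j \<in> K - I. j < k} = {}"
        by auto
      ultimately have "card {j. j < k} = card {j \<in> I. j < k} + card {j \<in> K - I. j < k}"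
        by (simp only: card_Un_disjoint finite)
      then have "(- 1 :: real) ^ card {j. j < k} * (- 1) ^ card {j \<in> I. j < k} = (- 1) ^ card {j \<in> K - I. j < k}"
        by (simp add: power_add)
      moreover have "shuffle_sign I (K - I) * shuffle_sign I (K - I) = 1"
        by (simp add: shuffle_sign_def flip: power_mult_distrib)
      ultimately show ?thesis
        unfolding compl shuffle_sign_insert[OF k] hook using k by (simp add: mult_ac)
    qed
    have "(\<Sum>I\<in>Pow K. (- 1) ^ card {j. j < k} * (\<omega> $ I * hook (axis k 1) rho0 $ I))
      = (- 1) ^ card {j. j < k} * (\<omega> \<bullet> hook (axis k 1) rho0)"
      unfolding inner_vec_def sum_distrib_left inner_real_def
      by (rule sum.mono_neutral_left) (auto simp: K hook)
    moreover have "?rhs $ K = (- 1) ^ card {j. j < k} * (\<omega> \<bullet> hook (axis k 1) rho0)"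
      unfolding rhs by (simp add: K)
    ultimately show ?thesis
      unfolding wedge by (simp only: summand cong: sum.cong)
  next
    case False
    \<comment> \<open>A nonzero term has factors of degrees 2 and 3, which would leave exactly one
      index outside \<open>K\<close>.\<close>
    have "\<omega> $ I * rho0 $ (- (K - I)) = 0" if "I \<in> Pow K" for I
    proof (rule ccontr)
      assume "\<omega> $ I * rho0 $ (- (K - I)) \<noteq> 0"
      then have "card I = 2" "card (- (K - I)) = 3"
        using \<omega> rho0_degree by (auto simp: Lam_def)
      moreover have "- (K - I) = - K \<union> I" "- K \<inter> I = {}"
        using that by auto
      ultimately have "card (- K) = 1"
        using card_Un_disjoint[of "- K" I] by simp
      then obtain k where "- K = {k}"
        by (rule card_1_singletonE)
      then have "K = - {k}" by blast
      with False show False by blast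
    qed
    then have "(\<omega> \<and>\<^sub>f hodge rho0) $ K = 0"
      unfolding wedge by (intro sum.neutral ballI) (simp only: mult.assoc mult_zero_right)
    moreover have "?rhs $ K = 0"
      unfolding rhs using False by (intro sum.neutral) auto
    ultimately show ?thesis by simp
  qed
qed

text \<open>Double orthogonal complement: the residue \<open>z\<close> of the projection onto the
  span of the \<open>hook (axis k 1) rho0\<close> lies in \<open>Lam2_20\<close> by
  \<open>wedge_hodge_rho0\<close>, so it is orthogonal to \<beta> and to \<open>n\<close>, hence to
  itself.\<close>

lemma orthogonal_Lam2_20:
  assumes "\<And>\<zeta>. \<zeta> \<in> Lam2_20 \<Longrightarrow> \<beta> \<bullet> \<zeta> = 0"
  obtains a where "\<And>i j. form_eval \<beta> [axis i 1, axis j 1] = (\<Sum>k\<in>UNIV. a k * form_eval rho0 [axis k 1, axis i 1, axis j 1])"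
proof -
  \<comment> \<open>The part of degree 2; it is all that elements of \<open>Lam2_20\<close> and
    evaluation on two vectors detect.\<close>
  define \<beta>2 :: form where "\<beta>2 = (\<chi> I. if card I = 2 then \<beta> $ I else 0)"
  let ?N = "range (\<lambda>k. hook (axis k 1) rho0)"
  obtain n z where nz: "n \<in> span ?N" "\<And>w. w \<in> span ?N \<Longrightarrow> orthogonal z w" "\<beta>2 = n + z"
    using orthogonal_subspace_decomp_exists[of ?N \<beta>2] by blast
  have "subspace (Lam 2)"
    by (auto simp: subspace_def Lam_def)
  moreover have "?N \<subseteq> Lam 2"
    using rho0_degree by (auto simp: Lam_def hook_def intro!: sum.neutral)
  ultimately have "n \<in> Lam 2"
    using nz(1) span_minimal by blast
  then have z2: "z \<in> Lam 2"
    using nz(3) by (auto simp: Lam_def \<beta>2_def vec_eq_iff) (metis add_0)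
  have "z \<bullet> hook (axis k 1) rho0 = 0" for k
    using nz(2)[OF span_base, of "hook (axis k 1) rho0"] by (auto simp: orthogonal_def)
  then have "z \<in> Lam2_20"
    using z2 by (simp add: Lam2_20_def wedge_hodge_rho0)
  then have "\<beta> \<bullet> z = 0"
    by (rule assms)
  moreover have "\<beta> \<bullet> z = \<beta>2 \<bullet> z"
    using z2 by (auto simp: inner_vec_def \<beta>2_def Lam_def intro!: sum.cong)
  moreover have "n \<bullet> z = 0"
    using nz(2)[OF nz(1)] by (simp add: orthogonal_def inner_commute)
  ultimately have "z = 0"
    by (simp add: nz(3) inner_add_left)
  then have "\<beta>2 \<in> span ?N"
    using nz by simp
  moreover have "span ?N \<subseteq> {v. \<exists>a. v = (\<Sum>k\<in>UNIV. a k *\<^sub>R hook (axis k 1) rho0)}" (is "_ \<subseteq> ?V")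
  proof (rule span_minimal)
    have "\<exists>a. hook (axis k 1) rho0 = (\<Sum>k\<in>UNIV. a k *\<^sub>R hook (axis k 1) rho0)" for k :: 8
      by (rule exI[of _ "\<lambda>j. if j = k then 1 else 0"])
        (simp add: if_distrib[of "\<lambda>c. c *\<^sub>R _"] cong: if_cong)
    then show "?N \<subseteq> ?V" by blast
    have "\<exists>a. v + v' = (\<Sum>k\<in>UNIV. a k *\<^sub>R hook (axis k 1) rho0)" if v: "v \<in> ?V" "v' \<in> ?V" for v v'
    proof -
      obtain a a' where "v = (\<Sum>k\<in>UNIV. a k *\<^sub>R hook (axis k 1) rho0)" "v' = (\<Sum>k\<in>UNIV. a' k *\<^sub>R hook (axis k 1) rho0)"
        using v by blast
      then show ?thesis
        by (intro exI[of _ "\<lambda>k. a k + a' k"]) (simp add: scaleR_add_left sum.distrib)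
    qed
    moreover have "\<exists>a. c *\<^sub>R v = (\<Sum>k\<in>UNIV. a k *\<^sub>R hook (axis k 1) rho0)" if v: "v \<in> ?V" for c v
    proof -
      obtain a where "v = (\<Sum>k\<in>UNIV. a k *\<^sub>R hook (axis k 1) rho0)"
        using v by blast
      then show ?thesis
        by (intro exI[of _ "\<lambda>k. c * a k"]) (simp add: scaleR_sum_right)
    qed
    moreover have "0 \<in> ?V"
      using exI[of "\<lambda>a. 0 = (\<Sum>k\<in>UNIV. a k *\<^sub>R hook (axis k 1) rho0)" "\<lambda>_. 0"] by simp
    ultimately show "subspace ?V"
      unfolding subspace_def by blast
  qed
  ultimately obtain a where a: "\<beta>2 = (\<Sum>k\<in>UNIV. a k *\<^sub>R hook (axis k 1) rho0)"
    by blast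
  have "form_eval \<beta> [axis i 1, axis j 1] = form_eval \<beta>2 [axis i 1, axis j 1]" for i j
    by (simp add: form_eval_2_basis coeff2_def \<beta>2_def)
  then show ?thesis
    by (intro that[of a])
      (simp only: a linear_sum[OF linear_form_eval] form_eval_linear form_eval_hook[of rho0])
qed

section \<open>Adapted bases\<close>

locale adapted_basis =
  fixes \<gamma> :: "R8 \<Rightarrow> R8 \<Rightarrow> real" and \<rho> :: "R8 \<Rightarrow> R8 \<Rightarrow> R8 \<Rightarrow> real" and E :: "8 \<Rightarrow> R8"
  assumes bilinear_metric: "bilinear \<gamma>"
    and metric_sym: "\<gamma> u v = \<gamma> v u"
    and orthonormal: "\<gamma> (E i) (E j) = (if i = j then 1 else 0)"
    and det_frame: "det (\<chi> i. E i) \<noteq> 0"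
    and lin1: "linear (\<lambda>u. \<rho> u v w)" and lin2: "linear (\<lambda>v. \<rho> u v w)" and lin3: "linear (\<lambda>w. \<rho> u v w)"
    and alt12: "\<rho> u u v = 0" and alt23: "\<rho> v u u = 0"
    and rho_frame: "\<rho> (E i) (E j) (E k) = form_eval rho0 [axis i 1, axis j 1, axis k 1]"
begin

lemmas metric_simps = bilinear_simps[OF bilinear_metric]
lemmas rho_simps = linear_add[OF lin1] linear_scale[OF lin1] linear_diff[OF lin1] linear_neg[OF lin1]
  linear_add[OF lin2] linear_scale[OF lin2] linear_diff[OF lin2] linear_neg[OF lin2]
  linear_add[OF lin3] linear_scale[OF lin3] linear_diff[OF lin3] linear_neg[OF lin3]

lemma expand: "u = (\<Sum>i\<in>UNIV. \<gamma> u (E i) *\<^sub>R E i)"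
proof -
  let ?A = "transpose (\<chi> i. E i) :: real^8^8"
  have "invertible ?A"
    using det_frame by (simp add: invertible_det_nz)
  then obtain B where "?A ** B = mat 1"
    unfolding invertible_def by blast
  then have "u = ?A *v (B *v u)"
    by (simp add: matrix_vector_mul_assoc)
  then obtain c where "u = ?A *v c"
    by blast
  also have "?A *v c = (\<Sum>i\<in>UNIV. c $ i *\<^sub>R E i)"
    by (simp add: matrix_mult_sum scalar_mult_eq_scaleR column_def transpose_def)
  finally have u: "u = (\<Sum>i\<in>UNIV. c $ i *\<^sub>R E i)" .
  have lin: "linear (\<lambda>u. \<gamma> u v)" for v
    using bilinear_metric by (simp add: bilinear_def)
  have "\<gamma> u (E j) = c $ j" for j
    unfolding u linear_sum[OF lin] by (simp add: metric_simps orthonormal if_distrib cong: if_cong)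
  then show ?thesis
    using u by simp
qed

lemma frame_eqI: "linear f \<Longrightarrow> (\<And>i. f (E i) = 0) \<Longrightarrow> f u = 0"
  by (subst expand) (simp add: linear_sum linear_scale)

text \<open>\<rho> with its last index raised. Although written in the frame, it is characterised
  without it by \<open>metric_br\<close>.\<close>

definition br where "br u v = (\<Sum>k\<in>UNIV. \<rho> u v (E k) *\<^sub>R E k)"

text \<open>Rescaling \<open>E 7\<close> absorbs the \<open>sqrt 3\<close> in
  \<open>rho0\<close>.\<close>

definition b where "b i = (if i = 7 then sqrt 3 *\<^sub>R E 7 else E i)"

lemma metric_br: "\<gamma> (br u v) w = \<rho> u v w"
proof -
  have lin: "linear (\<gamma> w)"
    using bilinear_metric by (simp add: bilinear_def)
  have "\<gamma> (br u v) w = \<gamma> w (br u v)"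
    by (rule metric_sym)
  also have "\<dots> = (\<Sum>k\<in>UNIV. \<gamma> w (E k) * \<rho> u v (E k))"
    by (simp add: br_def linear_sum[OF lin] metric_simps mult.commute)
  also have "\<dots> = \<rho> u v (\<Sum>k\<in>UNIV. \<gamma> w (E k) *\<^sub>R E k)"
    by (simp add: linear_sum[OF lin3] rho_simps)
  finally show ?thesis
    by (simp flip: expand)
qed

lemma rho_skew: "\<rho> u v w = - \<rho> v u w" "\<rho> u v w = - \<rho> u w v"
proof -
  have "\<rho> u v w + \<rho> v u w = 0" "\<rho> u v w + \<rho> u w v = 0"
  proof -
    have "\<rho> (u + v) (u + v) w = 0" "\<rho> u (v + w) (v + w) = 0"
      by (rule alt12, rule alt23)
    then have "\<rho> u u w + \<rho> v u w + (\<rho> u v w + \<rho> v v w) = 0"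
      "\<rho> u v v + \<rho> u w v + (\<rho> u v w + \<rho> u w w) = 0"
      by (simp_all only: rho_simps)
    then show "\<rho> u v w + \<rho> v u w = 0" "\<rho> u v w + \<rho> u w v = 0"
      by (simp_all add: alt12 alt23)
  qed
  then show "\<rho> u v w = - \<rho> v u w" "\<rho> u v w = - \<rho> u w v"
    by linarith+
qed

sublocale psu3_algebra \<gamma> br b
proof
  show "bilinear \<gamma>" "\<gamma> u v = \<gamma> v u" for u v
    by (fact bilinear_metric, fact metric_sym)
  show ip_b: "\<gamma> (b i) (b j) = (if i = j then if i = 7 then 3 else 1 else 0)" for i j
    by (auto simp: b_def metric_simps orthonormal)
  show "x = (\<Sum>i\<in>UNIV. (\<gamma> x (b i) / \<gamma> (b i) (b i)) *\<^sub>R b i)" for x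
  proof -
    have "(\<gamma> x (b i) / \<gamma> (b i) (b i)) *\<^sub>R b i = \<gamma> x (E i) *\<^sub>R E i" for i
      unfolding ip_b by (simp add: b_def metric_simps)
    then show ?thesis
      by (simp flip: expand)
  qed
  show "bilinear br"
    by (auto simp: bilinear_def br_def rho_simps scaleR_add_left sum.distrib scaleR_sum_right intro!: linearI)
  show "br x y = - br y x" for x y
    by (simp add: br_def rho_skew(1)[of x y] sum_negf)
  show "\<gamma> (br x y) z = \<gamma> x (br y z)" for x y z
    using rho_skew(1)[of y x z] rho_skew(2)[of y x z]
    by (simp add: metric_br metric_sym[of x])
  show
    "br (b 0) (b 1) = b 6 + b 7" "br (b 0) (b 2) = - b 5"
    "br (b 0) (b 3) = - b 4" "br (b 0) (b 4) = b 3"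
    "br (b 0) (b 5) = b 2" "br (b 0) (b 6) = - b 1"
    "br (b 0) (b 7) = - (3 *\<^sub>R b 1)" "br (b 1) (b 2) = - b 4"
    "br (b 1) (b 3) = b 5" "br (b 1) (b 4) = b 2"
    "br (b 1) (b 5) = - b 3" "br (b 1) (b 6) = b 0"
    "br (b 1) (b 7) = 3 *\<^sub>R b 0" "br (b 2) (b 3) = b 6 - b 7"
    "br (b 2) (b 4) = - b 1" "br (b 2) (b 5) = - b 0"
    "br (b 2) (b 6) = - b 3" "br (b 2) (b 7) = 3 *\<^sub>R b 3"
    "br (b 3) (b 4) = - b 0" "br (b 3) (b 5) = b 1"
    "br (b 3) (b 6) = b 2" "br (b 3) (b 7) = - (3 *\<^sub>R b 2)"
    "br (b 4) (b 5) = - (2 *\<^sub>R b 6)" "br (b 4) (b 6) = 2 *\<^sub>R b 5"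
    "br (b 4) (b 7) = 0" "br (b 5) (b 6) = - (2 *\<^sub>R b 4)"
    "br (b 5) (b 7) = 0" "br (b 6) (b 7) = 0"
    by (simp_all add: br_def b_def sum_8 rho_simps rho_frame form_eval_rho0 det3_def axis_def)
qed

lemma metric_eqI: "(\<And>w. \<gamma> u w = \<gamma> v w) \<Longrightarrow> u = v"
  by (rule ip_eqI)

lemma metric_frame_eqI:
  assumes "\<And>j. \<gamma> u (E j) = \<gamma> v (E j)"
  shows "u = v"
  using assms expand[of u] expand[of v] by simp

text \<open>For a metric-skew operator, annihilating \<rho> is the Leibniz rule for
  \<open>br\<close> with the last index lowered.\<close>

lemma inner_derivation_rho:
  assumes "linear A" "\<And>u v. \<gamma> (A u) v + \<gamma> u (A v) = 0"
    and "\<And>u v w. \<rho> (A u) v w + \<rho> u (A v) w + \<rho> u v (A w) = 0"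
  obtains a where "\<And>u. A u = br a u"
proof (rule skew_derivation_inner[OF assms(1)])
  show "\<gamma> (A u) v = - \<gamma> u (A v)" for u v
    using assms(2)[of u v] by simp
  show "A (br u v) = br (A u) v + br u (A v)" for u v
  proof (rule metric_eqI)
    fix w
    have "\<gamma> (A (br u v)) w = - \<rho> u v (A w)"
      using assms(2)[of "br u v" w] by (simp add: metric_br)
    then show "\<gamma> (A (br u v)) w = \<gamma> (br (A u) v + br u (A v)) w"
      using assms(3)[of u v w] by (simp add: metric_br metric_simps)
  qed
qed (use that in blast)

lemma rho_br_invariant: "\<rho> (br a u) v w + \<rho> u (br a v) w + \<rho> u v (br a w) = 0"
proof -
  have "\<rho> (br a u) v w + \<rho> u (br a v) w = \<gamma> (br a (br u v)) w"
    by (simp add: metric_simps jacobi[of a u v] flip: metric_br)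
  moreover have "\<rho> u v (br a w) = - \<gamma> (br a (br u v)) w"
    using br_skew[of "br u v" a] by (simp add: metric_simps flip: metric_br ip_br)
  ultimately show ?thesis by simp
qed

end

section \<open>A parallel PSU(3)-structure with parallel torsion in one chart\<close>

locale psu3_chart = connection_chart U D for U :: "R8 set" and D +
  fixes \<gamma> :: "R8 \<Rightarrow> R8 \<Rightarrow> R8 \<Rightarrow> real" and \<rho> :: "R8 \<Rightarrow> R8 \<Rightarrow> R8 \<Rightarrow> R8 \<Rightarrow> real"
  assumes metric_smooth: "smooth_on U (\<lambda>x. \<gamma> x a b)"
    and rho_smooth: "smooth_on U (\<lambda>x. \<rho> x a b c)"
    and adapted: "x \<in> U \<Longrightarrow> \<exists>E. adapted_basis (\<gamma> x) (\<rho> x) E"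
    and metric_parallel: "x \<in> U \<Longrightarrow>
      frechet_derivative (\<lambda>y. \<gamma> y a b) (at x) w = \<gamma> x (D x w a) b + \<gamma> x a (D x w b)"
    and rho_parallel: "x \<in> U \<Longrightarrow> frechet_derivative (\<lambda>y. \<rho> y a b c) (at x) w
      = \<rho> x (D x w a) b c + \<rho> x a (D x w b) c + \<rho> x a b (D x w c)"
    and torsion_parallel: "x \<in> U \<Longrightarrow>
      dT x w a b + D x w (T x a b) - T x (D x w a) b - T x a (D x w b) = 0"
begin

lemma S_eq_zero:
  assumes x: "x \<in> U"
  shows "S x w a b c = 0"
proof -
  obtain E where "adapted_basis (\<gamma> x) (\<rho> x) E"
    using adapted[OF x] by blast
  then interpret adapted_basis "\<gamma> x" "\<rho> x" E .
  \<comment> \<open>Linearity is recorded on all of \<open>U\<close>, because the invariance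
    identities for \<open>R\<close> are differentiated to obtain those for \<open>S\<close>.\<close>
  have metric_lin: "bilinear (\<gamma> y)"
    and rho_lin: "linear (\<lambda>a. \<rho> y a b c)" "linear (\<lambda>b. \<rho> y a b c)" "linear (\<lambda>c. \<rho> y a b c)"
    if "y \<in> U" for y a b c
    using adapted[OF that] unfolding adapted_basis_def by blast+
  note metric_facts = metric_lin metric_smooth metric_parallel
  note rho_facts = rho_lin rho_smooth rho_parallel
  have "\<exists>r. \<forall>c. R x a b c = br r c" for a b
    by (rule inner_derivation_rho[OF linear_R(1)[OF x, of a b] R_skew_parallel2[OF metric_facts x]
        R_parallel3[OF rho_facts x]]) blast+
  then obtain r where r: "\<And>a b c. R x a b c = br (r a b) c"
    by metis
  have "\<exists>s. \<forall>c. S x w a b c = br s c" for w a b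
    by (rule inner_derivation_rho[OF linear_S[OF x, of w a b] S_skew_parallel2[OF metric_facts x]
        S_parallel3[OF rho_facts x]]) blast+
  then obtain s where s: "\<And>w a b c. S x w a b c = br (s w a b) c"
    by metis
  note R_lin = linear_R[OF x, THEN linear_add] linear_R[OF x, THEN linear_scale]
  note S_lin = linear_S_direction[OF x, THEN linear_add] linear_S_direction[OF x, THEN linear_scale]
  \<comment> \<open>The facts about \<open>R\<close> and \<open>S\<close> are operator identities;
    \<open>center_trivial\<close> strips off the bracket where an identity between elements of the
    algebra is required.\<close>
  have "s w a b = 0"
  proof (rule curvature_derivative_zero[of "T x" r s])
    show "bilinear (T x)"
      by (rule bilinear_T[OF x])
    show "bilinear r"
      unfolding bilinear_def
      by (intro conjI allI linearI; rule center_trivial) (simp_all add: br_simps R_lin flip: r)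
    show "linear (\<lambda>w. s w a b)" for a b
      by (intro linearI; rule center_trivial) (simp_all add: br_simps S_lin flip: s)
    show "r a b = - r b a" for a b
      by (rule center_trivial, insert R_skew[OF x, of a b], simp add: br_simps flip: r)
    show "s w a b = - s w b a" for w a b
      by (rule center_trivial, insert S_skew[OF x, of w a b], simp add: br_simps flip: s)
    show "br (s w a b) (T x c d) = T x (br (s w a b) c) d + T x c (br (s w a b) d)" for w a b c d
      using S_derivation_T[OF torsion_parallel x] by (simp flip: s)
    show "br (r a b) c + br (r b c) a + br (r c a) b = T x (T x a b) c + T x (T x b c) a + T x (T x c a) b" for a b c
      using bianchi1_parallel[OF torsion_parallel x] by (simp flip: r)
    show "br (s w a b) c + br (s w b c) a + br (s w c a) b = 0" for w a b c
      using S_bianchi1[OF torsion_parallel x] by (simp flip: s)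
    show "s a b c + s b c a + s c a b + (r (T x a b) c + r (T x b c) a + r (T x c a) b) = 0" for a b c
      by (rule center_trivial, insert bianchi2[OF x, of a b c], simp add: br_simps flip: r s)
  qed
  then show ?thesis
    by (simp add: s br_simps)
qed

end

section \<open>The characteristic connection\<close>

lemma tensor_field_2:
  assumes "tensor_field A 2 S" "c \<in> A"
  shows "smooth_on (img c) (\<lambda>x. S c x [u, v])"
    and "x \<in> img c \<Longrightarrow> bilinear (\<lambda>u v. S c x [u, v])"
proof -
  have *: "smooth_on (img c) (\<lambda>x. S c x us) \<and> (\<forall>x\<in>img c. \<forall>i<2. linear (\<lambda>v. S c x (us[i := v])))"
    if "length us = 2" for us
    using assms that unfolding tensor_field_def by blast
  show "smooth_on (img c) (\<lambda>x. S c x [u, v])"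
    using *[of "[u, v]"] by simp
  show "bilinear (\<lambda>u v. S c x [u, v])" if "x \<in> img c"
  proof -
    have "linear (\<lambda>w. S c x ([u, v][i := w]))" if "i < 2" for i u v
      using *[of "[u, v]"] that \<open>x \<in> img c\<close> by auto
    from this[of 0] this[of 1] show ?thesis
      by (simp add: bilinear_def)
  qed
qed

lemma tensor_field_3:
  assumes "tensor_field A 3 S" "c \<in> A"
  shows "smooth_on (img c) (\<lambda>x. S c x [u, v, w])"
    and "x \<in> img c \<Longrightarrow> linear (\<lambda>u. S c x [u, v, w])"
    and "x \<in> img c \<Longrightarrow> linear (\<lambda>v. S c x [u, v, w])"
    and "x \<in> img c \<Longrightarrow> linear (\<lambda>w. S c x [u, v, w])"
proof -
  have *: "smooth_on (img c) (\<lambda>x. S c x us) \<and> (\<forall>x\<in>img c. \<forall>i<3. linear (\<lambda>v. S c x (us[i := v])))"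
    if "length us = 3" for us
    using assms that unfolding tensor_field_def by blast
  show "smooth_on (img c) (\<lambda>x. S c x [u, v, w])"
    using *[of "[u, v, w]"] by simp
  have "linear (\<lambda>z. S c x ([u, v, w][i := z]))" if "i < 3" "x \<in> img c" for i
    using *[of "[u, v, w]"] that by auto
  from this[of 0] this[of 1] this[of 2]
  show "x \<in> img c \<Longrightarrow> linear (\<lambda>u. S c x [u, v, w])"
    "x \<in> img c \<Longrightarrow> linear (\<lambda>v. S c x [u, v, w])"
    "x \<in> img c \<Longrightarrow> linear (\<lambda>w. S c x [u, v, w])"
    by (simp_all add: numeral_2_eq_2)
qed

lemma cov_tensor_unfold:
  "cov_tensor D S c x u [v1, v2] = frechet_derivative (\<lambda>y. S c y [v1, v2]) (at x) u
    - (S c x [D c x u v1, v2] + S c x [v1, D c x u v2])"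
  "cov_tensor D S c x u [v1, v2, v3] = frechet_derivative (\<lambda>y. S c y [v1, v2, v3]) (at x) u
    - (S c x [D c x u v1, v2, v3] + S c x [v1, D c x u v2, v3] + S c x [v1, v2, D c x u v3])"
  "cov_tensor D S c x u [v1, v2, v3, v4] = frechet_derivative (\<lambda>y. S c y [v1, v2, v3, v4]) (at x) u
    - (S c x [D c x u v1, v2, v3, v4] + S c x [v1, D c x u v2, v3, v4]
      + S c x [v1, v2, D c x u v3, v4] + S c x [v1, v2, v3, D c x u v4])"
  by (simp_all add: cov_tensor_def lessThan_Suc)

lemma has_derivative_trilinear_family:
  fixes f h k :: "'a::real_normed_vector \<Rightarrow> 'b::euclidean_space" and P :: "'a \<Rightarrow> 'b \<Rightarrow> 'b \<Rightarrow> 'b \<Rightarrow> 'c::real_normed_vector"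
  assumes U: "open U" "x \<in> U"
    and lin: "\<And>y b c. y \<in> U \<Longrightarrow> linear (\<lambda>a. P y a b c)" "\<And>y a c. y \<in> U \<Longrightarrow> linear (\<lambda>b. P y a b c)"
      "\<And>y a b. y \<in> U \<Longrightarrow> linear (\<lambda>c. P y a b c)"
    and P': "\<And>a b c. ((\<lambda>y. P y a b c) has_derivative (\<lambda>w. P' w a b c)) (at x)"
    and f: "(f has_derivative f') (at x)" and h: "(h has_derivative h') (at x)" and k: "(k has_derivative k') (at x)"
  shows "((\<lambda>y. P y (f y) (h y) (k y)) has_derivative
    (\<lambda>w. P' w (f x) (h x) (k x) + P x (f' w) (h x) (k x) + P x (f x) (h' w) (k x) + P x (f x) (h x) (k' w))) (at x)"
proof -
  have "((\<lambda>y. P y (f y) (h y) c) has_derivative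
    (\<lambda>w. P' w (f x) (h x) c + P x (f' w) (h x) c + P x (f x) (h' w) c)) (at x)" for c
    by (rule has_derivative_bilinear_family[where B = "\<lambda>y a b. P y a b c" and B' = "\<lambda>w a b. P' w a b c", OF U _ P' f h])
      (simp add: bilinear_def lin)
  from has_derivative_linear_family[where L = "\<lambda>y. P y (f y) (h y)", OF U lin(3) this k] show ?thesis .
qed

lemma sum_W_components: "(\<Sum>i=1..6. G i) = G 1 + G 2 + G 3 + (G 4 + G 5) + G (6::nat)"
  for G :: "nat \<Rightarrow> tform"
  by (simp add: eval_nat_numeral add.assoc)

locale characteristic_chart =
  fixes M :: "'m topology" and A :: "'m chart set" and g \<rho> :: "'m tensor" and Dg Dc :: "'m connection"
    and c :: "'m chart"
  assumes psu3: "psu3_structure M A g \<rho>"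
    and levi_civita: "levi_civita A g Dg"
    and characteristic: "characteristic_connection A g \<rho> Dg Dc"
    and chart: "c \<in> A"
begin

lemma tensors: "tensor_field A 2 g" "tensor_field A 3 \<rho>"
  using psu3 unfolding psu3_structure_def riemannian_metric_def three_form_def by auto

lemma affine: "affine_connection A Dg" "affine_connection A Dc"
  using levi_civita characteristic unfolding levi_civita_def characteristic_connection_def by auto

lemma open_chart: "open (img c)"
  using psu3 chart unfolding psu3_structure_def oriented_manifold_def by blast

lemma connection_chart_D:
  assumes "affine_connection A D"
  shows "connection_chart (img c) (D c)"
  using assms chart open_chart unfolding affine_connection_def by unfold_locales auto

lemma adapted_frame_basis:
  assumes "x \<in> img c" "adapted_frame g \<rho> c x E"
  shows "adapted_basis (\<lambda>u v. g c x [u, v]) (\<lambda>u v w. \<rho> c x [u, v, w]) E"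
proof (rule adapted_basis.intro)
  show "g c x [u, v] = g c x [v, u]" for u v
    using psu3 chart assms(1) unfolding psu3_structure_def riemannian_metric_def by blast
  show "\<rho> c x [u, u, v] = 0" "\<rho> c x [v, u, u] = 0" for u v
    using psu3 chart assms(1) unfolding psu3_structure_def three_form_def by blast+
qed (use assms tensor_field_2(2)[OF tensors(1) chart] tensor_field_3[OF tensors(2) chart]
    in \<open>auto simp: adapted_frame_def\<close>)

text \<open>The contorsion is skew and \<open>Dg\<close> is metric.\<close>

lemma metric_parallel:
  assumes x: "x \<in> img c"
  shows "frechet_derivative (\<lambda>y. g c y [a, b]) (at x) w = g c x [Dc c x w a, b] + g c x [a, Dc c x w b]"
proof -
  obtain e T F where diff: "\<And>u v w. g c x [Dc c x u v, w] = g c x [Dg c x u v, w]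
      + 1/2 * form_eval T [frame_components g c x e u, frame_components g c x e v, frame_components g c x e w]
      + form_eval (sigma 2 (hook (frame_components g c x e u) rho0) F)
          [frame_components g c x e v, frame_components g c x e w]"
    using characteristic chart x unfolding characteristic_connection_def Let_def by metis
  have sym: "g c x [u, v] = g c x [v, u]" for u v
    using psu3 chart x unfolding psu3_structure_def riemannian_metric_def by blast
  have "cov_tensor Dg g c x w [a, b] = 0"
    using levi_civita chart x unfolding levi_civita_def parallel_def by simp
  then have "frechet_derivative (\<lambda>y. g c y [a, b]) (at x) w = g c x [Dg c x w a, b] + g c x [Dg c x w b, a]"
    using sym[of a "Dg c x w b"] by (simp add: cov_tensor_unfold)
  moreover have "g c x [Dc c x w a, b] + g c x [Dc c x w b, a] = g c x [Dg c x w a, b] + g c x [Dg c x w b, a]"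
    unfolding diff form_eval_hook[of T]
    using form_eval_2_skew[of _ "frame_components g c x e a" "frame_components g c x e b"] by simp
  ultimately show ?thesis
    using sym[of a "Dc c x w b"] by simp
qed

text \<open>In an adapted frame the connection matrix of \<open>Dc\<close> is orthogonal to \<open>Lam2_20\<close>, hence
  is a bracket operator.\<close>

lemma characteristic_connection_inner:
  assumes x: "x \<in> img c"
  obtains e where "local_adapted_frame g \<rho> c x e"
    "\<And>k. \<exists>a. \<forall>i. cov Dc c (e k) (e i) x
      = adapted_basis.br (\<lambda>u v w. \<rho> c x [u, v, w]) (\<lambda>i. e i x) a (e i x)"
proof -
  obtain e G T F where frame: "local_adapted_frame g \<rho> c x e"
    and W: "W_components (intrinsic_torsion g Dg c x e) G" "G 6 = 0"
    and TF: "characteristic_forms G T F"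
    and diff: "\<And>u v w. g c x [Dc c x u v, w] = g c x [Dg c x u v, w]
      + 1/2 * form_eval T [frame_components g c x e u, frame_components g c x e v, frame_components g c x e w]
      + form_eval (sigma 2 (hook (frame_components g c x e u) rho0) F)
          [frame_components g c x e v, frame_components g c x e w]"
    using characteristic chart x unfolding characteristic_connection_def Let_def by metis
  obtain V where V: "open V" "x \<in> V" "V \<subseteq> img c" "\<And>i. smooth_on V (e i)"
    "\<And>y. y \<in> V \<Longrightarrow> adapted_frame g \<rho> c y (\<lambda>i. e i y)"
    using frame unfolding local_adapted_frame_def by blast
  interpret adapted_basis "\<lambda>u v. g c x [u, v]" "\<lambda>u v w. \<rho> c x [u, v, w]" "\<lambda>i. e i x"
    by (rule adapted_frame_basis[OF x V(5)[OF V(2)]])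
  have comp: "frame_components g c x e (e k x) = axis k 1" for k
    by (simp add: frame_components_def orthonormal axis_def vec_eq_iff)
  define a where "a k i j = g c x [cov Dg c (e k) (e i) x, e j x]" for k i j
  \<comment> \<open>Differentiate the constant functions g(e_i, e_j), using that \<open>Dg\<close>
    is metric.\<close>
  have a_skew: "a k i j = - a k j i" for k i j
  proof -
    have g': "((\<lambda>y. g c y [u, v]) has_derivative (\<lambda>w. g c x [Dg c x w u, v] + g c x [u, Dg c x w v])) (at x)" for u v
    proof -
      have "cov_tensor Dg g c x w [u, v] = 0" for w
        using levi_civita chart x unfolding levi_civita_def parallel_def by simp
      then have "frechet_derivative (\<lambda>y. g c y [u, v]) (at x)
          = (\<lambda>w. g c x [Dg c x w u, v] + g c x [u, Dg c x w v])"
        by (simp add: cov_tensor_unfold fun_eq_iff)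
      then show ?thesis
        using smooth_on_has_derivative[OF tensor_field_2(1)[OF tensors(1) chart, of u v] x] by (simp only:)
    qed
    have e': "(e i has_derivative frechet_derivative (e i) (at x)) (at x)" for i
      by (rule smooth_on_has_derivative[OF V(4,2)])
    have "g c y [e i y, e j y] = (if i = j then 1 else 0)" if "y \<in> V" for y
      using V(5)[OF that] by (simp add: adapted_frame_def)
    note has_derivative_unique_open[OF V(1,2) this has_derivative_bilinear_family[where
        B = "\<lambda>y u v. g c y [u, v]", OF V(1,2) _ g' e'[of i] e'[of j]] has_derivative_const, of "e k x"]
    then have "g c x [Dg c x (e k x) (e i x), e j x] + g c x [e i x, Dg c x (e k x) (e j x)]
        + g c x [frechet_derivative (e i) (at x) (e k x), e j x] + g c x [e i x, frechet_derivative (e j) (at x) (e k x)] = 0"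
      using tensor_field_2(2)[OF tensors(1) chart] V(3) by auto
    then show ?thesis
      unfolding a_def cov_def
      by (simp add: metric_simps metric_sym[of "e i x" "Dg c x (e k x) (e j x)"]
          metric_sym[of "e i x" "frechet_derivative (e j) (at x) (e k x)"])
  qed
  have ex: "\<exists>A. \<forall>i. cov Dc c (e k) (e i) x = br A (e i x)" for k
  proof -
    let ?\<omega> = "connection_form g Dg c x e k" and ?T = "hook (axis k 1) T" and ?F = "sigma 2 (hook (axis k 1) rho0) F"
    \<comment> \<open>The connection form of \<open>Dc\<close> in direction \<open>e k\<close>:
      Levi-Civita form plus contorsion. The factors -1/2 and -1 in \<open>Theta1\<close> and
      \<open>Theta2\<close> are opposite to those of the contorsion, and \<open>G 6 = 0\<close>, so
      its projection by \<open>pr_m\<close> cancels.\<close>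
    define \<beta> where "\<beta> = ?\<omega> + (1/2) *\<^sub>R ?T + ?F"
    have "intrinsic_torsion g Dg c x e = Theta1 T + Theta2 F"
      using W TF unfolding W_components_def characteristic_forms_def sum_W_components by simp
    from arg_cong[OF this, of "\<lambda>G. G $ k"]
    have pr: "pr_m ?\<omega> = - (1/2) *\<^sub>R pr_m ?T - pr_m ?F"
      by (simp add: intrinsic_torsion_def Theta1_def Theta2_def)
    have orth: "\<beta> \<bullet> \<zeta> = 0" if "\<zeta> \<in> Lam2_20" for \<zeta>
    proof -
      have "\<beta> \<bullet> \<zeta> = (pr_m ?\<omega> + (1/2) *\<^sub>R pr_m ?T + pr_m ?F) \<bullet> \<zeta>"
        using pr_m_orthogonal[OF that, of ?\<omega>] pr_m_orthogonal[OF that, of ?T] pr_m_orthogonal[OF that, of ?F]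
        by (simp add: \<beta>_def inner_diff_left inner_add_left)
      then show ?thesis
        by (simp add: pr)
    qed
    obtain h where h: "\<And>i j. form_eval \<beta> [axis i 1, axis j 1]
        = (\<Sum>n\<in>UNIV. h n * form_eval rho0 [axis n 1, axis i 1, axis j 1])"
      by (rule orthogonal_Lam2_20[OF orth]) (assumption | rule that | blast)+
    \<comment> \<open>The coefficients of \<beta> in the forms \<open>hook (axis n 1) rho0\<close>
      are the frame components of the acting element.\<close>
    have "cov Dc c (e k) (e i) x = br (\<Sum>n\<in>UNIV. h n *\<^sub>R e n x) (e i x)" for i
    proof (rule metric_frame_eqI)
      fix j
      have connection: "form_eval ?\<omega> [axis i 1, axis j 1] = a k i j"
        unfolding connection_form_def a_def[symmetric] by (rule connection_matrix_form[OF a_skew])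
      have "g c x [cov Dc c (e k) (e i) x, e j x] = a k i j
          + (1/2 * form_eval T [axis k 1, axis i 1, axis j 1] + form_eval ?F [axis i 1, axis j 1])"
        unfolding a_def cov_def using diff[of "e k x" "e i x" "e j x"] by (simp add: metric_simps comp)
      also have "\<dots> = form_eval \<beta> [axis i 1, axis j 1]"
        unfolding \<beta>_def by (simp add: form_eval_linear connection form_eval_hook[of T])
      also have "\<dots> = \<rho> c x [\<Sum>n\<in>UNIV. h n *\<^sub>R e n x, e i x, e j x]"
        by (simp add: h linear_sum[OF lin1] linear_scale[OF lin1] rho_frame)
      finally show "g c x [cov Dc c (e k) (e i) x, e j x]
          = g c x [br (\<Sum>n\<in>UNIV. h n *\<^sub>R e n x) (e i x), e j x]"
        by (simp add: metric_br)
    qed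
    then show ?thesis by blast
  qed
  show ?thesis
    by (rule that[OF frame]) (rule ex)
qed

text \<open>The covariant derivative \<open>N\<close> of \<rho> is linear in all four arguments, so
  it suffices to compute it on an adapted frame.\<close>

lemma rho_parallel:
  assumes x: "x \<in> img c"
  shows "frechet_derivative (\<lambda>y. \<rho> c y [u1, u2, u3]) (at x) w
    = \<rho> c x [Dc c x w u1, u2, u3] + \<rho> c x [u1, Dc c x w u2, u3] + \<rho> c x [u1, u2, Dc c x w u3]"
proof -
  obtain e where frame: "local_adapted_frame g \<rho> c x e"
    and inner: "\<And>k. \<exists>a. \<forall>i. cov Dc c (e k) (e i) x
      = adapted_basis.br (\<lambda>u v w. \<rho> c x [u, v, w]) (\<lambda>i. e i x) a (e i x)"
    using characteristic_connection_inner[OF x] by blast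
  obtain V where V: "open V" "x \<in> V" "V \<subseteq> img c" "\<And>i. smooth_on V (e i)"
    "\<And>y. y \<in> V \<Longrightarrow> adapted_frame g \<rho> c y (\<lambda>i. e i y)"
    using frame unfolding local_adapted_frame_def by blast
  interpret adapted_basis "\<lambda>u v. g c x [u, v]" "\<lambda>u v w. \<rho> c x [u, v, w]" "\<lambda>i. e i x"
    by (rule adapted_frame_basis[OF x V(5)[OF V(2)]])
  interpret connection_chart "img c" "Dc c"
    by (rule connection_chart_D[OF affine(2)])
  let ?d = "\<lambda>w a1 a2 a3. frechet_derivative (\<lambda>y. \<rho> c y [a1, a2, a3]) (at x) w"
  define N where "N w a1 a2 a3 = ?d w a1 a2 a3
    - (\<rho> c x [Dc c x w a1, a2, a3] + \<rho> c x [a1, Dc c x w a2, a3] + \<rho> c x [a1, a2, Dc c x w a3])" for w a1 a2 a3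
  have \<rho>': "((\<lambda>y. \<rho> c y [a1, a2, a3]) has_derivative (\<lambda>w. ?d w a1 a2 a3)) (at x)" for a1 a2 a3
    by (rule smooth_on_has_derivative[OF tensor_field_3(1)[OF tensors(2) chart] x])
  note \<rho>_lin = tensor_field_3(2-4)[OF tensors(2) chart]
  have d_lin: "linear (\<lambda>w. ?d w a1 a2 a3)" "linear (\<lambda>a1. ?d w a1 a2 a3)" "linear (\<lambda>a2. ?d w a1 a2 a3)"
    "linear (\<lambda>a3. ?d w a1 a2 a3)" for w a1 a2 a3
    by (rule has_derivative_linear[OF \<rho>']
        linear_derivative_family[where L = "\<lambda>y a1. \<rho> c y [a1, a2, a3]" and L' = "\<lambda>w a1. ?d w a1 a2 a3", OF open_U x \<rho>_lin(1) \<rho>']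
        linear_derivative_family[where L = "\<lambda>y a2. \<rho> c y [a1, a2, a3]" and L' = "\<lambda>w a2. ?d w a1 a2 a3", OF open_U x \<rho>_lin(2) \<rho>']
        linear_derivative_family[where L = "\<lambda>y a3. \<rho> c y [a1, a2, a3]" and L' = "\<lambda>w a3. ?d w a1 a2 a3", OF open_U x \<rho>_lin(3) \<rho>'];
        assumption)+
  note N_simps = N_def rho_simps bilinear_simps[OF bilinear_D[OF x]] d_lin[THEN linear_add] d_lin[THEN linear_scale]
  have N_lin: "linear (\<lambda>w. N w a1 a2 a3)" "linear (\<lambda>a1. N w a1 a2 a3)" "linear (\<lambda>a2. N w a1 a2 a3)"
    "linear (\<lambda>a3. N w a1 a2 a3)" for w a1 a2 a3
    by (intro linearI; simp add: N_simps algebra_simps)+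
  have "N (e k x) (e i x) (e j x) (e l x) = 0" for k i j l
  proof -
    have e': "(e i has_derivative frechet_derivative (e i) (at x)) (at x)" for i
      by (rule smooth_on_has_derivative[OF V(4,2)])
    \<comment> \<open>\<rho> has constant coefficients in the frame. Hence \<open>N\<close> there is
      minus the sum of the terms with covariant derivatives of frame vectors; these are brackets
      with one common \<open>a\<close>, and \<rho> is invariant under brackets.\<close>
    have const: "\<rho> c y [e i y, e j y, e l y] = form_eval rho0 [axis i 1, axis j 1, axis l 1]" if "y \<in> V" for y
      using V(5)[OF that] by (simp add: adapted_frame_def)
    have "((\<lambda>y. \<rho> c y [e i y, e j y, e l y]) has_derivative (\<lambda>w. ?d w (e i x) (e j x) (e l x)
      + \<rho> c x [frechet_derivative (e i) (at x) w, e j x, e l x]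
      + \<rho> c x [e i x, frechet_derivative (e j) (at x) w, e l x]
      + \<rho> c x [e i x, e j x, frechet_derivative (e l) (at x) w])) (at x)"
      by (rule has_derivative_trilinear_family[where P = "\<lambda>y a1 a2 a3. \<rho> c y [a1, a2, a3]" and P' = ?d,
            OF open_U x \<rho>_lin \<rho>' e' e' e'])
    from has_derivative_unique_open[OF V(1,2) const this has_derivative_const, of "e k x"]
    have "N (e k x) (e i x) (e j x) (e l x) = - (\<rho> c x [cov Dc c (e k) (e i) x, e j x, e l x]
      + \<rho> c x [e i x, cov Dc c (e k) (e j) x, e l x] + \<rho> c x [e i x, e j x, cov Dc c (e k) (e l) x])"
      by (simp add: N_def cov_def rho_simps)
    moreover obtain a where "\<And>i. cov Dc c (e k) (e i) x = br a (e i x)"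
      using inner by blast
    ultimately show ?thesis
      using rho_br_invariant by simp
  qed
  then have "N w (e i x) (e j x) (e l x) = 0" for w i j l
    using frame_eqI[OF N_lin(1)] by blast
  then have "N w a1 (e j x) (e l x) = 0" for w a1 j l
    using frame_eqI[OF N_lin(2)] by blast
  then have "N w a1 a2 (e l x) = 0" for w a1 a2 l
    using frame_eqI[OF N_lin(3)] by blast
  then have "N w a1 a2 a3 = 0" for w a1 a2 a3
    using frame_eqI[OF N_lin(4)] by blast
  then show ?thesis
    by (simp add: N_def)
qed

text \<open>The hypothesis concerns the torsion lowered with the metric. As \<open>Dc\<close> is
  metric, it says that the vector-valued \<open>T\<close> is parallel after pairing with an
  arbitrary vector.\<close>

lemma psu3_chart_Dc:
  assumes torsion: "parallel A Dc 3 (torsion_tensor g Dc)"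
  shows "psu3_chart (img c) (Dc c) (\<lambda>x u v. g c x [u, v]) (\<lambda>x u v w. \<rho> c x [u, v, w])"
proof -
  interpret connection_chart "img c" "Dc c"
    by (rule connection_chart_D[OF affine(2)])
  have adapted: "\<exists>E. adapted_basis (\<lambda>u v. g c x [u, v]) (\<lambda>u v w. \<rho> c x [u, v, w]) E" if "x \<in> img c" for x
    using psu3 chart adapted_frame_basis[OF that] that unfolding psu3_structure_def by blast
  show ?thesis
  proof
    show "smooth_on (img c) (\<lambda>x. g c x [u, v])" "smooth_on (img c) (\<lambda>x. \<rho> c x [u, v, w])" for u v w
      by (rule tensor_field_2(1)[OF tensors(1) chart] tensor_field_3(1)[OF tensors(2) chart])+
    fix x w a b
    assume x: "x \<in> img c"
    then obtain E where "adapted_basis (\<lambda>u v. g c x [u, v]) (\<lambda>u v w. \<rho> c x [u, v, w]) E"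
      using adapted by blast
    then interpret adapted_basis "\<lambda>u v. g c x [u, v]" "\<lambda>u v w. \<rho> c x [u, v, w]" E .
    show "dT x w a b + Dc c x w (T x a b) - T x (Dc c x w a) b - T x a (Dc c x w b) = 0"
    proof (rule metric_eqI)
      fix d
      have T: "torsion_tensor g Dc c y [u, v, d] = g c y [T y u v, d]" for y u v d
        by (simp add: torsion_tensor_def torsion_def cov_def lie_bracket_def T_def)
      have "((\<lambda>y. g c y [T y a b, d]) has_derivative (\<lambda>w. g c x [Dc c x w (T x a b), d]
          + g c x [T x a b, Dc c x w d] + g c x [dT x w a b, d])) (at x)"
        by (rule parallel2_slots(1)[where \<gamma> = "\<lambda>x u v. g c x [u, v]", OF tensor_field_2(2)[OF tensors(1) chart]
              tensor_field_2(1)[OF tensors(1) chart] metric_parallel x has_derivative_T_const[OF x]])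
      note frechet_derivative_at[OF this, symmetric]
      moreover have "cov_tensor Dc (torsion_tensor g Dc) c x w [a, b, d] = 0"
        using torsion chart x unfolding parallel_def by simp
      ultimately show "g c x [dT x w a b + Dc c x w (T x a b) - T x (Dc c x w a) b - T x a (Dc c x w b), d] = g c x [0, d]"
        by (simp add: cov_tensor_unfold T metric_simps)
    qed
  qed (use adapted metric_parallel rho_parallel in blast)+
qed

text \<open>Lowering an index with the parallel metric identifies the covariant derivative of
  \<open>curvature_tensor\<close> with \<open>S\<close>, which vanishes by
  \<open>S_eq_zero\<close>.\<close>

lemma cov_curvature_zero:
  assumes torsion: "parallel A Dc 3 (torsion_tensor g Dc)" and x: "x \<in> img c"
  shows "cov_tensor Dc (curvature_tensor g Dc) c x w [v1, v2, v3, v4] = 0"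
proof -
  interpret psu3_chart "img c" "Dc c" "\<lambda>x u v. g c x [u, v]" "\<lambda>x u v w. \<rho> c x [u, v, w]"
    by (rule psu3_chart_Dc[OF torsion])
  have R: "curvature_tensor g Dc c y [v1, v2, v3, v4] = g c y [R y v1 v2 v3, v4]" if "y \<in> img c" for y v1 v2 v3 v4
  proof -
    have "cov Dc c (\<lambda>_. u) (\<lambda>_. v) = (\<lambda>y. Dc c y u v)" for u v
      by (simp add: cov_def fun_eq_iff)
    moreover have "cov Dc c (\<lambda>_. u) (\<lambda>y. Dc c y v z) y = D1 y u v z + Dc c y u (Dc c y v z)" for u v z
      by (simp add: cov_def D1_def)
    moreover have "cov Dc c (lie_bracket (\<lambda>_. v1) (\<lambda>_. v2)) (\<lambda>_. v3) y = 0"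
      by (simp add: cov_def lie_bracket_def D_simps[OF that])
    ultimately show ?thesis
      by (simp add: curvature_tensor_def curvature_def R_def)
        (simp add: algebra_simps)
  qed
  have "((\<lambda>y. g c y [R y v1 v2 v3, v4]) has_derivative (\<lambda>w. g c x [Dc c x w (R x v1 v2 v3), v4]
      + g c x [R x v1 v2 v3, Dc c x w v4] + g c x [dR x w v1 v2 v3, v4])) (at x)"
    by (rule parallel2_slots(1)[where \<gamma> = "\<lambda>x u v. g c x [u, v]", OF tensor_field_2(2)[OF tensors(1) chart]
          tensor_field_2(1)[OF tensors(1) chart] metric_parallel x has_derivative_R_const[OF x]])
  \<comment> \<open>\<open>curvature_tensor\<close> is expressed by \<open>R\<close> on
    \<open>img c\<close> only; as this set is open, the derivatives still agree.\<close>
  then have "((\<lambda>y. curvature_tensor g Dc c y [v1, v2, v3, v4]) has_derivative (\<lambda>w. g c x [Dc c x w (R x v1 v2 v3), v4]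
      + g c x [R x v1 v2 v3, Dc c x w v4] + g c x [dR x w v1 v2 v3, v4])) (at x)"
    by (rule has_derivative_transform_within_open[OF _ open_U x]) (simp add: R)
  note frechet_derivative_at[OF this, symmetric]
  then have "cov_tensor Dc (curvature_tensor g Dc) c x w [v1, v2, v3, v4] = g c x [S x w v1 v2 v3, v4]"
    by (simp add: cov_tensor_unfold R[OF x] S_def bilinear_simps[OF tensor_field_2(2)[OF tensors(1) chart x]])
  then show ?thesis
    by (simp add: S_eq_zero[OF x] bilinear_simps[OF tensor_field_2(2)[OF tensors(1) chart x]])
qed

end

theorem proposition6p2:
  fixes M :: "'m topology" and A :: "'m chart set"
    and g \<rho> :: "'m tensor" and Dg Dc :: "'m connection"
  assumes "psu3_structure M A g \<rho>"
    and "levi_civita A g Dg"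
    and "\<not> psu3_integrable A g \<rho> Dg"
    and "of_type A g \<rho> Dg {1, 2, 3, 4, 5}"
    and "characteristic_connection A g \<rho> Dg Dc"
    and "parallel A Dc 3 (torsion_tensor g Dc)"
  shows "ambrose_singer A g Dc"
  unfolding ambrose_singer_def
proof
  show "parallel A Dc 3 (torsion_tensor g Dc)"
    by fact
  show "parallel A Dc 4 (curvature_tensor g Dc)"
    unfolding parallel_def
  proof (intro ballI allI impI)
    fix c x u and vs :: "R8 list"
    assume "c \<in> A" "x \<in> img c" "length vs = 4"
    then interpret characteristic_chart M A g \<rho> Dg Dc c
      using assms by unfold_locales
    obtain v1 v2 v3 v4 where "vs = [v1, v2, v3, v4]"
      using \<open>length vs = 4\<close> by (auto simp: eval_nat_numeral length_Suc_conv)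
    then show "cov_tensor Dc (curvature_tensor g Dc) c x u vs = 0"
      using cov_curvature_zero[OF assms(6) \<open>x \<in> img c\<close>] by simp
  qed
qed

end
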